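(* Let $q_0\in M$, $t_1>0$ and $q_1\in\mathcal{A}_{q_0}(t_1)$. Consider Euler's elastic problem with data $q_0,q_1,t_1$. (1) There exists an optimal control for Euler's elastic problem in the class $u(\cdot)\in L_2[0,t_1]$. (2) If an optimal control $u(\cdot)$ is not an abnormal extremal control, then $u(\cdot)\in L_\infty[0,t_1]$, and the corresponding optimal trajectory $q(\cdot)$ is Lipschitzian. (3) All optimal solutions to Euler's elastic problem satisfy the Pontryagin Maximum Principle.
   Context: Let $M=\mathbb{R}^2_{x,y}\times S^1_\theta$, $S^1=\mathbb{R}/2\pi\mathbb{Z}$. Euler's elastic problem with data $q_0,q_1\in M$, $t_1>0$ is the optimal control problem $$\dot x=\cos\theta,\quad \dot y=\sin\theta,\quad \dot\theta=u,\qquad q=(x,y,\theta)\in M,\ u\in\mathbb{R},$$ $$q(0)=q_0,\quad q(t_1)=q_1,\quad t_1 \text{ fixed},\qquad J=\frac12\int_0^{t_1}u^2(t)\,dt\to\min,$$ with controls $u\in L_2[0,t_1]$ and absolutely continuous trajectories. $\mathcal{A}_{q_0}(t_1)$ denotes the set of endpoints $q(t_1)$ of all trajectories with $q(0)=q_0$ corresponding to controls $u\in L_2[0,t_1]$. Pontryagin Maximum Principle (PMP): let $X_1=\cos\theta\,\partial_x+\sin\theta\,\partial_y$, $X_2=\partial_\theta$, $h_i(\lambda)=\langle\lambda,X_i\rangle$ for $\lambda\in T^*M$, $h_u^\nu(\lambda)=h_1(\lambda)+u h_2(\lambda)+\frac{\nu}{2}u^2$, let $\vec h_u^\nu$ be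 the Hamiltonian vector field of $h_u^\nu$ on $T^*M$ and $\pi:T^*M\to M$ the projection. A pair $(u(t),q(t))$, $t\in[0,t_1]$, satisfies the PMP if there exist an absolutely continuous curve $\lambda_t\in T^*M$ with $\pi(\lambda_t)=q(t)$ and a number $\nu\le0$ such that for almost all $t\in[0,t_1]$: $\dot\lambda_t=\vec h^\nu_{u(t)}(\lambda_t)$; $h^\nu_{u(t)}(\lambda_t)=\max_{v\in\mathbb{R}}h^\nu_v(\lambda_t)$; $(\nu,\lambda_t)\ne0$. A control is an abnormal extremal control if it satisfies the PMP for some $\lambda_t$ with $\nu=0$. *)

theory Defs
  imports "HOL-Analysis.Analysis"
begin

section \<open>The circle as the reals modulo \<open>2\<pi>\<close>\<close>

definition angle_eq :: "real \<Rightarrow> real \<Rightarrow> bool" where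
  "angle_eq a b \<longleftrightarrow> (\<exists>k::int. b = a + 2 * pi * of_int k)"

lemma equivp_angle_eq: "equivp angle_eq"
proof (rule equivpI)
  show "reflp angle_eq"
    unfolding reflp_def angle_eq_def by (intro allI exI[of _ 0]) simp
  show "symp angle_eq"
  proof (rule sympI)
    fix a b assume "angle_eq a b"
    then obtain k :: int where "b = a + 2 * pi * of_int k"
      by (auto simp: angle_eq_def)
    then show "angle_eq b a"
      unfolding angle_eq_def by (intro exI[of _ "- k"]) simp
  qed
  show "transp angle_eq"
  proof (rule transpI)
    fix a b c assume "angle_eq a b" "angle_eq b c"
    then obtain k l :: int where "b = a + 2 * pi * of_int k" "c = b + 2 * pi * of_int l"
      by (auto simp: angle_eq_def)
    then show "angle_eq a c"
      unfolding angle_eq_def by (intro exI[of _ "k + l"]) (simp add: algebra_simps)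
  qed
qed

quotient_type circle = real / angle_eq
  morphisms rep_angle angle
  by (rule equivp_angle_eq)

instantiation circle :: ab_group_add
begin

lift_definition zero_circle :: circle is 0 .

lift_definition plus_circle :: "circle \<Rightarrow> circle \<Rightarrow> circle" is "(+)"
proof -
  fix a a' b b' assume "angle_eq a a'" "angle_eq b b'"
  then obtain k l :: int where "a' = a + 2 * pi * of_int k" "b' = b + 2 * pi * of_int l"
    by (auto simp: angle_eq_def)
  then show "angle_eq (a + b) (a' + b')"
    unfolding angle_eq_def by (intro exI[of _ "k + l"]) (simp add: algebra_simps)
qed

lift_definition uminus_circle :: "circle \<Rightarrow> circle" is uminus
proof -
  fix a a' assume "angle_eq a a'"
  then obtain k :: int where "a' = a + 2 * pi * of_int k"
    by (auto simp: angle_eq_def)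
  then show "angle_eq (- a) (- a')"
    unfolding angle_eq_def by (intro exI[of _ "- k"]) simp
qed

definition minus_circle :: "circle \<Rightarrow> circle \<Rightarrow> circle" where
  "minus_circle a b = a + (- b)"

lemma angle_eq_refl: "angle_eq a a"
  using equivp_angle_eq by (rule equivp_reflp)

instance
proof
  fix a b c :: circle
  show "a + b + c = a + (b + c)"
    by transfer (simp add: add.assoc angle_eq_refl)
  show "a + b = b + a"
    by transfer (simp add: add.commute angle_eq_refl)
  show "0 + a = a"
    by transfer (simp add: angle_eq_refl)
  show "- a + a = 0"
    by transfer (simp add: angle_eq_refl)
  show "a - b = a + - b"
    by (simp add: minus_circle_def)
qed

end

lift_definition cos_circle :: "circle \<Rightarrow> real" is cos
proof -
  fix a b assume "angle_eq a b"
  then obtain k :: int where "b = a + of_int k * (2 * pi)"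
    by (auto simp: angle_eq_def mult.commute)
  then show "cos a = cos b"
    using cos.plus_of_int[of a k] by simp
qed

lift_definition sin_circle :: "circle \<Rightarrow> real" is sin
proof -
  fix a b assume "angle_eq a b"
  then obtain k :: int where "b = a + of_int k * (2 * pi)"
    by (auto simp: angle_eq_def mult.commute)
  then show "sin a = sin b"
    using sin.plus_of_int[of a k] by simp
qed

text \<open>The flat metric: the distance between two classes is the least distance between
  representatives.\<close>

definition mod_dist :: "real \<Rightarrow> real \<Rightarrow> real" where
  "mod_dist a b = (INF k::int. \<bar>a - b + 2 * pi * of_int k\<bar>)"

lemma mod_dist_le: "mod_dist a b \<le> \<bar>a - b + 2 * pi * of_int k\<bar>"
  unfolding mod_dist_def by (rule cINF_lower) (auto intro!: bdd_belowI[of _ 0])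

lemma mod_dist_nonneg: "0 \<le> mod_dist a b"
  unfolding mod_dist_def by (rule cINF_greatest) auto

lemma mod_dist_attained: "\<exists>k::int. mod_dist a b = \<bar>a - b + 2 * pi * of_int k\<bar>"
proof -
  define x where "x = (a - b) / (2 * pi)"
  have eq: "\<bar>a - b + 2 * pi * of_int k\<bar> = 2 * pi * \<bar>x - of_int (- k)\<bar>" for k :: int
  proof -
    have "a - b + 2 * pi * of_int k = 2 * pi * (x - of_int (- k))"
      by (simp add: x_def field_simps)
    then show ?thesis by (simp add: abs_mult)
  qed
  have "mod_dist a b \<ge> \<bar>a - b + 2 * pi * of_int (- round x)\<bar>"
    unfolding mod_dist_def
  proof (rule cINF_greatest)
    fix k :: int
    have "\<bar>x - of_int (round x)\<bar> \<le> \<bar>x - of_int (- k)\<bar>"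
      by (rule round_diff_minimal)
    then show "\<bar>a - b + 2 * pi * of_int (- round x)\<bar> \<le> \<bar>a - b + 2 * pi * of_int k\<bar>"
      unfolding eq by simp
  qed simp
  then show ?thesis
    using mod_dist_le[of a b "- round x"] by (intro exI[of _ "- round x"]) linarith
qed

lemma mod_dist_mono_cong:
  assumes "angle_eq a a'" "angle_eq b b'"
  shows "mod_dist a' b' \<le> mod_dist a b"
proof -
  obtain k l where kl: "a' = a + 2 * pi * of_int k" "b' = b + 2 * pi * of_int l"
    using assms by (auto simp: angle_eq_def)
  obtain m where m: "mod_dist a b = \<bar>a - b + 2 * pi * of_int m\<bar>"
    using mod_dist_attained by blast
  have "mod_dist a' b' \<le> \<bar>a' - b' + 2 * pi * of_int (m - k + l)\<bar>"
    by (rule mod_dist_le)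
  also have "a' - b' + 2 * pi * of_int (m - k + l) = a - b + 2 * pi * of_int m"
    by (simp add: kl algebra_simps)
  finally show ?thesis using m by simp
qed

lemma mod_dist_eq_0: "mod_dist a b = 0 \<longleftrightarrow> angle_eq a b"
proof
  assume "mod_dist a b = 0"
  then obtain k :: int where "a - b + 2 * pi * of_int k = 0"
    using mod_dist_attained[of a b] by auto
  then show "angle_eq a b"
    unfolding angle_eq_def by (intro exI[of _ k]) linarith
next
  assume "angle_eq a b"
  then obtain k :: int where "b = a + 2 * pi * of_int k"
    by (auto simp: angle_eq_def)
  then show "mod_dist a b = 0"
    using mod_dist_le[of a b k] mod_dist_nonneg[of a b] by simp
qed

lemma mod_dist_triangle: "mod_dist a b \<le> mod_dist a c + mod_dist b c"
proof -
  obtain k l where kl: "mod_dist a c = \<bar>a - c + 2 * pi * of_int k\<bar>"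
    "mod_dist b c = \<bar>b - c + 2 * pi * of_int l\<bar>"
    using mod_dist_attained by metis
  have "mod_dist a b \<le> \<bar>a - b + 2 * pi * of_int (k - l)\<bar>"
    by (rule mod_dist_le)
  also have "a - b + 2 * pi * of_int (k - l)
      = (a - c + 2 * pi * of_int k) - (b - c + 2 * pi * of_int l)"
    by (simp add: algebra_simps)
  finally show ?thesis using kl by linarith
qed

instantiation circle :: metric_space
begin

lift_definition dist_circle :: "circle \<Rightarrow> circle \<Rightarrow> real" is mod_dist
  using mod_dist_mono_cong equivp_symp[OF equivp_angle_eq] by (metis order_antisym)

definition uniformity_circle :: "(circle \<times> circle) filter" where
  "uniformity_circle = (INF e\<in>{0<..}. principal {(x, y). dist x y < e})"

definition open_circle :: "circle set \<Rightarrow> bool" where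
  "open_circle U \<longleftrightarrow> (\<forall>x\<in>U. \<forall>\<^sub>F (x', y) in uniformity. x' = x \<longrightarrow> y \<in> U)"

instance
proof
  fix x y z :: circle
  show "dist x y = 0 \<longleftrightarrow> x = y"
    by transfer (rule mod_dist_eq_0)
  show "dist x y \<le> dist x z + dist y z"
    by transfer (rule mod_dist_triangle)
qed (simp_all only: uniformity_circle_def open_circle_def)

end


section \<open>The manifold, its tangent vectors, and curves\<close>

type_synonym manifold = "real \<times> real \<times> circle"

text \<open>Tangent vectors and covectors are given by their coordinates in the global frames
  \<open>\<partial>\<^sub>x, \<partial>\<^sub>y, \<partial>\<^sub>\<theta>\<close> and \<open>dx, dy, d\<theta>\<close>, which trivialise both bundles; the pairing of a covector
  with a vector is then the inner product of coordinates.\<close>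

type_synonym tangent = "real \<times> real \<times> real"
type_synonym covector = "real \<times> real \<times> real"
type_synonym cotangent_bundle = "manifold \<times> covector"

definition bundle_proj :: "cotangent_bundle \<Rightarrow> manifold" where
  "bundle_proj \<xi> = fst \<xi>"

definition covering :: "real \<times> real \<times> real \<Rightarrow> manifold" where
  "covering = (\<lambda>(x, y, a). (x, y, angle a))"

text \<open>A curve has velocity \<open>v\<close> at \<open>t\<close> if some lift to the universal cover does. The lift
  need not be continuous away from \<open>t\<close>, but two lifts that are continuous at \<open>t\<close> differ by a
  constant near \<open>t\<close>, so the velocity is well defined.\<close>

definition has_velocity :: "(real \<Rightarrow> manifold) \<Rightarrow> tangent \<Rightarrow> real \<Rightarrow> real set \<Rightarrow> bool" where
  "has_velocity q v t S \<longleftrightarrow>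
     (\<exists>r. (\<forall>s\<in>S. q s = covering (r s)) \<and> (r has_vector_derivative v) (at t within S))"

definition has_cotangent_velocity ::
    "(real \<Rightarrow> cotangent_bundle) \<Rightarrow> tangent \<times> covector \<Rightarrow> real \<Rightarrow> real set \<Rightarrow> bool" where
  "has_cotangent_velocity \<xi> w t S \<longleftrightarrow>
     has_velocity (\<lambda>s. fst (\<xi> s)) (fst w) t S \<and>
     ((\<lambda>s. snd (\<xi> s)) has_vector_derivative snd w) (at t within S)"

definition abs_continuous_on :: "real set \<Rightarrow> (real \<Rightarrow> 'a::metric_space) \<Rightarrow> bool" where
  "abs_continuous_on S f \<longleftrightarrow>
     (\<forall>\<epsilon>>0. \<exists>\<delta>>0. \<forall>D. finite D \<and> (\<forall>(a, b)\<in>D. a \<le> b \<and> {a..b} \<subseteq> S) \<and>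
        pairwise (\<lambda>(a, b) (c, d). disjnt {a<..<b} {c<..<d}) D \<and>
        (\<Sum>(a, b)\<in>D. b - a) < \<delta>
        \<longrightarrow> (\<Sum>(a, b)\<in>D. dist (f a) (f b)) < \<epsilon>)"


section \<open>Euler's elastic problem\<close>

text \<open>Controls are functions rather than classes of functions modulo null sets, and only
  their values on \<open>[0, t\<^sub>1]\<close> matter.\<close>

definition L2_controls :: "real \<Rightarrow> (real \<Rightarrow> real) set" where
  "L2_controls t1 = {u. u \<in> borel_measurable (lebesgue_on {0..t1}) \<and>
     integrable (lebesgue_on {0..t1}) (\<lambda>t. (u t)\<^sup>2)}"

definition Linf_controls :: "real \<Rightarrow> (real \<Rightarrow> real) set" where
  "Linf_controls t1 = {u. u \<in> borel_measurable (lebesgue_on {0..t1}) \<and>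
     (\<exists>C. AE t in lebesgue_on {0..t1}. \<bar>u t\<bar> \<le> C)}"

fun elastic_rhs :: "manifold \<Rightarrow> real \<Rightarrow> tangent" where
  "elastic_rhs (x, y, \<theta>) u = (cos_circle \<theta>, sin_circle \<theta>, u)"

definition trajectory :: "real \<Rightarrow> (real \<Rightarrow> real) \<Rightarrow> (real \<Rightarrow> manifold) \<Rightarrow> bool" where
  "trajectory t1 u q \<longleftrightarrow> abs_continuous_on {0..t1} q \<and>
     (AE t in lebesgue_on {0..t1}. has_velocity q (elastic_rhs (q t) (u t)) t {0..t1})"

definition attainable_set :: "manifold \<Rightarrow> real \<Rightarrow> manifold set" where
  "attainable_set q0 t1 = {q t1 | u q. u \<in> L2_controls t1 \<and> trajectory t1 u q \<and> q 0 = q0}"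

definition admissible_pair ::
    "manifold \<Rightarrow> manifold \<Rightarrow> real \<Rightarrow> (real \<Rightarrow> real) \<Rightarrow> (real \<Rightarrow> manifold) \<Rightarrow> bool" where
  "admissible_pair q0 q1 t1 u q \<longleftrightarrow>
     u \<in> L2_controls t1 \<and> trajectory t1 u q \<and> q 0 = q0 \<and> q t1 = q1"

definition elastic_energy :: "real \<Rightarrow> (real \<Rightarrow> real) \<Rightarrow> real" where
  "elastic_energy t1 u = 1 / 2 * (LINT t|lebesgue_on {0..t1}. (u t)\<^sup>2)"

definition optimal_pair ::
    "manifold \<Rightarrow> manifold \<Rightarrow> real \<Rightarrow> (real \<Rightarrow> real) \<Rightarrow> (real \<Rightarrow> manifold) \<Rightarrow> bool" where
  "optimal_pair q0 q1 t1 u q \<longleftrightarrow> admissible_pair q0 q1 t1 u q \<and>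
     (\<forall>v p. admissible_pair q0 q1 t1 v p \<longrightarrow> elastic_energy t1 u \<le> elastic_energy t1 v)"

definition optimal_control ::
    "manifold \<Rightarrow> manifold \<Rightarrow> real \<Rightarrow> (real \<Rightarrow> real) \<Rightarrow> bool" where
  "optimal_control q0 q1 t1 u \<longleftrightarrow> (\<exists>q. optimal_pair q0 q1 t1 u q)"


section \<open>The Pontryagin Maximum Principle\<close>

fun X1 :: "manifold \<Rightarrow> tangent" where
  "X1 (x, y, \<theta>) = (cos_circle \<theta>, sin_circle \<theta>, 0)"

definition X2 :: "manifold \<Rightarrow> tangent" where
  "X2 q = (0, 0, 1)"

definition linear_hamiltonian :: "(manifold \<Rightarrow> tangent) \<Rightarrow> cotangent_bundle \<Rightarrow> real" where
  "linear_hamiltonian X = (\<lambda>(q, p). p \<bullet> X q)"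

definition pmp_hamiltonian :: "real \<Rightarrow> real \<Rightarrow> cotangent_bundle \<Rightarrow> real" where
  "pmp_hamiltonian \<nu> u \<xi> =
     linear_hamiltonian X1 \<xi> + u * linear_hamiltonian X2 \<xi> + \<nu> / 2 * u\<^sup>2"

text \<open>In canonical coordinates the Hamiltonian vector field of \<open>H\<close> is
  \<open>(\<partial>H/\<partial>p, - \<partial>H/\<partial>q)\<close>. Partial derivatives in \<open>q\<close> are taken along the flows
  \<open>s \<mapsto> q + covering (s b)\<close> of the coordinate fields, \<open>+\<close> being the group structure
  of the product of two lines and the circle.\<close>

definition hamiltonian_vector_field ::
    "(cotangent_bundle \<Rightarrow> real) \<Rightarrow> cotangent_bundle \<Rightarrow> tangent \<times> covector" where
  "hamiltonian_vector_field H = (\<lambda>(q, p).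
     ((\<Sum>b\<in>Basis. deriv (\<lambda>s::real. H (q, p + s *\<^sub>R b)) 0 *\<^sub>R b),
      - (\<Sum>b\<in>Basis. deriv (\<lambda>s::real. H (q + covering (s *\<^sub>R b), p)) 0 *\<^sub>R b)))"

text \<open>A covector \<open>(q, p)\<close> vanishes when its fibre coordinate \<open>p\<close> does.\<close>

definition pmp_lift ::
    "real \<Rightarrow> (real \<Rightarrow> real) \<Rightarrow> (real \<Rightarrow> manifold) \<Rightarrow> real \<Rightarrow> (real \<Rightarrow> cotangent_bundle) \<Rightarrow> bool" where
  "pmp_lift t1 u q \<nu> \<xi> \<longleftrightarrow>
     abs_continuous_on {0..t1} \<xi> \<and> (\<forall>t\<in>{0..t1}. bundle_proj (\<xi> t) = q t) \<and> \<nu> \<le> 0 \<and>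
     (AE t in lebesgue_on {0..t1}.
        has_cotangent_velocity \<xi> (hamiltonian_vector_field (pmp_hamiltonian \<nu> (u t)) (\<xi> t))
          t {0..t1} \<and>
        (\<forall>v. pmp_hamiltonian \<nu> v (\<xi> t) \<le> pmp_hamiltonian \<nu> (u t) (\<xi> t)) \<and>
        (\<nu>, snd (\<xi> t)) \<noteq> 0)"

definition satisfies_pmp :: "real \<Rightarrow> (real \<Rightarrow> real) \<Rightarrow> (real \<Rightarrow> manifold) \<Rightarrow> bool" where
  "satisfies_pmp t1 u q \<longleftrightarrow> (\<exists>\<nu> \<xi>. pmp_lift t1 u q \<nu> \<xi>)"

definition abnormal_extremal_control :: "manifold \<Rightarrow> real \<Rightarrow> (real \<Rightarrow> real) \<Rightarrow> bool" where
  "abnormal_extremal_control q0 t1 u \<longleftrightarrow>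
     (\<exists>q. trajectory t1 u q \<and> q 0 = q0 \<and> (\<exists>\<xi>. pmp_lift t1 u q 0 \<xi>))"

end

theory Submission
  imports Defs "HOL-Complex_Analysis.Great_Picard"
begin

text \<open>
The first step is to solve the control system. A trajectory with control \<open>u\<close> is determined by its
starting point: its angle lifts to \<open>\<theta> t = \<theta> 0 + integral {0..t} u\<close>, and its position is the primitive of
\<open>(cos \<theta>, sin \<theta>)\<close> (\<open>trajectory_eq_steered_curve\<close>). As velocities exist only almost everywhere, this
rests on the two halves of the fundamental theorem of calculus for Lebesgue integrals
(\<open>lebesgue_differentiation\<close>, \<open>abs_continuous_derivative_0_imp_constant\<close>). What is left is to minimise
the square norm over the \<open>L\<^sub>2\<close> controls whose curve has the prescribed end point
(\<open>optimal_pair_iff\<close>).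

An optimal control exists because the headings of a minimising sequence are uniformly Hoelder
continuous, by Cauchy-Schwarz, so that a subsequence converges uniformly. The end point is
continuous under this convergence, and the energy is lower semicontinuous
(\<open>L2_primitive_limit\<close>), which is obtained from convexity and the parallelogram law.

For the maximum principle let \<open>g1\<close> and \<open>g2\<close> be the integrals of \<open>- sin \<theta>\<close> and \<open>cos \<theta>\<close> from \<open>t\<close> to the
final time, and vary the control in the span of the four functions \<open>u, g1, g2, 1\<close>. The map from the
four coefficients to the energy and the three coordinates of the end point has as its derivative
the Gram matrix of these functions. At an optimal control it cannot be invertible, for otherwise
the map would be open there and the energy could be decreased. Hence there is a nontrivial relation
\<open>\<nu> u + a1 g1 + a2 g2 + a3 = 0\<close> almost everywhere, and \<open>\<nu> \<le> 0\<close> after a change of sign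
(\<open>optimal_control_stationary\<close>). The curve \<open>(a1, a2, a1 g1 + a2 g2 + a3)\<close> of covectors solves the
adjoint equation, and the relation says that the Hamiltonian, a concave quadratic polynomial in the
control, is stationary and therefore maximal at \<open>u\<close> (\<open>pmp_lift_if_multipliers\<close>). Normal and abnormal
extremals are treated alike: if \<open>\<nu> = 0\<close> the control is abnormal, and otherwise \<open>u\<close> is almost everywhere
a continuous function, hence bounded, which makes the trajectory Lipschitz
(\<open>normal_optimal_control_regularity\<close>).
\<close>

section \<open>Absolute continuity and the fundamental theorem of calculus\<close>

text \<open>By Henstock's lemma, disjoint intervals on which the mean value of the integrand is off by more
than \<open>e\<close> from its value at an end point have small total length once they are subordinate to the
gauge. The intervals that witness the failure of differentiability are of this kind, and they
cover the exceptional set finely, so the Vitali covering lemma bounds its outer measure.\<close>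

lemma negligible_not_derivative_of_integral:
  fixes f :: "real \<Rightarrow> real"
  assumes f: "f integrable_on {a..b}" and e: "0 < e"
  defines "F \<equiv> \<lambda>t. integral {a..t} f"
  shows "negligible {x\<in>{a..b}. \<forall>d>0. \<exists>y\<in>{a..b}. y \<noteq> x \<and> \<bar>y - x\<bar> < d \<and>
           \<bar>F y - F x - f x * (y - x)\<bar> > e * \<bar>y - x\<bar>}" (is "negligible ?E")
  unfolding negligible_outer_le
proof (intro allI impI)
  fix \<eta> :: real assume \<eta>: "0 < \<eta>"
  \<comment> \<open>The factor 5 is the enlargement in the Vitali covering lemma.\<close>
  obtain \<gamma> where \<gamma>: "gauge \<gamma>"
    and small: "\<And>p. \<lbrakk>p tagged_partial_division_of (cbox a b); \<gamma> fine p\<rbrakk> \<Longrightarrow>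
             sum (\<lambda>(x,k). norm(measure lborel k *\<^sub>R f x - integral k f)) p < e * \<eta> / 5"
    using Henstock_lemma[of f a b "e * \<eta> / 5"] f e \<eta> by (auto simp: box_real)
  define I :: "real \<times> real \<Rightarrow> real set" where "I = (\<lambda>(x, y). cbox (min x y) (max x y))"
  define K where "K = {(x, y). x \<in> {a..b} \<and> y \<in> {a..b} \<and> y \<noteq> x \<and>
      \<bar>F y - F x - f x * (y - x)\<bar> > e * \<bar>y - x\<bar> \<and> I (x, y) \<subseteq> \<gamma> x}"
  define c r where "c = (\<lambda>(x, y). (x + y) / 2 :: real)" and "r = (\<lambda>(x, y). \<bar>y - x\<bar> / 2 :: real)"
  have I_cball: "I i = cball (c i) (r i)" for i
    by (cases i) (auto simp: I_def c_def r_def cball_eq_atLeastAtMost min_def max_def field_simps)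
  have r_pos: "0 < r i \<and> r i \<le> b - a" if "i \<in> K" for i
    using that by (auto simp: K_def r_def)
  have cover: "?E \<subseteq> (\<Union>i\<in>K. cball (c i) (r i))"
  proof
    fix x assume x: "x \<in> ?E"
    obtain d where d: "d > 0" "ball x d \<subseteq> \<gamma> x"
      using \<gamma> by (meson gauge_def open_contains_ball)
    then obtain y where y: "y \<in> {a..b}" "y \<noteq> x" "\<bar>y - x\<bar> < d"
      "\<bar>F y - F x - f x * (y - x)\<bar> > e * \<bar>y - x\<bar>"
      using x by blast
    have "I (x, y) \<subseteq> ball x d"
      using y by (auto simp: I_def dist_real_def min_def max_def split: if_splits)
    then have "(x, y) \<in> K"
      using x y d by (auto simp: K_def)
    moreover have "x \<in> I (x, y)" by (auto simp: I_def)
    ultimately show "x \<in> (\<Union>i\<in>K. cball (c i) (r i))"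
      unfolding I_cball[symmetric] by blast
  qed
  obtain C where C: "countable C" "C \<subseteq> K"
     "pairwise (\<lambda>i j. disjnt (cball (c i) (r i)) (cball (c j) (r j))) C"
     "?E \<subseteq> (\<Union>i\<in>C. cball (c i) (5 * r i))"
    by (rule Vitali_covering_lemma_cballs[OF cover r_pos]) (blast intro: that)+
  have total: "(\<Sum>i\<in>D. 2 * r i) \<le> \<eta> / 5" if D: "D \<subseteq> C" "finite D" for D
  proof -
    let ?g = "\<lambda>i. (fst i, I i)"
    have mem: "fst i \<in> I i" for i by (cases i) (auto simp: I_def)
    have disj: "I i \<inter> I j = {}" if "i \<in> D" "j \<in> D" "i \<noteq> j" for i j
      using C(3) D(1) that unfolding pairwise_def I_cball disjnt_def by blast
    have inj: "inj_on ?g D"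
      using mem disj unfolding inj_on_def by (metis disjoint_iff prod.inject)
    have tp: "?g ` D tagged_partial_division_of (cbox a b)"
      unfolding tagged_partial_division_of_def
    proof (intro conjI allI impI)
      fix x L assume "(x, L) \<in> ?g ` D"
      then obtain i where i: "i \<in> D" "x = fst i" "L = I i" by auto
      then show "x \<in> L" using mem by auto
      have "i \<in> K" using i D C by blast
      then show "L \<subseteq> cbox a b" using i by (auto simp: K_def I_def)
      show "\<exists>a b. L = cbox a b" using i by (cases i) (auto simp: I_def)
    next
      fix x1 K1 x2 K2
      assume "(x1, K1) \<in> ?g ` D \<and> (x2, K2) \<in> ?g ` D \<and> (x1, K1) \<noteq> (x2, K2)"
      then obtain i j where "i \<in> D" "j \<in> D" "K1 = I i" "K2 = I j" "i \<noteq> j" by auto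
      then show "interior K1 \<inter> interior K2 = {}"
        using disj[of i j] interior_subset[of K1] interior_subset[of K2] by blast
    qed (use D in auto)
    have fine: "\<gamma> fine ?g ` D"
      using subsetD[OF subset_trans[OF D(1) C(2)]] unfolding fine_def by (fastforce simp: K_def)
    have key: "e * (2 * r i) \<le> norm (measure lborel (I i) *\<^sub>R f (fst i) - integral (I i) f)" if "i \<in> D" for i
    proof -
      obtain x y where i: "i = (x, y)" by (cases i)
      have K: "x \<in> {a..b}" "y \<in> {a..b}" "y \<noteq> x" "\<bar>F y - F x - f x * (y - x)\<bar> > e * \<bar>y - x\<bar>"
        using that D C by (auto simp: i K_def)
      have split: "F t - F s = integral {s..t} f" if "s \<in> {a..b}" "t \<in> {a..b}" "s \<le> t" for s t
        using Henstock_Kurzweil_Integration.integral_combine[of a s t f] that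
          integrable_subinterval_real[OF f, of a t] by (auto simp: F_def)
      show ?thesis
      proof (cases "x \<le> y")
        case True
        have "I i = {x..y}" using True by (auto simp: i I_def)
        then have "measure lborel (I i) *\<^sub>R f (fst i) - integral (I i) f = - (F y - F x - f x * (y - x))"
          using split[of x y] K True by (simp add: i algebra_simps)
        then show ?thesis using K by (simp add: i r_def)
      next
        case False
        have "I i = {y..x}" using False by (auto simp: i I_def)
        then have "measure lborel (I i) *\<^sub>R f (fst i) - integral (I i) f = F y - F x - f x * (y - x)"
          using split[of y x] K False by (simp add: i algebra_simps)
        then show ?thesis using K by (simp add: i r_def)
      qed
    qed
    have "e * (\<Sum>i\<in>D. 2 * r i) \<le> (\<Sum>i\<in>D. norm (measure lborel (I i) *\<^sub>R f (fst i) - integral (I i) f))"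
      unfolding sum_distrib_left using key by (rule sum_mono)
    also have "\<dots> = sum (\<lambda>(x,k). norm(measure lborel k *\<^sub>R f x - integral k f)) (?g ` D)"
      by (simp add: sum.reindex[OF inj])
    also have "\<dots> < e * \<eta> / 5" by (rule small[OF tp fine])
    finally show ?thesis using e by (simp add: field_simps)
  qed
  let ?T = "\<Union>i\<in>C. cball (c i) (5 * r i)"
  have bound: "measure lebesgue (\<Union>i\<in>D. cball (c i) (5 * r i)) \<le> \<eta>" if D: "D \<subseteq> C" "finite D" for D
  proof -
    have "measure lebesgue (\<Union>i\<in>D. cball (c i) (5 * r i))
        \<le> (\<Sum>i\<in>D. measure lebesgue (cball (c i) (5 * r i)))"
      by (rule measure_UNION_le) (use D in auto)
    also have "\<dots> = (\<Sum>i\<in>D. 5 * (2 * r i))"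
    proof (rule sum.cong)
      fix i assume "i \<in> D"
      then have "0 < r i" using r_pos D C by blast
      then show "measure lebesgue (cball (c i) (5 * r i)) = 5 * (2 * r i)"
        by (simp add: cball_eq_atLeastAtMost)
    qed simp
    also have "\<dots> \<le> \<eta>" using total[OF D] by (simp add: sum_distrib_left[symmetric])
    finally show ?thesis .
  qed
  have "?T \<in> lmeasurable \<and> measure lebesgue ?T \<le> \<eta>"
    using fmeasurable_UN_bound[OF C(1), of "\<lambda>i. cball (c i) (5 * r i)" lebesgue \<eta>]
      measure_UN_bound[OF C(1), of "\<lambda>i. cball (c i) (5 * r i)" lebesgue \<eta>] bound by auto
  then show "\<exists>T. ?E \<subseteq> T \<and> T \<in> lmeasurable \<and> measure lebesgue T \<le> \<eta>"
    using C(4) by blast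
qed

text \<open>The fundamental theorem of calculus without continuity of the integrand: the trajectories below have
controls in \<open>L\<^sub>2\<close>, so their headings are differentiable only almost everywhere.\<close>

lemma lebesgue_differentiation:
  fixes f :: "real \<Rightarrow> real"
  assumes f: "f integrable_on {a..b}"
  obtains N where "negligible N"
    "\<And>x. x \<in> {a..b} - N \<Longrightarrow>
      ((\<lambda>t. integral {a..t} f) has_vector_derivative f x) (at x within {a..b})"
proof -
  define F where "F = (\<lambda>t. integral {a..t} f)"
  define E where "E = (\<lambda>n::nat. {x\<in>{a..b}. \<forall>d>0. \<exists>y\<in>{a..b}. y \<noteq> x \<and> \<bar>y - x\<bar> < d \<and>
           \<bar>F y - F x - f x * (y - x)\<bar> > inverse (Suc n) * \<bar>y - x\<bar>})"
  have "negligible (E n)" for n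
    unfolding E_def F_def by (rule negligible_not_derivative_of_integral[OF f]) simp
  then have "negligible (\<Union>n. E n)" by (intro negligible_countable_Union) auto
  moreover have "(F has_vector_derivative f x) (at x within {a..b})" if x: "x \<in> {a..b} - (\<Union>n. E n)" for x
    unfolding has_vector_derivative_def has_derivative_within_alt
  proof (intro conjI allI impI)
    fix \<epsilon> :: real assume "0 < \<epsilon>"
    then obtain n where n: "inverse (Suc n) < \<epsilon>" using reals_Archimedean by blast
    have "x \<notin> E n" using x by blast
    then obtain d where d: "d > 0" "\<And>y. y \<in> {a..b} \<Longrightarrow> y \<noteq> x \<Longrightarrow> \<bar>y - x\<bar> < d \<Longrightarrow>
        \<bar>F y - F x - f x * (y - x)\<bar> \<le> inverse (Suc n) * \<bar>y - x\<bar>"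
      proof -
      assume *: "\<And>d. \<lbrakk>d > 0; \<And>y. \<lbrakk>y \<in> {a..b}; y \<noteq> x; \<bar>y - x\<bar> < d\<rbrakk> \<Longrightarrow>
        \<bar>F y - F x - f x * (y - x)\<bar> \<le> inverse (Suc n) * \<bar>y - x\<bar>\<rbrakk> \<Longrightarrow> thesis"
      have "x \<in> {a..b}" using x by blast
      then obtain d where "d > 0" "\<forall>y\<in>{a..b}. \<not> (y \<noteq> x \<and> \<bar>y - x\<bar> < d \<and>
           \<bar>F y - F x - f x * (y - x)\<bar> > inverse (Suc n) * \<bar>y - x\<bar>)"
        using \<open>x \<notin> E n\<close> unfolding E_def by blast
      then show thesis using *[of d] not_less by blast
    qed
    have "norm (F y - F x - (y - x) *\<^sub>R f x) \<le> \<epsilon> * norm (y - x)"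
      if "y \<in> {a..b}" "norm (y - x) < d" for y
    proof (cases "y = x")
      case False
      then have "\<bar>F y - F x - f x * (y - x)\<bar> \<le> inverse (Suc n) * \<bar>y - x\<bar>"
        using d(2)[of y] that by simp
      also have "\<dots> \<le> \<epsilon> * \<bar>y - x\<bar>" using n by (intro mult_right_mono) auto
      finally show ?thesis by (simp add: mult.commute)
    qed simp
    then show "\<exists>d>0. \<forall>y\<in>{a..b}. norm (y - x) < d \<longrightarrow>
        norm (F y - F x - (y - x) *\<^sub>R f x) \<le> \<epsilon> * norm (y - x)"
      using d(1) by blast
  qed (rule bounded_linear_scaleR_left)
  ultimately show ?thesis using that unfolding F_def by blast
qed

lemma abs_continuous_onE:
  assumes "abs_continuous_on S f" "0 < \<epsilon>"
  obtains \<delta> where "0 < \<delta>"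
    "\<And>D. \<lbrakk>finite D; \<forall>(a, b)\<in>D. a \<le> b \<and> {a..b} \<subseteq> S;
      pairwise (\<lambda>(a, b) (c, d). disjnt {a<..<b} {c<..<d}) D;
      (\<Sum>(a, b)\<in>D. b - a) < \<delta>\<rbrakk> \<Longrightarrow> (\<Sum>(a, b)\<in>D. dist (f a) (f b)) < \<epsilon>"
proof -
  from assms(1)[unfolded abs_continuous_on_def, rule_format, OF assms(2)]
  obtain \<delta> where "0 < \<delta>" and D: "\<forall>D. finite D \<and> (\<forall>(a, b)\<in>D. a \<le> b \<and> {a..b} \<subseteq> S) \<and>
        pairwise (\<lambda>(a, b) (c, d). disjnt {a<..<b} {c<..<d}) D \<and>
        (\<Sum>(a, b)\<in>D. b - a) < \<delta>
        \<longrightarrow> (\<Sum>(a, b)\<in>D. dist (f a) (f b)) < \<epsilon>"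
    by (elim exE conjE)
  show thesis
    by (rule that[OF \<open>0 < \<delta>\<close>], rule D[rule_format], intro conjI)
qed

text \<open>Off the null set \<open>N\<close> the increment of \<open>f\<close> over a short interval is small compared with its
length; on intervals tagged in \<open>N\<close> absolute continuity takes over, since they can be kept inside
an open set of small measure. A gauge that encodes both requirements has a fine tagged division,
along which the increments of \<open>f\<close> are summed.\<close>

lemma abs_continuous_derivative_0_imp_constant:
  fixes f :: "real \<Rightarrow> real"
  assumes ac: "abs_continuous_on {a..b} f" and N: "negligible N" and ab: "a \<le> b"
    and deriv: "\<And>x. x \<in> {a..b} - N \<Longrightarrow> (f has_vector_derivative 0) (at x within {a..b})"
  shows "f b = f a"
proof -
  have "\<bar>f b - f a\<bar> \<le> 0 + \<epsilon>" if \<epsilon>: "0 < \<epsilon>" for \<epsilon>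
  proof -
    define \<epsilon>' where "\<epsilon>' = \<epsilon> / (b - a + 1)"
    have \<epsilon>': "\<epsilon>' > 0" using \<epsilon> ab by (simp add: \<epsilon>'_def)
    have "\<epsilon>' * (b - a + 1) = \<epsilon>" using ab by (simp add: \<epsilon>'_def)
    then have \<epsilon>_eq: "\<epsilon>' + \<epsilon>' * (b - a) = \<epsilon>" by (simp add: algebra_simps)
    obtain \<delta> where \<delta>: "\<delta> > 0" and ac': "\<And>D. \<lbrakk>finite D; \<forall>(a', b')\<in>D. a' \<le> b' \<and> {a'..b'} \<subseteq> {a..b};
        pairwise (\<lambda>(a, b) (c, d). disjnt {a<..<b} {c<..<d}) D;
        (\<Sum>(a, b)\<in>D. b - a) < \<delta>\<rbrakk> \<Longrightarrow> (\<Sum>(a, b)\<in>D. dist (f a) (f b)) < \<epsilon>'"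
      by (rule abs_continuous_onE[OF ac \<epsilon>']) (rule that; assumption)
    have Nl: "N \<in> sets lebesgue" "emeasure lebesgue N = 0"
      using N by (auto simp: negligible_iff_null_sets)
    obtain U where U: "open U" "N \<subseteq> U" "U - N \<in> lmeasurable" "emeasure lebesgue (U - N) < ennreal \<delta>"
      using sets_lebesgue_outer_open[OF Nl(1) \<delta>] by metis
    have Um: "U \<in> lmeasurable"
      using U N by (metis Un_Diff_cancel2 fmeasurable.Un negligible_imp_measurable sup.absorb1)
    have Us: "measure lebesgue U < \<delta>"
    proof -
      have "measure lebesgue U = measure lebesgue (U - N)"
        using N Um by (simp add: measure_Diff_null_set negligible_iff_null_sets fmeasurableD)
      also have "\<dots> < \<delta>"
        using U \<delta> by (simp add: emeasure_eq_measure2 ennreal_less_iff)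
      finally show ?thesis .
    qed
    have "\<exists>d. \<forall>x. 0 < d x \<and> (x \<in> N \<longrightarrow> ball x (d x) \<subseteq> U) \<and> (x \<in> {a..b} - N \<longrightarrow>
        (\<forall>y\<in>{a..b}. \<bar>y - x\<bar> < d x \<longrightarrow> \<bar>f y - f x\<bar> \<le> \<epsilon>' * \<bar>y - x\<bar>))"
    proof (intro choice allI)
      fix x
      show "\<exists>d. 0 < d \<and> (x \<in> N \<longrightarrow> ball x d \<subseteq> U) \<and> (x \<in> {a..b} - N \<longrightarrow>
        (\<forall>y\<in>{a..b}. \<bar>y - x\<bar> < d \<longrightarrow> \<bar>f y - f x\<bar> \<le> \<epsilon>' * \<bar>y - x\<bar>))"
      proof (cases "x \<in> N")
        case True
        then obtain d where "d > 0" "ball x d \<subseteq> U" using U by (meson open_contains_ball subsetD)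
        then show ?thesis using True by blast
      next
        case False
        show ?thesis
        proof (cases "x \<in> {a..b}")
          case True
          then have "(f has_derivative (\<lambda>h. h *\<^sub>R 0)) (at x within {a..b})"
            using deriv False unfolding has_vector_derivative_def by blast
          then obtain d where "d > 0"
            "\<forall>y\<in>{a..b}. norm (y - x) < d \<longrightarrow> norm (f y - f x - (y - x) *\<^sub>R 0) \<le> \<epsilon>' * norm (y - x)"
            using \<epsilon>' unfolding has_derivative_within_alt by blast
          then show ?thesis using False by (intro exI[of _ d]) auto
        qed (use False in \<open>auto intro: exI[of _ 1]\<close>)
      qed
    qed
    then obtain d where d: "\<And>x. 0 < d x" "\<And>x. x \<in> N \<Longrightarrow> ball x (d x) \<subseteq> U"
      "\<And>x y. x \<in> {a..b} - N \<Longrightarrow> y \<in> {a..b} \<Longrightarrow> \<bar>y - x\<bar> < d x \<Longrightarrow> \<bar>f y - f x\<bar> \<le> \<epsilon>' * \<bar>y - x\<bar>"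
      by metis
    obtain p where p: "p tagged_division_of {a..b}" "(\<lambda>x. ball x (d x)) fine p"
      using fine_division_exists_real[of "\<lambda>x. ball x (d x)" a b] d(1) by (auto simp: gauge_def)
    have pf: "finite p" using p by blast
    have cell: "\<exists>c e. L = {c..e} \<and> c \<le> x \<and> x \<le> e \<and> a \<le> c \<and> e \<le> b \<and> Sup L = e \<and> Inf L = c \<and> L \<subseteq> ball x (d x)"
      if xL: "(x, L) \<in> p" for x L
    proof -
      obtain c e where "L = {c..e}" using tagged_division_ofD(4)[OF p(1) xL] by (auto simp: box_real)
      moreover have "x \<in> L" "L \<subseteq> {a..b}" using tagged_division_ofD(2,3)[OF p(1) xL] by auto
      moreover have "L \<subseteq> ball x (d x)" using p(2) xL unfolding fine_def by blast
      ultimately show ?thesis by (intro exI[of _ c] exI[of _ e]) auto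
    qed
    let ?v = "\<lambda>(x::real, L::real set). \<bar>f (Sup L) - f (Inf L)\<bar>"
    \<comment> \<open>Cells with nonempty interior are told apart by disjointness of the interiors; the others add nothing.\<close>
    define q where "q = {z\<in>p. fst z \<in> N \<and> Inf (snd z) < Sup (snd z)}"
    define q0 where "q0 = {z\<in>p. fst z \<in> N \<and> \<not> Inf (snd z) < Sup (snd z)}"
    define g where "g = (\<lambda>(x::real, L::real set). (Inf L, Sup L))"
    have qf: "finite q" and qp: "q \<subseteq> p" using pf by (auto simp: q_def)
    have disj: "disjnt {Inf L<..<Sup L} {Inf L'<..<Sup L'}"
      if "(x, L) \<in> p" "(x', L') \<in> p" "(x, L) \<noteq> (x', L')" for x L x' L'
    proof -
      have "interior L = {Inf L<..<Sup L}" "interior L' = {Inf L'<..<Sup L'}"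
        using cell[OF that(1)] cell[OF that(2)] interior_atLeastAtMost_real by metis+
      then show ?thesis
        using tagged_division_ofD(5)[OF p(1) that] by (simp only: disjnt_def)
    qed
    have disj_q: "pairwise (\<lambda>z z'. disjnt {Inf (snd z)<..<Sup (snd z)} {Inf (snd z')<..<Sup (snd z')}) q"
      unfolding pairwise_def using disj qp by (metis prod.collapse subsetD)
    have inj: "inj_on g q"
    proof (rule inj_onI)
      fix z z' assume z: "z \<in> q" "z' \<in> q" "g z = g z'"
      show "z = z'"
      proof (rule ccontr)
        assume "z \<noteq> z'"
        then have "disjnt {Inf (snd z)<..<Sup (snd z)} {Inf (snd z')<..<Sup (snd z')}"
          using z qp disj[of "fst z" "snd z" "fst z'" "snd z'"] by auto
        then show False using z by (auto simp: disjnt_def g_def q_def split: prod.splits)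
      qed
    qed
    have qsub: "{Inf L..Sup L} \<subseteq> U \<and> Inf L \<le> Sup L \<and> a \<le> Inf L \<and> Sup L \<le> b" if "(x, L) \<in> q" for x L
    proof -
      have "(x, L) \<in> p" "x \<in> N" using that by (auto simp: q_def)
      then show ?thesis using cell[of x L] d(2)[of x] by auto
    qed
    have len: "(\<Sum>(a, b)\<in>g ` q. b - a) < \<delta>"
    proof -
      have "(\<Sum>(a, b)\<in>g ` q. b - a) = (\<Sum>(x, L)\<in>q. measure lebesgue {Inf L<..<Sup L})"
        by (subst sum.reindex[OF inj]) (use qsub in \<open>auto simp: g_def intro!: sum.cong\<close>)
      also have "\<dots> = measure lebesgue (\<Union>(x, L)\<in>q. {Inf L<..<Sup L})"
        unfolding split_def
        by (rule measure_UNION'[symmetric, OF qf _ disj_q]) auto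
      also have "\<dots> \<le> measure lebesgue U"
      proof (rule measure_mono_fmeasurable[OF _ _ Um])
        have "{Inf L<..<Sup L} \<subseteq> U" if "(x, L) \<in> q" for x L
          using qsub[OF that] greaterThanLessThan_subseteq_atLeastAtMost_iff[of "Inf L" "Sup L" "Inf L" "Sup L"]
          by blast
        then show "(\<Union>(x, L)\<in>q. {Inf L<..<Sup L}) \<subseteq> U" by blast
        show "(\<Union>(x, L)\<in>q. {Inf L<..<Sup L}) \<in> sets lebesgue"
          by (intro sets.finite_UN qf) auto
      qed
      finally show ?thesis using Us by simp
    qed
    have "(\<Sum>z\<in>q. ?v z) = (\<Sum>(a, b)\<in>g ` q. dist (f a) (f b))"
      by (subst sum.reindex[OF inj]) (auto simp: g_def dist_real_def abs_minus_commute intro!: sum.cong)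
    also have "\<dots> < \<epsilon>'"
    proof (rule ac'[OF _ _ _ len])
      show "\<forall>(a', b')\<in>g ` q. a' \<le> b' \<and> {a'..b'} \<subseteq> {a..b}"
        using qsub by (fastforce simp: g_def)
      show "pairwise (\<lambda>(a, b) (c, d). disjnt {a<..<b} {c<..<d}) (g ` q)"
      proof (rule pairwiseI)
        fix u v assume "u \<in> g ` q" "v \<in> g ` q" "u \<noteq> v"
        then obtain z z' where "z \<in> q" "z' \<in> q" "z \<noteq> z'" "u = g z" "v = g z'" by blast
        then show "(\<lambda>(a, b) (c, d). disjnt {a<..<b} {c<..<d}) u v"
          using disj_q unfolding pairwise_def g_def by (simp add: split_def)
      qed
    qed (use qf in auto)
    finally have sum_q: "(\<Sum>z\<in>q. ?v z) < \<epsilon>'" .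
    have sum_q0: "(\<Sum>z\<in>q0. ?v z) = 0"
    proof (intro sum.neutral ballI)
      fix z assume z: "z \<in> q0"
      then have "(fst z, snd z) \<in> p" "\<not> Inf (snd z) < Sup (snd z)" by (auto simp: q0_def)
      then have "Sup (snd z) = Inf (snd z)" using cell[of "fst z" "snd z"] by force
      then show "?v z = 0" by (simp add: split_def)
    qed
    have sum_r: "(\<Sum>z\<in>{z\<in>p. fst z \<notin> N}. ?v z) \<le> (\<Sum>z\<in>{z\<in>p. fst z \<notin> N}. \<epsilon>' * (\<lambda>(x, L). Sup L - Inf L) z)"
    proof (rule sum_mono)
      fix z assume z: "z \<in> {z\<in>p. fst z \<notin> N}"
      obtain x L where xL: "z = (x, L)" by (cases z)
      obtain c e where ce: "L = {c..e}" "c \<le> x" "x \<le> e" "a \<le> c" "e \<le> b" "Sup L = e" "Inf L = c"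
        "L \<subseteq> ball x (d x)" using cell[of x L] z xL by auto
      have "c \<in> ball x (d x)" "e \<in> ball x (d x)"
        using ce(2,3) subsetD[OF ce(8)] unfolding ce(1) by auto
      then have "\<bar>f c - f x\<bar> \<le> \<epsilon>' * \<bar>c - x\<bar>" "\<bar>f e - f x\<bar> \<le> \<epsilon>' * \<bar>e - x\<bar>"
        using d(3)[of x c] d(3)[of x e] ce z xL by (auto simp: dist_real_def abs_minus_commute)
      then have "\<bar>f e - f c\<bar> \<le> \<epsilon>' * \<bar>c - x\<bar> + \<epsilon>' * \<bar>e - x\<bar>" by linarith
      also have "\<dots> = \<epsilon>' * (e - c)" using ce by (simp add: algebra_simps)
      finally show "?v z \<le> \<epsilon>' * (\<lambda>(x, L). Sup L - Inf L) z" using ce xL by simp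
    qed
    also have "\<dots> \<le> (\<Sum>z\<in>p. \<epsilon>' * (\<lambda>(x, L). Sup L - Inf L) z)"
    proof (rule sum_mono2[OF pf])
      fix z assume "z \<in> p - {z\<in>p. fst z \<notin> N}"
      then have "(fst z, snd z) \<in> p" by simp
      then have "Inf (snd z) \<le> Sup (snd z)" using cell[of "fst z" "snd z"] by force
      then show "0 \<le> \<epsilon>' * (\<lambda>(x, L). Sup L - Inf L) z" using \<epsilon>' by (simp add: split_def)
    qed auto
    also have "\<dots> = \<epsilon>' * (b - a)"
      unfolding sum_distrib_left[symmetric]
      using additive_tagged_division_1[OF ab p(1), of "\<lambda>x. x"] by simp
    finally have sum_r: "(\<Sum>z\<in>{z\<in>p. fst z \<notin> N}. ?v z) \<le> \<epsilon>' * (b - a)" .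
    have "p = q \<union> q0 \<union> {z\<in>p. fst z \<notin> N}" by (auto simp: q_def q0_def)
    then have "(\<Sum>z\<in>p. ?v z) = (\<Sum>z\<in>q \<union> q0 \<union> {z\<in>p. fst z \<notin> N}. ?v z)" by simp
    also have "\<dots> = (\<Sum>z\<in>q. ?v z) + (\<Sum>z\<in>q0. ?v z) + (\<Sum>z\<in>{z\<in>p. fst z \<notin> N}. ?v z)"
      by (subst sum.union_disjoint, use pf in \<open>auto simp: q_def q0_def\<close>)
         (subst sum.union_disjoint, use pf in \<open>auto simp: q_def q0_def\<close>)
    finally have "(\<Sum>z\<in>p. ?v z) \<le> \<epsilon>' + \<epsilon>' * (b - a)"
      using sum_q sum_q0 sum_r by linarith
    moreover have "\<bar>f b - f a\<bar> \<le> (\<Sum>z\<in>p. ?v z)"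
      unfolding additive_tagged_division_1[OF ab p(1), of f, symmetric]
      by (rule order_trans[OF sum_abs]) (auto intro!: sum_mono)
    ultimately show ?thesis using \<epsilon>_eq by linarith
  qed
  then have "\<bar>f b - f a\<bar> \<le> 0" by (rule field_le_epsilon)
  then show ?thesis by simp
qed

lemma sum_integral_disjoint_le:
  fixes h :: "real \<Rightarrow> real"
  assumes h: "h integrable_on {A..B}" "\<And>x. x \<in> {A..B} \<Longrightarrow> 0 \<le> h x"
    and D: "finite D" "\<forall>(a, b)\<in>D. a \<le> b \<and> {a..b} \<subseteq> {A..B}"
    and disj: "pairwise (\<lambda>(a, b) (c, d). disjnt {a<..<b} {c<..<d}) D"
  shows "(\<Sum>(a, b)\<in>D. integral {a..b} h) \<le> integral {A..B} h"
proof -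
  let ?h = "\<lambda>(a, b) x. if x \<in> {a<..<b} then h x else 0"
  have sub: "a \<le> b" "{a..b} \<subseteq> {A..B}" if "(a, b) \<in> D" for a b
    using D that by auto
  have disj': "disjnt {fst i<..<snd i} {fst j<..<snd j}" if "i \<in> D" "j \<in> D" "i \<noteq> j" for i j
    using disj that unfolding pairwise_def split_def by blast
  have eq: "integral {a..b} h = integral {A..B} (?h (a, b)) \<and> ?h (a, b) integrable_on {A..B}"
    if "(a, b) \<in> D" for a b
  proof -
    have int: "{a<..<b} \<inter> {A..B} = {a<..<b}" using sub[OF that] by auto
    have ho: "h integrable_on {a<..<b}"
      using integrable_subinterval_real[OF h(1) sub(2)[OF that]]
        integrable_on_open_interval[of h a b] by (simp add: box_real)
    have "integral {A..B} (?h (a, b)) = integral {a<..<b} h"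
      unfolding prod.case integral_restrict_Int int ..
    moreover have "integral {a<..<b} h = integral {a..b} h"
      using integral_open_interval[of a b h] by (simp add: box_real)
    ultimately show ?thesis
      using ho unfolding prod.case integrable_restrict_Int int by simp
  qed
  have "(\<Sum>(a, b)\<in>D. integral {a..b} h) = (\<Sum>i\<in>D. integral {A..B} (?h i))"
    using eq by (intro sum.cong) auto
  also have "\<dots> = integral {A..B} (\<lambda>x. \<Sum>i\<in>D. ?h i x)"
    by (rule integral_sum[symmetric]) (use D eq in auto)
  also have "\<dots> \<le> integral {A..B} h"
  proof (rule integral_le)
    show "(\<lambda>x. \<Sum>i\<in>D. ?h i x) integrable_on {A..B}"
      by (rule integrable_sum) (use D eq in auto)
    fix x assume x: "x \<in> {A..B}"
    show "(\<Sum>i\<in>D. ?h i x) \<le> h x"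
    proof (cases "\<exists>i\<in>D. x \<in> {fst i<..<snd i}")
      case True
      then obtain i where i: "i \<in> D" "x \<in> {fst i<..<snd i}" by blast
      have "?h j x = 0" if "j \<in> D - {i}" for j
      proof -
        have "x \<notin> {fst j<..<snd j}"
          using disj'[of i j] i that unfolding disjnt_iff by blast
        then show ?thesis by (cases j) auto
      qed
      then have "(\<Sum>i\<in>D. ?h i x) = ?h i x"
        using D i by (simp add: sum.remove)
      then show ?thesis using i by (cases i) auto
    next
      case False
      then have "(\<Sum>i\<in>D. ?h i x) = 0" by (intro sum.neutral) force
      then show ?thesis using h x by simp
    qed
  qed (fact h)
  finally show ?thesis .
qed

text \<open>Splitting \<open>g\<close> into \<open>min g n\<close>, whose integral over a set is at most \<open>n\<close> times its measure, and a
remainder of small total integral, which exists by dominated convergence, gives the uniform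
smallness.\<close>

lemma abs_continuous_onI_integral_bound:
  fixes f :: "real \<Rightarrow> 'a::metric_space" and g :: "real \<Rightarrow> real"
  assumes g: "g integrable_on {A..B}" and g0: "\<And>x. x \<in> {A..B} \<Longrightarrow> 0 \<le> g x"
    and bound: "\<And>s t. \<lbrakk>A \<le> s; s \<le> t; t \<le> B\<rbrakk> \<Longrightarrow> dist (f s) (f t) \<le> integral {s..t} g"
  shows "abs_continuous_on {A..B} f"
  unfolding abs_continuous_on_def
proof (intro allI impI)
  fix \<epsilon> :: real assume \<epsilon>: "0 < \<epsilon>"
  define m where "m = (\<lambda>(n::nat) x. min (g x) (real n))"
  have m_int: "m n integrable_on {A..B}" for n
  proof -
    have "m n absolutely_integrable_on {A..B}"
      unfolding m_def
      by (intro absolutely_integrable_min_1 absolutely_integrable_on_const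
          absolutely_integrable_on_iff_nonneg[THEN iffD2, OF _ g] g0) auto
    then show ?thesis by (rule absolutely_integrable_on_def[THEN iffD1, THEN conjunct1])
  qed
  have "(\<lambda>n. integral {A..B} (m n)) \<longlonglongrightarrow> integral {A..B} g"
  proof (rule dominated_convergence(2)[OF m_int g])
    show "norm (m n x) \<le> g x" if "x \<in> {A..B}" for n x
      using g0[OF that] by (auto simp: m_def min_def)
    show "(\<lambda>n. m n x) \<longlonglongrightarrow> g x" for x
    proof (rule tendsto_eventually)
      obtain N :: nat where "g x \<le> N" using real_arch_simple by blast
      then show "\<forall>\<^sub>F n in sequentially. m n x = g x"
        unfolding eventually_sequentially m_def by (intro exI[of _ N]) auto
    qed
  qed
  then obtain n where n: "\<bar>integral {A..B} (m n) - integral {A..B} g\<bar> < \<epsilon> / 2"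
    using \<epsilon> unfolding LIMSEQ_iff real_norm_def by (meson half_gt_zero order_refl)
  define r where "r = (\<lambda>x. g x - m n x)"
  have r: "r integrable_on {A..B}" "\<And>x. 0 \<le> r x"
    unfolding r_def using g m_int by (auto intro: integrable_diff simp: m_def)
  have r_small: "integral {A..B} r < \<epsilon> / 2"
    using n unfolding r_def integral_diff[OF g m_int] by linarith
  let ?\<delta> = "\<epsilon> / (2 * (real n + 1))"
  show "\<exists>\<delta>>0. \<forall>D. finite D \<and> (\<forall>(a, b)\<in>D. a \<le> b \<and> {a..b} \<subseteq> {A..B}) \<and>
        pairwise (\<lambda>(a, b) (c, d). disjnt {a<..<b} {c<..<d}) D \<and>
        (\<Sum>(a, b)\<in>D. b - a) < \<delta>
        \<longrightarrow> (\<Sum>(a, b)\<in>D. dist (f a) (f b)) < \<epsilon>"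
  proof (intro exI[of _ ?\<delta>] conjI allI impI)
    show "?\<delta> > 0" using \<epsilon> by simp
    fix D :: "(real \<times> real) set"
    assume D: "finite D \<and> (\<forall>(a, b)\<in>D. a \<le> b \<and> {a..b} \<subseteq> {A..B}) \<and>
        pairwise (\<lambda>(a, b) (c, d). disjnt {a<..<b} {c<..<d}) D \<and>
        (\<Sum>(a, b)\<in>D. b - a) < ?\<delta>"
    have cell: "dist (f a) (f b) \<le> real n * (b - a) + integral {a..b} r" if "(a, b) \<in> D" for a b
    proof -
      have ab: "a \<le> b" "{a..b} \<subseteq> {A..B}" using D that by auto
      note ii = integrable_subinterval_real[OF _ ab(2)]
      have "dist (f a) (f b) \<le> integral {a..b} g" using ab by (intro bound) auto
      also have "integral {a..b} g = integral {a..b} (m n) + integral {a..b} r"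
        using integral_add[OF ii[OF m_int[of n]] ii[OF r(1)]] by (simp add: r_def)
      also have "integral {a..b} (m n) \<le> integral {a..b} (\<lambda>x. real n)"
        by (rule integral_le) (use ii[OF m_int] in \<open>auto simp: m_def\<close>)
      also have "\<dots> = n * (b - a)" using ab by simp
      finally show ?thesis by simp
    qed
    have "(\<Sum>(a, b)\<in>D. dist (f a) (f b)) \<le> (\<Sum>(a, b)\<in>D. n * (b - a) + integral {a..b} r)"
      using cell by (intro sum_mono) auto
    also have "\<dots> = n * (\<Sum>(a, b)\<in>D. b - a) + (\<Sum>(a, b)\<in>D. integral {a..b} r)"
      by (simp add: split_def sum.distrib sum_distrib_left)
    also have "\<dots> \<le> n * ?\<delta> + integral {A..B} r"
      using D r by (intro add_mono mult_left_mono sum_integral_disjoint_le) auto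
    also have "\<dots> < \<epsilon> / 2 + \<epsilon> / 2"
    proof (rule add_le_less_mono[OF _ r_small])
      have "n * ?\<delta> \<le> (real n + 1) * ?\<delta>" using \<epsilon> by (intro mult_right_mono) auto
      also have "\<dots> = \<epsilon> / 2" using of_nat_0_le_iff[of n] by (auto simp: field_simps)
      finally show "n * ?\<delta> \<le> \<epsilon> / 2" .
    qed
    finally show "(\<Sum>(a, b)\<in>D. dist (f a) (f b)) < \<epsilon>" by simp
  qed
qed

lemma abs_continuous_on_subset:
  assumes ac: "abs_continuous_on S f" and sub: "S' \<subseteq> S"
  shows "abs_continuous_on S' f"
  unfolding abs_continuous_on_def
proof (intro allI impI)
  fix \<epsilon> :: real assume \<epsilon>: "0 < \<epsilon>"
  obtain \<delta> where \<delta>: "0 < \<delta>"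
    and small: "\<And>D. \<lbrakk>finite D; \<forall>(c, d)\<in>D. c \<le> d \<and> {c..d} \<subseteq> S;
      pairwise (\<lambda>(a, b) (c, d). disjnt {a<..<b} {c<..<d}) D;
      (\<Sum>(a, b)\<in>D. b - a) < \<delta>\<rbrakk> \<Longrightarrow> (\<Sum>(a, b)\<in>D. dist (f a) (f b)) < \<epsilon>"
    by (rule abs_continuous_onE[OF ac \<epsilon>]) (rule that; assumption)
  show "\<exists>\<delta>>0. \<forall>D. finite D \<and> (\<forall>(c, d)\<in>D. c \<le> d \<and> {c..d} \<subseteq> S') \<and>
      pairwise (\<lambda>(a, b) (c, d). disjnt {a<..<b} {c<..<d}) D \<and>
      (\<Sum>(a, b)\<in>D. b - a) < \<delta>
      \<longrightarrow> (\<Sum>(a, b)\<in>D. dist (f a) (f b)) < \<epsilon>"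
  proof (intro exI[of _ \<delta>] conjI allI impI \<delta>, elim conjE)
    fix D :: "(real \<times> real) set"
    assume D: "finite D" "\<forall>(c, d)\<in>D. c \<le> d \<and> {c..d} \<subseteq> S'"
      "pairwise (\<lambda>(a, b) (c, d). disjnt {a<..<b} {c<..<d}) D" "(\<Sum>(a, b)\<in>D. b - a) < \<delta>"
    have "\<forall>(c, d)\<in>D. c \<le> d \<and> {c..d} \<subseteq> S"
      using D(2) sub unfolding split_def by blast
    then show "(\<Sum>(a, b)\<in>D. dist (f a) (f b)) < \<epsilon>" by (rule small[OF D(1) _ D(3,4)])
  qed
qed

corollary abs_continuous_derivative_0_imp_eq_left:
  fixes f :: "real \<Rightarrow> real"
  assumes ac: "abs_continuous_on {a..b} f" and N: "negligible N"
    and deriv: "\<And>x. x \<in> {a..b} - N \<Longrightarrow> (f has_vector_derivative 0) (at x within {a..b})"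
    and t: "t \<in> {a..b}"
  shows "f t = f a"
proof (rule abs_continuous_derivative_0_imp_constant[where f = f and a = a and b = t and N = N])
  have sub: "{a..t} \<subseteq> {a..b}" using t by auto
  show "abs_continuous_on {a..t} f" by (rule abs_continuous_on_subset[OF ac sub])
  show "(f has_vector_derivative 0) (at x within {a..t})" if "x \<in> {a..t} - N" for x
    by (rule has_vector_derivative_within_subset[OF deriv sub]) (use that sub in blast)
qed (use t N in auto)

lemma abs_continuous_on_dominated:
  assumes "abs_continuous_on S q" "abs_continuous_on S p"
    and le: "\<And>s t. \<lbrakk>s \<in> S; t \<in> S\<rbrakk> \<Longrightarrow> dist (f s) (f t) \<le> dist (q s) (q t) + dist (p s) (p t)"
  shows "abs_continuous_on S f"
  unfolding abs_continuous_on_def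
proof (intro allI impI)
  fix \<epsilon> :: real assume "0 < \<epsilon>"
  then have h: "0 < \<epsilon> / 2" by simp
  from assms(1)[unfolded abs_continuous_on_def, rule_format, OF h]
  obtain \<delta>1 where "0 < \<delta>1" and D1: "\<forall>D. finite D \<and> (\<forall>(a, b)\<in>D. a \<le> b \<and> {a..b} \<subseteq> S) \<and>
        pairwise (\<lambda>(a, b) (c, d). disjnt {a<..<b} {c<..<d}) D \<and> (\<Sum>(a, b)\<in>D. b - a) < \<delta>1
        \<longrightarrow> (\<Sum>(a, b)\<in>D. dist (q a) (q b)) < \<epsilon> / 2"
    by (elim exE conjE)
  from assms(2)[unfolded abs_continuous_on_def, rule_format, OF h]
  obtain \<delta>2 where "0 < \<delta>2" and D2: "\<forall>D. finite D \<and> (\<forall>(a, b)\<in>D. a \<le> b \<and> {a..b} \<subseteq> S) \<and>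
        pairwise (\<lambda>(a, b) (c, d). disjnt {a<..<b} {c<..<d}) D \<and> (\<Sum>(a, b)\<in>D. b - a) < \<delta>2
        \<longrightarrow> (\<Sum>(a, b)\<in>D. dist (p a) (p b)) < \<epsilon> / 2"
    by (elim exE conjE)
  show "\<exists>\<delta>>0. \<forall>D. finite D \<and> (\<forall>(a, b)\<in>D. a \<le> b \<and> {a..b} \<subseteq> S) \<and>
        pairwise (\<lambda>(a, b) (c, d). disjnt {a<..<b} {c<..<d}) D \<and>
        (\<Sum>(a, b)\<in>D. b - a) < \<delta>
        \<longrightarrow> (\<Sum>(a, b)\<in>D. dist (f a) (f b)) < \<epsilon>"
  proof (intro exI[of _ "min \<delta>1 \<delta>2"] conjI allI impI)
    fix D :: "(real \<times> real) set"
    assume D: "finite D \<and> (\<forall>(a, b)\<in>D. a \<le> b \<and> {a..b} \<subseteq> S) \<and>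
        pairwise (\<lambda>(a, b) (c, d). disjnt {a<..<b} {c<..<d}) D \<and> (\<Sum>(a, b)\<in>D. b - a) < min \<delta>1 \<delta>2"
    have "(\<Sum>(a, b)\<in>D. dist (f a) (f b)) \<le> (\<Sum>(a, b)\<in>D. dist (q a) (q b) + dist (p a) (p b))"
    proof (rule sum_mono)
      fix z assume z: "z \<in> D"
      obtain a b where ab: "z = (a, b)" by (cases z)
      have "a \<le> b" "{a..b} \<subseteq> S" using D z ab by auto
      then have "a \<in> S" "b \<in> S" by auto
      then show "(\<lambda>(a, b). dist (f a) (f b)) z \<le> (\<lambda>(a, b). dist (q a) (q b) + dist (p a) (p b)) z"
        using le ab by simp
    qed
    also have "\<dots> = (\<Sum>(a, b)\<in>D. dist (q a) (q b)) + (\<Sum>(a, b)\<in>D. dist (p a) (p b))"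
      by (simp add: split_def sum.distrib)
    also have "\<dots> < \<epsilon> / 2 + \<epsilon> / 2"
      using D D1[rule_format, of D] D2[rule_format, of D] by (intro add_strict_mono) auto
    finally show "(\<Sum>(a, b)\<in>D. dist (f a) (f b)) < \<epsilon>" by simp
  qed (use \<open>0 < \<delta>1\<close> \<open>0 < \<delta>2\<close> in auto)
qed

section \<open>Square integrable controls\<close>

lemma AE_lebesgue_on_interval_iff:
  fixes a b :: real
  shows "(AE t in lebesgue_on {a..b}. P t) \<longleftrightarrow> (\<exists>N. negligible N \<and> (\<forall>t\<in>{a..b} - N. P t))"
proof -
  have "(AE t in lebesgue_on {a..b}. P t) \<longleftrightarrow> (AE t in lebesgue. t \<in> {a..b} \<longrightarrow> P t)"
    by (rule AE_restrict_space_iff) simp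
  also have "\<dots> \<longleftrightarrow> (\<exists>N. negligible N \<and> {t. \<not> (t \<in> {a..b} \<longrightarrow> P t)} \<subseteq> N)"
    by (rule eventually_ae_filter_negligible)
  also have "\<dots> \<longleftrightarrow> (\<exists>N. negligible N \<and> (\<forall>t\<in>{a..b} - N. P t))"
    by (intro ex_cong1 conj_cong refl) blast
  finally show ?thesis .
qed

lemma AE_lebesgue_on_intervalI:
  fixes a b :: real
  assumes "negligible N" "\<And>t. t \<in> {a..b} - N \<Longrightarrow> P t"
  shows "AE t in lebesgue_on {a..b}. P t"
  unfolding AE_lebesgue_on_interval_iff using assms by blast

lemma AE_lebesgue_on_intervalE:
  fixes a b :: real
  assumes "AE t in lebesgue_on {a..b}. P t"
  obtains N where "negligible N" "\<And>t. t \<in> {a..b} - N \<Longrightarrow> P t"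
proof -
  from assms[unfolded AE_lebesgue_on_interval_iff]
  obtain N where "negligible N" "\<forall>t\<in>{a..b} - N. P t" by (elim exE conjE)
  then show thesis by (intro that[of N]) auto
qed

lemma integral_increment:
  fixes f :: "real \<Rightarrow> 'a::banach"
  assumes "f integrable_on {a..b}" "a \<le> s" "s \<le> t" "t \<le> b"
  shows "integral {a..t} f - integral {a..s} f = integral {s..t} f"
  using Henstock_Kurzweil_Integration.integral_combine[of a s t f]
    integrable_subinterval_real[OF assms(1), of a t] assms by (simp add: algebra_simps)

lemma L2_controls_iff:
  "u \<in> L2_controls T \<longleftrightarrow> u \<in> borel_measurable (lebesgue_on {0..T}) \<and> (\<lambda>t. (u t)\<^sup>2) integrable_on {0..T}"
proof -
  have "integrable (lebesgue_on {0..T}) (\<lambda>t. (u t)\<^sup>2) \<longleftrightarrow> (\<lambda>t. (u t)\<^sup>2) absolutely_integrable_on {0..T}"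
    using absolutely_integrable_measurable_real[of "{0..T}" "\<lambda>t. (u t)\<^sup>2"] by auto
  also have "\<dots> \<longleftrightarrow> (\<lambda>t. (u t)\<^sup>2) integrable_on {0..T}"
    by (rule absolutely_integrable_on_iff_nonneg) simp
  finally show ?thesis unfolding L2_controls_def by blast
qed

lemma elastic_energy_eq_integral:
  "u \<in> L2_controls T \<Longrightarrow> elastic_energy T u = 1 / 2 * integral {0..T} (\<lambda>t. (u t)\<^sup>2)"
  unfolding elastic_energy_def L2_controls_def by (auto simp: lebesgue_integral_eq_integral)

lemma L2_mult_absolutely_integrable:
  assumes "u \<in> L2_controls T" "v \<in> L2_controls T"
  shows "(\<lambda>t. u t * v t) absolutely_integrable_on {0..T}"
proof (rule measurable_bounded_by_integrable_imp_absolutely_integrable)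
  show "(\<lambda>t. u t * v t) \<in> borel_measurable (lebesgue_on {0..T})"
    using assms by (intro borel_measurable_times) (auto simp: L2_controls_iff)
  show "(\<lambda>t. (u t)\<^sup>2 + (v t)\<^sup>2) integrable_on {0..T}"
    using assms by (intro integrable_add) (auto simp: L2_controls_iff)
  show "norm (u t * v t) \<le> (u t)\<^sup>2 + (v t)\<^sup>2" for t
  proof -
    have "2 * (\<bar>u t\<bar> * \<bar>v t\<bar>) \<le> (u t)\<^sup>2 + (v t)\<^sup>2"
      using sum_squares_bound[of "\<bar>u t\<bar>" "\<bar>v t\<bar>"] by simp
    moreover have "0 \<le> \<bar>u t\<bar> * \<bar>v t\<bar>" by simp
    ultimately have "\<bar>u t\<bar> * \<bar>v t\<bar> \<le> (u t)\<^sup>2 + (v t)\<^sup>2" by linarith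
    then show ?thesis by (simp add: abs_mult)
  qed
qed simp

lemma L2_mult_integrable:
  "u \<in> L2_controls T \<Longrightarrow> v \<in> L2_controls T \<Longrightarrow> (\<lambda>t. u t * v t) integrable_on {0..T}"
  using L2_mult_absolutely_integrable absolutely_integrable_on_def by blast

lemma L2_continuous:
  assumes "continuous_on {0..T} u" shows "u \<in> L2_controls T"
  unfolding L2_controls_iff
  using assms by (auto intro!: continuous_imp_measurable_on_sets_lebesgue integrable_continuous_real continuous_intros)

lemma L2_const: "(\<lambda>t. c) \<in> L2_controls T"
  by (rule L2_continuous) simp

lemma L2_absolutely_integrable:
  "u \<in> L2_controls T \<Longrightarrow> u absolutely_integrable_on {0..T}"
  using L2_mult_absolutely_integrable[OF _ L2_const[of 1]] by simp

lemma L2_integrable: "u \<in> L2_controls T \<Longrightarrow> u integrable_on {0..T}"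
  using L2_absolutely_integrable absolutely_integrable_on_def by blast

lemma L2_abs_integrable: "u \<in> L2_controls T \<Longrightarrow> (\<lambda>t. \<bar>u t\<bar>) integrable_on {0..T}"
  using L2_absolutely_integrable unfolding absolutely_integrable_on_def by simp

lemma L2_scale:
  assumes "u \<in> L2_controls T" shows "(\<lambda>t. c * u t) \<in> L2_controls T"
  using assms unfolding L2_controls_iff power_mult_distrib
  by (auto intro!: borel_measurable_times integrable_on_mult_right)

lemma L2_add:
  assumes u: "u \<in> L2_controls T" and v: "v \<in> L2_controls T"
  shows "(\<lambda>t. u t + v t) \<in> L2_controls T"
  unfolding L2_controls_iff
proof
  show "(\<lambda>t. u t + v t) \<in> borel_measurable (lebesgue_on {0..T})"
    using u v by (intro borel_measurable_add) (auto simp: L2_controls_iff)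
  have "(\<lambda>t. u t * u t + 2 * (u t * v t) + v t * v t) integrable_on {0..T}"
    using u v by (intro integrable_add integrable_on_mult_right L2_mult_integrable) auto
  then show "(\<lambda>t. (u t + v t)\<^sup>2) integrable_on {0..T}"
    by (simp add: power2_eq_square algebra_simps)
qed

lemma L2_diff:
  "u \<in> L2_controls T \<Longrightarrow> v \<in> L2_controls T \<Longrightarrow> (\<lambda>t. u t - v t) \<in> L2_controls T"
  using L2_add[of u T "\<lambda>t. - 1 * v t"] L2_scale[of v T "- 1"] by simp

text \<open>This makes the primitives of an \<open>L\<^sub>2\<close>-bounded family of controls uniformly Hoelder continuous.\<close>

lemma L2_cauchy_schwarz:
  assumes u: "u \<in> L2_controls T" and st: "0 \<le> s" "s \<le> t" "t \<le> T"
  shows "(integral {s..t} u)\<^sup>2 \<le> (t - s) * integral {0..T} (\<lambda>t. (u t)\<^sup>2)"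
proof (cases "s = t")
  case False
  then have st': "0 < t - s" using st by simp
  note sub = integrable_subinterval_real[of _ 0 T s t]
  have ui: "u integrable_on {s..t}" and u2: "(\<lambda>t. (u t)\<^sup>2) integrable_on {s..t}"
    using u st by (auto intro!: sub L2_integrable simp: L2_controls_iff)
  \<comment> \<open>The inequality is the nonnegativity of the integrated square of \<open>u\<close> minus its mean.\<close>
  define c where "c = integral {s..t} u / (t - s)"
  have "0 \<le> integral {s..t} (\<lambda>r. (u r - c)\<^sup>2)"
    using L2_diff[OF u L2_const[of c]] st
    by (intro Henstock_Kurzweil_Integration.integral_nonneg sub) (auto simp: L2_controls_iff)
  also have "(\<lambda>r. (u r - c)\<^sup>2) = (\<lambda>r. (u r)\<^sup>2 + ((- 2 * c) * u r + c\<^sup>2))"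
    by (auto simp: power2_eq_square algebra_simps)
  also have "integral {s..t} \<dots> = integral {s..t} (\<lambda>r. (u r)\<^sup>2) + ((- 2 * c) * integral {s..t} u + (t - s) * c\<^sup>2)"
    using integral_unique[OF has_integral_add[OF integrable_integral[OF u2]
        has_integral_add[OF has_integral_mult_right[OF integrable_integral[OF ui], of "- 2 * c"]
          has_integral_const_real[of "c\<^sup>2" s t]]]] st
    by simp
  finally have nonneg: "0 \<le> integral {s..t} (\<lambda>r. (u r)\<^sup>2) + ((- 2 * c) * integral {s..t} u + (t - s) * c\<^sup>2)" .
  have c: "integral {s..t} u = (t - s) * c" using st' by (simp add: c_def)
  have "c * integral {s..t} u \<le> integral {s..t} (\<lambda>r. (u r)\<^sup>2)"
    using nonneg unfolding c by (simp add: power2_eq_square algebra_simps)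
  then have "(t - s) * (c * integral {s..t} u) \<le> (t - s) * integral {s..t} (\<lambda>r. (u r)\<^sup>2)"
    using st' by (intro mult_left_mono) auto
  then have "(integral {s..t} u)\<^sup>2 \<le> (t - s) * integral {s..t} (\<lambda>r. (u r)\<^sup>2)"
    unfolding c by (simp add: power2_eq_square mult_ac)
  also have "\<dots> \<le> (t - s) * integral {0..T} (\<lambda>t. (u t)\<^sup>2)"
    using u st by (intro mult_left_mono integral_subset_le u2) (auto simp: L2_controls_iff)
  finally show ?thesis .
qed simp

section \<open>Trajectories as steered curves\<close>

lemma angle_rep_angle [simp]: "angle (rep_angle c) = c"
  by (rule Quotient_abs_rep[OF Quotient_circle])

lemma cos_circle_angle [simp]: "cos_circle (angle a) = cos a"
  by (rule cos_circle.abs_eq)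

lemma sin_circle_angle [simp]: "sin_circle (angle a) = sin a"
  by (rule sin_circle.abs_eq)

lemma dist_angle: "dist (angle a) (angle b) = mod_dist a b"
  by (rule dist_circle.abs_eq)

lemma mod_dist_le_add: "mod_dist a b \<le> mod_dist c d + \<bar>(a - b) - (c - d)\<bar>"
proof -
  obtain k :: int where k: "mod_dist c d = \<bar>c - d + 2 * pi * of_int k\<bar>"
    using mod_dist_attained by blast
  show ?thesis using mod_dist_le[of a b k] unfolding k by linarith
qed

lemma abs_mod_dist_diff_le: "\<bar>mod_dist a b - mod_dist c d\<bar> \<le> \<bar>(a - b) - (c - d)\<bar>"
  using mod_dist_le_add[of a b c d] mod_dist_le_add[of c d a b] by linarith

lemma dist_angle_le: "dist (angle a) (angle b) \<le> \<bar>a - b\<bar>"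
  unfolding dist_angle using mod_dist_le[of a b 0] by simp

lemma dist_prod_le_add: "dist (a, b) (c, d) \<le> dist a c + dist b d"
  unfolding dist_Pair_Pair by (rule sqrt_sum_squares_le_sum) auto

text \<open>The lift of the third coordinate of the trajectory that starts at \<open>q\<close> with control \<open>u\<close>.\<close>

definition heading :: "manifold \<Rightarrow> (real \<Rightarrow> real) \<Rightarrow> real \<Rightarrow> real" where
  "heading q u t = rep_angle (snd (snd q)) + integral {0..t} u"

definition steered_curve :: "manifold \<Rightarrow> (real \<Rightarrow> real) \<Rightarrow> real \<Rightarrow> manifold" where
  "steered_curve q u t = (fst q + integral {0..t} (\<lambda>s. cos (heading q u s)),
     fst (snd q) + integral {0..t} (\<lambda>s. sin (heading q u s)), angle (heading q u t))"

lemma steered_curve_0 [simp]: "steered_curve q u 0 = q"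
  by (simp add: steered_curve_def heading_def)

lemma continuous_heading:
  assumes "u \<in> L2_controls T" shows "continuous_on {0..T} (heading q u)"
  unfolding heading_def
  using indefinite_integral_continuous_1[OF L2_integrable[OF assms]]
  by (intro continuous_intros)

lemma continuous_on_cos_real: "continuous_on UNIV (cos :: real \<Rightarrow> real)"
  and continuous_on_sin_real: "continuous_on UNIV (sin :: real \<Rightarrow> real)"
  by (intro continuous_intros)+

lemma dist_steered_curve_le:
  assumes u: "u \<in> L2_controls T" and st: "0 \<le> s" "s \<le> t" "t \<le> T"
  shows "dist (steered_curve q u s) (steered_curve q u t) \<le> integral {s..t} (\<lambda>r. 2 + \<bar>u r\<bar>)"
proof -
  note sub = integrable_subinterval_real[of _ 0 T s t]
  have cont: "continuous_on {0..T} (\<lambda>r. f (heading q u r))" if "continuous_on UNIV f" for f :: "real \<Rightarrow> real"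
    using continuous_on_compose2[OF that continuous_heading[OF u]] by auto
  have comp: "\<bar>integral {0..s} (\<lambda>r. f (heading q u r)) - integral {0..t} (\<lambda>r. f (heading q u r))\<bar> \<le> t - s"
    if "continuous_on UNIV f" "\<And>x. \<bar>f x\<bar> \<le> 1" for f :: "real \<Rightarrow> real"
  proof -
    have int: "(\<lambda>r. f (heading q u r)) integrable_on {0..T}"
      by (intro integrable_continuous_real cont that)
    have "\<bar>integral {s..t} (\<lambda>r. f (heading q u r))\<bar> \<le> integral {s..t} (\<lambda>r. 1)"
      using integral_norm_bound_integral[OF sub[OF int], of "\<lambda>r. 1"] st that by auto
    then show ?thesis using integral_increment[OF int, of s t] st by (simp add: abs_minus_commute)
  qed
  have ui: "u integrable_on {s..t}" and ua: "(\<lambda>r. \<bar>u r\<bar>) integrable_on {s..t}"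
    using u st by (auto intro!: sub L2_integrable L2_abs_integrable)
  have "\<bar>heading q u s - heading q u t\<bar> = \<bar>integral {s..t} u\<bar>"
    using integral_increment[OF L2_integrable[OF u], of s t] st by (simp add: heading_def abs_minus_commute)
  also have "\<dots> \<le> integral {s..t} (\<lambda>r. \<bar>u r\<bar>)"
    using integral_norm_bound_integral[OF ui ua] by simp
  finally have turn: "dist (angle (heading q u s)) (angle (heading q u t)) \<le> integral {s..t} (\<lambda>r. \<bar>u r\<bar>)"
    using dist_angle_le order_trans by blast
  have "dist (steered_curve q u s) (steered_curve q u t) \<le>
      \<bar>integral {0..s} (\<lambda>r. cos (heading q u r)) - integral {0..t} (\<lambda>r. cos (heading q u r))\<bar> +
      (\<bar>integral {0..s} (\<lambda>r. sin (heading q u r)) - integral {0..t} (\<lambda>r. sin (heading q u r))\<bar> +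
       dist (angle (heading q u s)) (angle (heading q u t)))"
    unfolding steered_curve_def
    by (rule order_trans[OF dist_prod_le_add add_mono[OF _ dist_prod_le_add[THEN order_trans]]])
       (auto simp: dist_real_def)
  also have "\<dots> \<le> (t - s) + ((t - s) + integral {s..t} (\<lambda>r. \<bar>u r\<bar>))"
    by (intro add_mono turn comp continuous_on_cos_real continuous_on_sin_real abs_cos_le_one abs_sin_le_one)
  also have "\<dots> = integral {s..t} (\<lambda>r. 2 + \<bar>u r\<bar>)"
    using integral_add[OF integrable_const_ivl[of "2::real" s t] ua] st by (simp add: algebra_simps)
  finally show ?thesis .
qed

lemma abs_continuous_steered_curve:
  assumes u: "u \<in> L2_controls T"
  shows "abs_continuous_on {0..T} (steered_curve q u)"
proof (rule abs_continuous_onI_integral_bound)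
  show "(\<lambda>r. 2 + \<bar>u r\<bar>) integrable_on {0..T}"
    by (intro integrable_add L2_abs_integrable u) auto
qed (use dist_steered_curve_le[OF u] in auto)

lemma heading_has_derivative:
  assumes u: "u \<in> L2_controls T"
  obtains N where "negligible N" "\<And>t. t \<in> {0..T} - N \<Longrightarrow>
    (heading q u has_vector_derivative u t) (at t within {0..T})"
proof -
  obtain N where N: "negligible N" "\<And>x. x \<in> {0..T} - N \<Longrightarrow>
      ((\<lambda>t. integral {0..t} u) has_vector_derivative u x) (at x within {0..T})"
    using lebesgue_differentiation[OF L2_integrable[OF u]] by metis
  show thesis
  proof (rule that[OF N(1)])
    fix t assume "t \<in> {0..T} - N"
    from has_vector_derivative_add[OF has_vector_derivative_const N(2)[OF this]]
    show "(heading q u has_vector_derivative u t) (at t within {0..T})"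
      unfolding heading_def by simp
  qed
qed

lemma displacement_has_derivative:
  assumes u: "u \<in> L2_controls T" and t: "t \<in> {0..T}" and f: "continuous_on UNIV f"
  shows "((\<lambda>t. c + integral {0..t} (\<lambda>s. f (heading q u s))) has_vector_derivative (f (heading q u t) :: real))
    (at t within {0..T})"
proof -
  have "continuous_on {0..T} (\<lambda>r. f (heading q u r))"
    using continuous_on_compose2[OF f continuous_heading[OF u]] by auto
  from has_vector_derivative_add[OF has_vector_derivative_const integral_has_vector_derivative[OF this t]]
  show ?thesis by simp
qed

lemma steered_curve_has_velocity:
  assumes u: "u \<in> L2_controls T"
  obtains N where "negligible N" "\<And>t. t \<in> {0..T} - N \<Longrightarrow>
    has_velocity (steered_curve q u) (elastic_rhs (steered_curve q u t) (u t)) t {0..T}"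
proof -
  obtain N where N: "negligible N" "\<And>t. t \<in> {0..T} - N \<Longrightarrow>
    (heading q u has_vector_derivative u t) (at t within {0..T})"
    using heading_has_derivative[OF u] by metis
  show thesis
  proof (rule that[OF N(1)])
    fix t assume t: "t \<in> {0..T} - N"
    let ?r = "\<lambda>t. (fst q + integral {0..t} (\<lambda>s. cos (heading q u s)),
     fst (snd q) + integral {0..t} (\<lambda>s. sin (heading q u s)), heading q u t)"
    have "(?r has_vector_derivative (cos (heading q u t), sin (heading q u t), u t)) (at t within {0..T})"
      using t by (intro has_vector_derivative_Pair displacement_has_derivative[OF u] N(2))
        (auto intro: continuous_on_cos_real continuous_on_sin_real)
    then show "has_velocity (steered_curve q u) (elastic_rhs (steered_curve q u t) (u t)) t {0..T}"
      unfolding has_velocity_def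
      by (intro exI[of _ ?r]) (simp add: steered_curve_def covering_def)
  qed
qed

lemma trajectory_steered_curve:
  assumes u: "u \<in> L2_controls T"
  shows "trajectory T u (steered_curve q u)"
  unfolding trajectory_def AE_lebesgue_on_interval_iff
  using abs_continuous_steered_curve[OF u, of q] steered_curve_has_velocity[OF u, of q] by metis

text \<open>Used to compare two curves on the circle: the distance between them need not be differentiable
where they meet, but it varies no faster than the difference of two lifts.\<close>

lemma has_vector_derivative_0_dominated:
  fixes f g :: "real \<Rightarrow> real"
  assumes g: "(g has_vector_derivative 0) (at t within S)"
    and le: "\<And>s. s \<in> S \<Longrightarrow> \<bar>f s - f t\<bar> \<le> \<bar>g s - g t\<bar>"
  shows "(f has_vector_derivative 0) (at t within S)"
  unfolding has_vector_derivative_def has_derivative_within_alt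
proof (intro conjI allI impI)
  fix e :: real assume "0 < e"
  then obtain d where d: "d > 0" "\<forall>y\<in>S. norm (y - t) < d \<longrightarrow> norm (g y - g t - (y - t) *\<^sub>R 0) \<le> e * norm (y - t)"
    using g unfolding has_vector_derivative_def has_derivative_within_alt by blast
  have "norm (f y - f t - (y - t) *\<^sub>R 0) \<le> e * norm (y - t)" if "y \<in> S" "norm (y - t) < d" for y
    using d(2) that le[OF that(1)] by force
  then show "\<exists>d>0. \<forall>y\<in>S. norm (y - t) < d \<longrightarrow> norm (f y - f t - (y - t) *\<^sub>R 0) \<le> e * norm (y - t)"
    using d(1) by blast
qed (rule bounded_linear_scaleR_left)

text \<open>Uniqueness of trajectories. The lift that realises the velocity at \<open>t\<close> may depend on \<open>t\<close>, so the
angle is not compared through a global lift but through the distance on the circle to the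
expected angle; this real function is absolutely continuous with derivative zero almost
everywhere. With the angle known, each position coordinate has the expected derivative.\<close>

lemma trajectory_eq_steered_curve:
  assumes u: "u \<in> L2_controls T" and q: "trajectory T u q" and t: "t \<in> {0..T}"
  shows "q t = steered_curve (q 0) u t"
proof -
  define p where "p = steered_curve (q 0) u"
  define h where "h = heading (q 0) u"
  have acq: "abs_continuous_on {0..T} q" and acp: "abs_continuous_on {0..T} p"
    using q abs_continuous_steered_curve[OF u] by (auto simp: trajectory_def p_def)
  obtain N1 where N1: "negligible N1"
    "\<And>t. t \<in> {0..T} - N1 \<Longrightarrow> has_velocity q (elastic_rhs (q t) (u t)) t {0..T}"
    using q unfolding trajectory_def AE_lebesgue_on_interval_iff by blast
  obtain N2 where N2: "negligible N2"
    "\<And>t. t \<in> {0..T} - N2 \<Longrightarrow> (h has_vector_derivative u t) (at t within {0..T})"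
    using heading_has_derivative[OF u, of "q 0"] unfolding h_def by metis
  have N: "negligible (N1 \<union> N2)" using N1 N2 by (intro negligible_Un)
  have lift: "\<exists>x y a. (\<forall>s\<in>{0..T}. q s = (x s, y s, angle (a s))) \<and>
      (x has_vector_derivative cos_circle (snd (snd (q t)))) (at t within {0..T}) \<and>
      (y has_vector_derivative sin_circle (snd (snd (q t)))) (at t within {0..T}) \<and>
      (a has_vector_derivative u t) (at t within {0..T})" if tN: "t \<in> {0..T} - (N1 \<union> N2)" for t
  proof -
    obtain r where r: "\<forall>s\<in>{0..T}. q s = covering (r s)"
      "(r has_vector_derivative elastic_rhs (q t) (u t)) (at t within {0..T})"
      using N1(2)[of t] tN unfolding has_velocity_def by blast
    have rhs: "elastic_rhs (q t) (u t) = (cos_circle (snd (snd (q t))), sin_circle (snd (snd (q t))), u t)"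
      by (cases "q t") simp
    note r2 = r(2)[unfolded rhs]
    have d1: "((\<lambda>s. fst (r s)) has_vector_derivative cos_circle (snd (snd (q t)))) (at t within {0..T})"
      using bounded_linear.has_vector_derivative[OF bounded_linear_fst r2] by simp
    have d2: "((\<lambda>s. snd (r s)) has_vector_derivative (sin_circle (snd (snd (q t))), u t)) (at t within {0..T})"
      using bounded_linear.has_vector_derivative[OF bounded_linear_snd r2] by simp
    have d3: "((\<lambda>s. fst (snd (r s))) has_vector_derivative sin_circle (snd (snd (q t)))) (at t within {0..T})"
      using bounded_linear.has_vector_derivative[OF bounded_linear_fst d2] by simp
    have d4: "((\<lambda>s. snd (snd (r s))) has_vector_derivative u t) (at t within {0..T})"
      using bounded_linear.has_vector_derivative[OF bounded_linear_snd d2] by simp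
    show ?thesis
      by (rule exI[of _ "\<lambda>s. fst (r s)"], rule exI[of _ "\<lambda>s. fst (snd (r s))"],
          rule exI[of _ "\<lambda>s. snd (snd (r s))"])
        (use r(1) d1 d3 d4 in \<open>simp add: covering_def split_def\<close>)
  qed
  have angle_eq: "snd (snd (q t)) = angle (h t)" if t: "t \<in> {0..T}" for t
  proof -
    define f where "f = (\<lambda>s. dist (snd (snd (q s))) (angle (h s)))"
    have "f t = f 0"
    proof (rule abs_continuous_derivative_0_imp_eq_left[OF _ N _ t])
      show "abs_continuous_on {0..T} f"
      proof (rule abs_continuous_on_dominated[OF acq acp])
        fix s t assume "s \<in> {0..T}" "t \<in> {0..T}"
        have "dist (snd (snd (q s))) (snd (snd (q t))) \<le> dist (q s) (q t)"
          using order_trans[OF dist_snd_le dist_snd_le, of "q s" "q t"] by simp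
        moreover have "dist (angle (h s)) (angle (h t)) \<le> dist (p s) (p t)"
          using order_trans[OF dist_snd_le dist_snd_le, of "p s" "p t"]
          by (simp add: p_def steered_curve_def h_def)
        moreover have "\<bar>dist a b - dist c d\<bar> \<le> dist a c + dist b d" for a b c d :: circle
          using dist_triangle[of a b c] dist_triangle[of c b d] dist_triangle[of c d a] dist_triangle[of a d b]
          by (simp add: dist_commute)
        ultimately show "dist (f s) (f t) \<le> dist (q s) (q t) + dist (p s) (p t)"
          unfolding f_def dist_real_def using add_mono order_trans by blast
      qed
      fix t assume tN: "t \<in> {0..T} - (N1 \<union> N2)"
      obtain x y a where a': "\<forall>s\<in>{0..T}. q s = (x s, y s, angle (a s))"
        and da: "(a has_vector_derivative u t) (at t within {0..T})"
        using lift[OF tN] by blast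
      then have a: "\<forall>s\<in>{0..T}. snd (snd (q s)) = angle (a s)" by simp
      show "(f has_vector_derivative 0) (at t within {0..T})"
      proof (rule has_vector_derivative_0_dominated)
        show "((\<lambda>s. a s - h s) has_vector_derivative 0) (at t within {0..T})"
          using has_vector_derivative_diff[OF da N2(2)[of t]] tN by simp
        show "\<bar>f s - f t\<bar> \<le> \<bar>(a s - h s) - (a t - h t)\<bar>" if "s \<in> {0..T}" for s
          using a that tN abs_mod_dist_diff_le by (simp add: f_def dist_angle)
      qed
    qed
    also have "f 0 = 0" by (simp add: f_def h_def heading_def)
    finally show ?thesis by (simp add: f_def)
  qed
  have coord: "g (q t) = g (q 0) + integral {0..t} (\<lambda>s. f (heading (q 0) u s))"
    if t: "t \<in> {0..T}" and f: "continuous_on UNIV f"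
      and g: "\<And>a b. \<bar>g a - g b\<bar> \<le> dist a b"
      and gp: "\<And>t. g (p t) = g (q 0) + integral {0..t} (\<lambda>s. f (heading (q 0) u s))"
      and dg: "\<And>t. t \<in> {0..T} - (N1 \<union> N2) \<Longrightarrow>
        ((\<lambda>s. g (q s)) has_vector_derivative f (h t)) (at t within {0..T})"
    for g :: "manifold \<Rightarrow> real" and f t
  proof -
    define F where "F = (\<lambda>s. g (q s) - g (p s))"
    have "F t = F 0"
    proof (rule abs_continuous_derivative_0_imp_eq_left[OF _ N _ t])
      show "abs_continuous_on {0..T} F"
      proof (rule abs_continuous_on_dominated[OF acq acp])
        fix s t
        show "dist (F s) (F t) \<le> dist (q s) (q t) + dist (p s) (p t)"
          using g[of "q s" "q t"] g[of "p s" "p t"] unfolding F_def dist_real_def by linarith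
      qed
      fix t assume tN: "t \<in> {0..T} - (N1 \<union> N2)"
      then show "(F has_vector_derivative 0) (at t within {0..T})"
        using has_vector_derivative_diff[OF dg[OF tN] displacement_has_derivative[OF u _ f, of t "g (q 0)" "q 0"]]
        unfolding F_def gp by (simp add: h_def)
    qed
    then show ?thesis using gp[of t] by (simp add: F_def p_def)
  qed
  have "fst (q t) = fst (q 0) + integral {0..t} (\<lambda>s. cos (heading (q 0) u s))"
  proof (rule coord[OF t, where g = fst and f = cos])
    fix t assume tN: "t \<in> {0..T} - (N1 \<union> N2)"
    obtain x y a where r: "\<forall>s\<in>{0..T}. q s = (x s, y s, angle (a s))"
      and dx: "(x has_vector_derivative cos_circle (snd (snd (q t)))) (at t within {0..T})"
      using lift[OF tN] by blast
    have x: "fst (q s) = x s" if "s \<in> {0..T}" for s using r that by simp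
    show "((\<lambda>s. fst (q s)) has_vector_derivative cos (h t)) (at t within {0..T})"
      using has_vector_derivative_transform[OF _ x dx] angle_eq[of t] tN by simp
  qed (use dist_fst_le in \<open>auto simp: p_def steered_curve_def dist_real_def[symmetric] intro: continuous_on_cos_real\<close>)
  moreover have "fst (snd (q t)) = fst (snd (q 0)) + integral {0..t} (\<lambda>s. sin (heading (q 0) u s))"
  proof (rule coord[OF t, where g = "\<lambda>a. fst (snd a)" and f = sin])
    fix t assume tN: "t \<in> {0..T} - (N1 \<union> N2)"
    obtain x y a where r: "\<forall>s\<in>{0..T}. q s = (x s, y s, angle (a s))"
      and dy: "(y has_vector_derivative sin_circle (snd (snd (q t)))) (at t within {0..T})"
      using lift[OF tN] by blast
    have y: "fst (snd (q s)) = y s" if "s \<in> {0..T}" for s using r that by simp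
    show "((\<lambda>s. fst (snd (q s))) has_vector_derivative sin (h t)) (at t within {0..T})"
      using has_vector_derivative_transform[OF _ y dy] angle_eq[of t] tN by simp
  next
    show "\<bar>fst (snd a) - fst (snd b)\<bar> \<le> dist a b" for a b :: manifold
      using order_trans[OF dist_fst_le dist_snd_le, of a b] by (simp add: dist_real_def)
  qed (auto simp: p_def steered_curve_def intro: continuous_on_sin_real)
  ultimately show ?thesis
    using angle_eq[OF t] unfolding steered_curve_def h_def by (metis prod.collapse)
qed

lemma admissible_pair_iff:
  assumes "0 \<le> T"
  shows "admissible_pair q0 q1 T u q \<longleftrightarrow>
    u \<in> L2_controls T \<and> trajectory T u q \<and> q 0 = q0 \<and> steered_curve q0 u T = q1"
  unfolding admissible_pair_def using trajectory_eq_steered_curve[of u T q T] assms by auto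

section \<open>Existence of optimal controls\<close>

text \<open>Beppo Levi's theorem for series.\<close>

lemma AE_summable_if_integrals_summable:
  fixes f :: "nat \<Rightarrow> 'a \<Rightarrow> real"
  assumes int: "\<And>i. integrable M (f i)" and nn: "\<And>i x. 0 \<le> f i x"
    and sum: "summable (\<lambda>i. integral\<^sup>L M (f i))"
  shows "AE x in M. summable (\<lambda>i. f i x)" and "integrable M (\<lambda>x. \<Sum>i. f i x)"
proof -
  have meas: "f i \<in> borel_measurable M" for i using int by auto
  have "(\<integral>\<^sup>+ x. (\<Sum>i. ennreal (f i x)) \<partial>M) = (\<Sum>i. \<integral>\<^sup>+ x. ennreal (f i x) \<partial>M)"
    using meas by (intro nn_integral_suminf) auto
  also have "\<dots> = (\<Sum>i. ennreal (integral\<^sup>L M (f i)))"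
    using int nn by (intro suminf_cong nn_integral_eq_integral) auto
  also have "\<dots> = ennreal (\<Sum>i. integral\<^sup>L M (f i))"
    using sum nn by (intro suminf_ennreal2) (auto intro: integral_nonneg_AE)
  finally have fin: "(\<integral>\<^sup>+ x. (\<Sum>i. ennreal (f i x)) \<partial>M) \<noteq> \<infinity>" by simp
  have "AE x in M. (\<Sum>i. ennreal (f i x)) \<noteq> \<infinity>"
    by (rule nn_integral_PInf_AE[OF _ fin]) (use meas in measurable)
  then show ae: "AE x in M. summable (\<lambda>i. f i x)"
  proof eventually_elim
    case (elim x)
    then show ?case using nn by (intro summable_suminf_not_top) auto
  qed
  show "integrable M (\<lambda>x. \<Sum>i. f i x)"
  proof (rule integrable_suminf[OF int])
    show "AE x in M. summable (\<lambda>i. norm (f i x))" using ae nn by simp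
    show "summable (\<lambda>i. \<integral>x. norm (f i x) \<partial>M)" using sum nn by simp
  qed
qed

text \<open>Cauchy-Schwarz with the weights \<open>2\<^sup>i\<close>, whose reciprocals sum to at most 2.\<close>

lemma square_sum_le_weighted:
  fixes x :: "nat \<Rightarrow> real"
  shows "(\<Sum>i<n. \<bar>x i\<bar>)\<^sup>2 \<le> 2 * (\<Sum>i<n. 2 ^ i * (x i)\<^sup>2)"
proof -
  have "(\<Sum>i<n. \<bar>x i\<bar>)\<^sup>2 = (\<Sum>i<n. sqrt ((1 / 2) ^ i) * (sqrt (2 ^ i) * \<bar>x i\<bar>))\<^sup>2"
    by (simp add: real_sqrt_mult[symmetric] power_mult_distrib[symmetric] flip: mult.assoc)
  also have "\<dots> \<le> (\<Sum>i<n. (sqrt ((1 / 2) ^ i))\<^sup>2) * (\<Sum>i<n. (sqrt (2 ^ i) * \<bar>x i\<bar>)\<^sup>2)"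
    by (rule Cauchy_Schwarz_ineq_sum)
  also have "\<dots> = (\<Sum>i<n. (1 / 2) ^ i) * (\<Sum>i<n. 2 ^ i * (x i)\<^sup>2)"
    by (simp add: power_mult_distrib)
  also have "\<dots> \<le> 2 * (\<Sum>i<n. 2 ^ i * (x i)\<^sup>2)"
  proof (rule mult_right_mono)
    have "(\<Sum>i<n. (1 / 2 :: real) ^ i) \<le> (\<Sum>i. (1 / 2) ^ i)"
      by (rule sum_le_suminf) auto
    then show "(\<Sum>i<n. (1 / 2 :: real) ^ i) \<le> 2" by (simp add: suminf_geometric)
  qed (auto intro: sum_nonneg)
  finally show ?thesis .
qed

text \<open>Completeness of \<open>L\<^sub>2\<close>, for a rapidly convergent sequence. The series of the \<open>2\<^sup>k\<close>-weighted squares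
of the increments has finite integral. Where it converges the sequence converges too, and
together with the square of the first term the series dominates the squares of all terms, so that dominated convergence applies both to the
functions and to their squares.\<close>

lemma L2_limit:
  assumes v: "\<And>k. v k \<in> L2_controls T"
    and small: "\<And>k. integral {0..T} (\<lambda>t. (v (Suc k) t - v k t)\<^sup>2) \<le> C * (1 / 4) ^ k"
  obtains u where "u \<in> L2_controls T"
    "\<And>t. t \<in> {0..T} \<Longrightarrow> (\<lambda>k. integral {0..t} (v k)) \<longlonglongrightarrow> integral {0..t} u"
    "(\<lambda>k. integral {0..T} (\<lambda>t. (v k t)\<^sup>2)) \<longlonglongrightarrow> integral {0..T} (\<lambda>t. (u t)\<^sup>2)"
proof -
  let ?M = "lebesgue_on {0..T}"
  define d where "d = (\<lambda>k t. v (Suc k) t - v k t)"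
  define f where "f = (\<lambda>k t. 2 ^ k * (d k t)\<^sup>2)"
  have d: "d k \<in> L2_controls T" for k unfolding d_def by (intro L2_diff v)
  have fi: "integrable ?M (f k)" for k
    unfolding f_def using d[of k] by (auto simp: L2_controls_def)
  have f_int: "integral\<^sup>L ?M (f k) = 2 ^ k * integral {0..T} (\<lambda>t. (d k t)\<^sup>2)" for k
    using lebesgue_integral_eq_integral[OF fi] by (simp add: f_def)
  have f_le: "norm (integral\<^sup>L ?M (f k)) \<le> C * (1 / 2) ^ k" for k
  proof -
    have "0 \<le> integral {0..T} (\<lambda>t. (d k t)\<^sup>2)"
      using d[of k] by (intro Henstock_Kurzweil_Integration.integral_nonneg) (auto simp: L2_controls_iff)
    moreover have "2 ^ k * integral {0..T} (\<lambda>t. (d k t)\<^sup>2) \<le> 2 ^ k * (C * (1 / 4) ^ k)"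
      using small[of k] by (intro mult_left_mono) (auto simp: d_def)
    moreover have "2 ^ k * (C * (1 / 4) ^ k) = C * (1 / 2 :: real) ^ k"
      by (simp add: power_mult_distrib[symmetric] flip: mult.assoc)
    ultimately show ?thesis unfolding f_int by simp
  qed
  have sum: "summable (\<lambda>k. integral\<^sup>L ?M (f k))"
    by (rule summable_comparison_test'[OF _ f_le]) (intro summable_mult summable_geometric, simp)
  define s where "s = (\<lambda>t. \<Sum>k. f k t)"
  have f0: "0 \<le> f k t" for k t by (simp add: f_def)
  have ae: "AE t in ?M. summable (\<lambda>k. f k t)"
    by (rule AE_summable_if_integrals_summable(1)[OF fi f0 sum])
  obtain N where N: "negligible N" "\<And>t. t \<in> {0..T} - N \<Longrightarrow> summable (\<lambda>k. f k t)"
    by (rule AE_lebesgue_on_intervalE[OF ae]) (rule that)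
  have s_int: "s integrable_on {0..T}"
    using AE_summable_if_integrals_summable(2)[OF fi f0 sum] unfolding s_def
    by (rule integrable_on_lebesgue_on) simp
  define u where "u = (\<lambda>t. if t \<in> N then 0 else lim (\<lambda>k. v k t))"
  define w where "w = (\<lambda>k t. if t \<in> N then 0 else v k t)"
  define h where "h = (\<lambda>t. if t \<in> N then 0 else 2 * (v 0 t)\<^sup>2 + 4 * s t)"
  have telescope: "v k t = v 0 t + (\<Sum>i<k. d i t)" for k t
    by (induction k) (auto simp: d_def)
  have lim: "(\<lambda>k. w k t) \<longlonglongrightarrow> u t" if t: "t \<in> {0..T}" for t
  proof (cases "t \<in> N")
    case False
    have "summable (\<lambda>i. d i t)"
    proof (rule summable_comparison_test')
      show "summable (\<lambda>i. (1 / 2) ^ i + f i t)"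
        using N(2)[of t] t False by (intro summable_add summable_geometric) auto
      show "norm (d i t) \<le> (1 / 2) ^ i + f i t" for i
      proof -
        \<comment> \<open>The inequality between arithmetic and geometric means, split with weight \<open>2\<^sup>i\<close>.\<close>
        have "0 \<le> (1 / 2) ^ i * (1 - 2 ^ i * \<bar>d i t\<bar>)\<^sup>2" by simp
        also have "\<dots> = (1 / 2) ^ i - 2 * \<bar>d i t\<bar> + f i t"
          by (simp add: f_def power2_eq_square algebra_simps power_mult_distrib[symmetric] flip: power_mult_distrib)
        finally show ?thesis using abs_ge_zero[of "d i t"] unfolding real_norm_def by linarith
      qed
    qed
    then have "(\<lambda>k. v 0 t + (\<Sum>i<k. d i t)) \<longlonglongrightarrow> v 0 t + (\<Sum>i. d i t)"
      by (intro tendsto_intros summable_LIMSEQ)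
    then have "(\<lambda>k. v k t) \<longlonglongrightarrow> v 0 t + (\<Sum>i. d i t)"
      unfolding telescope[symmetric] .
    then show ?thesis using False by (simp add: u_def w_def limI)
  qed (simp add: u_def w_def)
  have bound: "(w k t)\<^sup>2 \<le> h t" if t: "t \<in> {0..T}" for k t
  proof (cases "t \<in> N")
    case False
    have "(v k t)\<^sup>2 \<le> 2 * (v 0 t)\<^sup>2 + 2 * (\<Sum>i<k. d i t)\<^sup>2"
      unfolding telescope[of k] using sum_squares_bound[of "v 0 t" "\<Sum>i<k. d i t"]
      by (simp add: power2_sum)
    also have "(\<Sum>i<k. d i t)\<^sup>2 \<le> (\<Sum>i<k. \<bar>d i t\<bar>)\<^sup>2"
      by (intro abs_le_square_iff[THEN iffD1] order_trans[OF sum_abs abs_ge_self])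
    also have "\<dots> \<le> 2 * (\<Sum>i<k. f i t)" unfolding f_def by (rule square_sum_le_weighted)
    also have "(\<Sum>i<k. f i t) \<le> s t"
      unfolding s_def using N(2)[of t] t False f0 by (intro sum_le_suminf) auto
    finally show ?thesis using False by (simp add: w_def h_def)
  qed (simp add: w_def h_def)
  have h_int: "h integrable_on {0..T}"
  proof (rule integrable_spike[OF _ N(1)])
    show "(\<lambda>t. 2 * (v 0 t)\<^sup>2 + 4 * s t) integrable_on {0..T}"
      using v[of 0] s_int by (intro integrable_add integrable_on_mult_right) (auto simp: L2_controls_iff)
  qed (simp add: h_def)
  note sp = integrable_spike[OF _ N(1)]
  have w2_int: "(\<lambda>t. (w k t)\<^sup>2) integrable_on {0..T}" for k
    by (rule sp[where f = "\<lambda>t. (v k t)\<^sup>2"]) (use v[of k] in \<open>auto simp: w_def L2_controls_iff\<close>)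
  have sq: "(\<lambda>t. (u t)\<^sup>2) integrable_on {0..T}"
    "(\<lambda>k. integral {0..T} (\<lambda>t. (w k t)\<^sup>2)) \<longlonglongrightarrow> integral {0..T} (\<lambda>t. (u t)\<^sup>2)"
  proof -
    have l: "(\<lambda>k. (w k t)\<^sup>2) \<longlonglongrightarrow> (u t)\<^sup>2" if "t \<in> {0..T}" for t
      by (intro tendsto_power lim that)
    have bd: "norm ((w k t)\<^sup>2) \<le> h t" if "t \<in> {0..T}" for k t
      using bound[OF that] by simp
    show "(\<lambda>t. (u t)\<^sup>2) integrable_on {0..T}"
      by (rule dominated_convergence(1)[OF w2_int h_int bd l])
    show "(\<lambda>k. integral {0..T} (\<lambda>t. (w k t)\<^sup>2)) \<longlonglongrightarrow> integral {0..T} (\<lambda>t. (u t)\<^sup>2)"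
      by (rule dominated_convergence(2)[OF w2_int h_int bd l])
  qed
  have w_int: "w k integrable_on {0..T}" for k
    by (rule sp[OF L2_integrable[OF v[of k]]]) (auto simp: w_def)
  have h1_int: "(\<lambda>t. 1 + h t) integrable_on {0..T}"
    by (intro integrable_add h_int) auto
  have w_le: "norm (w k t) \<le> 1 + h t" if "t \<in> {0..T}" for k t
  proof -
    have "\<bar>w k t\<bar> \<le> 1 + (w k t)\<^sup>2"
      using sum_squares_bound[of 1 "\<bar>w k t\<bar>"] zero_le_power2[of "w k t"] abs_ge_zero[of "w k t"]
      unfolding power2_abs by simp
    then show ?thesis using bound[OF that, of k] unfolding real_norm_def by linarith
  qed
  have w_eq: "integral {0..t} (w k) = integral {0..t} (v k)" for k t
    by (rule integral_spike[OF N(1)]) (simp add: w_def)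
  have lin: "u integrable_on {0..t} \<and> (\<lambda>k. integral {0..t} (v k)) \<longlonglongrightarrow> integral {0..t} u"
    if t: "t \<in> {0..T}" for t
  proof -
    note sub = integrable_subinterval_real[of _ 0 T 0 t]
    have wi: "w k integrable_on {0..t}" for k by (rule sub[OF w_int]) (use t in auto)
    have hi: "(\<lambda>t. 1 + h t) integrable_on {0..t}" by (rule sub[OF h1_int]) (use t in auto)
    have le: "norm (w k x) \<le> 1 + h x" if "x \<in> {0..t}" for k x
      by (rule w_le) (use that t in auto)
    have l: "(\<lambda>k. w k x) \<longlonglongrightarrow> u x" if "x \<in> {0..t}" for x
      by (rule lim) (use that t in auto)
    show ?thesis
      using dominated_convergence(1)[OF wi hi le l] dominated_convergence(2)[OF wi hi le l]
      unfolding w_eq by blast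
  qed
  have "u integrable_on {0..T}"
    by (cases "0 \<le> T") (use lin[of T] in auto)
  then have "u \<in> borel_measurable ?M" by (rule integrable_imp_measurable)
  then have uL: "u \<in> L2_controls T" using sq(1) by (simp add: L2_controls_iff)
  have w2_eq: "integral {0..T} (\<lambda>t. (w k t)\<^sup>2) = integral {0..T} (\<lambda>t. (v k t)\<^sup>2)" for k
    by (rule integral_spike[OF N(1)]) (simp add: w_def)
  show thesis
    by (rule that[OF uL conjunct2[OF lin] sq(2)[unfolded w2_eq]])
qed

lemma L2_parallelogram:
  assumes u: "u \<in> L2_controls T" and v: "v \<in> L2_controls T"
  shows "integral {0..T} (\<lambda>t. (v t - u t)\<^sup>2) = 2 * integral {0..T} (\<lambda>t. (u t)\<^sup>2)
     + 2 * integral {0..T} (\<lambda>t. (v t)\<^sup>2) - 4 * integral {0..T} (\<lambda>t. (1 / 2 * (u t + v t))\<^sup>2)"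
proof -
  have m: "(\<lambda>t. 1 / 2 * (u t + v t)) \<in> L2_controls T" by (intro L2_scale L2_add u v)
  have sq: "((\<lambda>t. (w t)\<^sup>2) has_integral integral {0..T} (\<lambda>t. (w t)\<^sup>2)) {0..T}" if "w \<in> L2_controls T" for w
    using that by (auto simp: L2_controls_iff)
  have eq: "(v t - u t)\<^sup>2 = 2 * (u t)\<^sup>2 + 2 * (v t)\<^sup>2 - 4 * (1 / 2 * (u t + v t))\<^sup>2" for t
    by (simp add: power2_eq_square algebra_simps)
  show ?thesis
    unfolding eq by (intro integral_unique has_integral_diff has_integral_add has_integral_mult_right sq u v m)
qed

text \<open>Lower semicontinuity of the energy. The controls whose primitive stays within \<open>\<delta>\<close> of \<open>\<eta>\<close> form a
convex set \<open>K \<delta>\<close>, so by the parallelogram law two of its elements of nearly minimal norm are close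
to each other. As \<open>\<delta>\<close> decreases to 0 the minimal values \<open>m \<delta>\<close> increase to some \<open>s \<le> B\<close>; nearly
minimal elements then form a Cauchy sequence, whose limit has the primitive \<open>\<eta>\<close>. This replaces
weak compactness of balls in \<open>L\<^sub>2\<close>.\<close>

lemma L2_primitive_limit:
  assumes w: "\<And>n. w n \<in> L2_controls T"
    and unif: "uniform_limit {0..T} (\<lambda>n t. integral {0..t} (w n)) \<eta> sequentially"
    and b: "b \<longlonglongrightarrow> B" and wb: "\<And>n. integral {0..T} (\<lambda>t. (w n t)\<^sup>2) \<le> b n"
  obtains u where "u \<in> L2_controls T" "\<And>t. t \<in> {0..T} \<Longrightarrow> integral {0..t} u = \<eta> t"
    "integral {0..T} (\<lambda>t. (u t)\<^sup>2) \<le> B"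
proof -
  define N :: "(real \<Rightarrow> real) \<Rightarrow> real" where "N = (\<lambda>v. integral {0..T} (\<lambda>t. (v t)\<^sup>2))"
  define K where "K = (\<lambda>\<delta>. {v \<in> L2_controls T. \<forall>t\<in>{0..T}. \<bar>integral {0..t} v - \<eta> t\<bar> \<le> \<delta>})"
  define m where "m = (\<lambda>\<delta>. Inf (N ` K \<delta>))"
  have N0: "0 \<le> N v" if "v \<in> L2_controls T" for v
    unfolding N_def using that
    by (intro Henstock_Kurzweil_Integration.integral_nonneg) (auto simp: L2_controls_iff)
  have KL2: "v \<in> L2_controls T" if "v \<in> K \<delta>" for v \<delta> using that by (simp add: K_def)
  have bdd: "bdd_below (N ` K \<delta>)" for \<delta>
    by (rule bdd_belowI[of _ 0]) (auto intro: N0 KL2)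
  have m_le: "m \<delta> \<le> N v" if "v \<in> K \<delta>" for v \<delta>
    unfolding m_def by (rule cINF_lower[OF bdd that])
  have ev: "\<forall>\<^sub>F n in sequentially. w n \<in> K \<delta>" if "\<delta> > 0" for \<delta>
    using uniform_limitD[OF unif that] 
    by eventually_elim (auto simp: K_def w dist_real_def intro: less_imp_le)
  have nonempty: "K \<delta> \<noteq> {}" if "\<delta> > 0" for \<delta>
    using eventually_happens'[OF sequentially_bot ev[OF that]] by blast
  have m_B: "m \<delta> \<le> B" if "\<delta> > 0" for \<delta>
  proof (rule tendsto_lowerbound[OF b])
    show "\<forall>\<^sub>F n in sequentially. m \<delta> \<le> b n"
      using ev[OF that]
    proof eventually_elim
      case (elim n)
      show ?case using m_le[OF elim] wb[of n] unfolding N_def by linarith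
    qed
  qed simp
  have m_mono: "m \<delta>' \<le> m \<delta>" if "0 < \<delta>" "\<delta> \<le> \<delta>'" for \<delta> \<delta>'
  proof -
    have "K \<delta> \<subseteq> K \<delta>'" using that by (force simp: K_def)
    then show ?thesis
      unfolding m_def using nonempty[OF that(1)] bdd by (intro cINF_superset_mono) auto
  qed
  define s where "s = (SUP \<delta>\<in>{0<..}. m \<delta>)"
  have bdds: "bdd_above (m ` {0<..})" using m_B by (intro bdd_aboveI[of _ B]) auto
  have m_s: "m \<delta> \<le> s" if "\<delta> > 0" for \<delta>
    unfolding s_def by (rule cSUP_upper[OF _ bdds]) (use that in simp)
  have s_B: "s \<le> B" unfolding s_def by (rule cSUP_least) (use m_B in auto)
  have "\<exists>\<delta>>0. \<exists>v\<in>K \<delta>. \<delta> \<le> inverse (Suc k) \<and> s - (1 / 4) ^ k < m \<delta> \<and> N v < s + (1 / 4) ^ k" for k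
  proof -
    have p: "0 < (1 / 4 :: real) ^ k" by simp
    obtain \<delta>0 where \<delta>0: "\<delta>0 > 0" "s - (1 / 4) ^ k < m \<delta>0"
      using less_cSUP_iff[OF _ bdds, of "s - (1 / 4) ^ k"] p unfolding s_def[symmetric] by auto
    define \<delta> where "\<delta> = min \<delta>0 (inverse (Suc k))"
    have \<delta>: "\<delta> > 0" "\<delta> \<le> \<delta>0" "\<delta> \<le> inverse (Suc k)" using \<delta>0 by (auto simp: \<delta>_def)
    have "m \<delta> < s + (1 / 4) ^ k" using m_s[OF \<delta>(1)] p by linarith
    then obtain v where "v \<in> K \<delta>" "N v < s + (1 / 4) ^ k"
      unfolding m_def using cINF_less_iff[OF nonempty[OF \<delta>(1)] bdd] by auto
    then show ?thesis using \<delta> \<delta>0(2) m_mono[OF \<delta>(1,2)] by force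
  qed
  then obtain \<delta> v where \<delta>: "\<And>k. \<delta> k > 0" "\<And>k. \<delta> k \<le> inverse (Suc k)" "\<And>k. s - (1 / 4) ^ k < m (\<delta> k)"
    and v: "\<And>k. v k \<in> K (\<delta> k)" "\<And>k. N (v k) < s + (1 / 4) ^ k"
    by metis
  have vL: "v k \<in> L2_controls T" for k using v(1) KL2 by blast
  have cauchy: "integral {0..T} (\<lambda>t. (v (Suc k) t - v k t)\<^sup>2) \<le> 8 * (1 / 4) ^ k" for k
  proof -
    let ?mid = "\<lambda>t. 1 / 2 * (v k t + v (Suc k) t)"
    let ?\<delta> = "max (\<delta> k) (\<delta> (Suc k))"
    have midL: "?mid \<in> L2_controls T" by (intro L2_scale L2_add vL)
    have "\<bar>integral {0..t} ?mid - \<eta> t\<bar> \<le> ?\<delta>" if t: "t \<in> {0..T}" for t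
    proof -
      have vi: "v j integrable_on {0..t}" for j
        by (rule integrable_subinterval_real[OF L2_integrable[OF vL]]) (use t in auto)
      have "integral {0..t} ?mid = 1 / 2 * (integral {0..t} (v k) + integral {0..t} (v (Suc k)))"
        using vi[of k] vi[of "Suc k"]
        by (intro integral_unique has_integral_mult_right has_integral_add) auto
      moreover have "\<bar>integral {0..t} (v k) - \<eta> t\<bar> \<le> \<delta> k" "\<bar>integral {0..t} (v (Suc k)) - \<eta> t\<bar> \<le> \<delta> (Suc k)"
        using v(1)[of k] v(1)[of "Suc k"] t by (auto simp: K_def)
      ultimately show ?thesis by (simp add: abs_le_iff max_def field_simps)
    qed
    then have "?mid \<in> K ?\<delta>" using midL by (simp add: K_def)
    then have "m ?\<delta> \<le> N ?mid" by (rule m_le)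
    moreover have "s - (1 / 4) ^ k < m ?\<delta>"
    proof -
      have "(1 / 4 :: real) ^ Suc k \<le> (1 / 4) ^ k" by simp
      then have "s - (1 / 4) ^ k < m (\<delta> (Suc k))" using \<delta>(3)[of "Suc k"] by linarith
      then show ?thesis using \<delta>(3)[of k] by (simp add: max_def)
    qed
    moreover have "(1 / 4 :: real) ^ Suc k \<le> (1 / 4) ^ k" by simp
    ultimately show ?thesis
      using v(2)[of k] v(2)[of "Suc k"] unfolding L2_parallelogram[OF vL vL] N_def by linarith
  qed
  obtain u where u: "u \<in> L2_controls T"
    "\<And>t. t \<in> {0..T} \<Longrightarrow> (\<lambda>k. integral {0..t} (v k)) \<longlonglongrightarrow> integral {0..t} u"
    "(\<lambda>k. integral {0..T} (\<lambda>t. (v k t)\<^sup>2)) \<longlonglongrightarrow> integral {0..T} (\<lambda>t. (u t)\<^sup>2)"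
    by (rule L2_limit[OF vL cauchy]) (rule that)
  have "integral {0..t} u = \<eta> t" if t: "t \<in> {0..T}" for t
  proof (rule LIMSEQ_unique[OF u(2)[OF t]])
    show "(\<lambda>k. integral {0..t} (v k)) \<longlonglongrightarrow> \<eta> t"
    proof (rule Lim_transform_bound[OF _ LIMSEQ_inverse_real_of_nat, THEN LIM_zero_cancel])
      show "\<forall>\<^sub>F k in sequentially. norm (integral {0..t} (v k) - \<eta> t) \<le> norm (inverse (real (Suc k)))"
      proof (rule always_eventually, rule allI)
        fix k
        have "\<bar>integral {0..t} (v k) - \<eta> t\<bar> \<le> \<delta> k" using v(1)[of k] t by (simp add: K_def)
        then show "norm (integral {0..t} (v k) - \<eta> t) \<le> norm (inverse (real (Suc k)))"
          using \<delta>(2)[of k] by simp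
      qed
    qed
  qed
  moreover have "N u \<le> s"
  proof (rule LIMSEQ_le)
    show "(\<lambda>k. N (v k)) \<longlonglongrightarrow> N u" using u(3) unfolding N_def .
    show "(\<lambda>k. s + (1 / 4) ^ k) \<longlonglongrightarrow> s"
      using tendsto_add[OF tendsto_const LIMSEQ_realpow_zero[of "1 / 4 :: real"]] by simp
    show "\<exists>n. \<forall>k\<ge>n. N (v k) \<le> s + (1 / 4) ^ k" using v(2) less_imp_le by blast
  qed
  ultimately show thesis using that[OF u(1)] s_B unfolding N_def by simp
qed

lemma optimal_pair_iff:
  assumes "0 \<le> T"
  shows "optimal_pair q0 q1 T u q \<longleftrightarrow> u \<in> L2_controls T \<and> trajectory T u q \<and> q 0 = q0 \<and>
    steered_curve q0 u T = q1 \<and> (\<forall>v\<in>L2_controls T. steered_curve q0 v T = q1 \<longrightarrow>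
      integral {0..T} (\<lambda>t. (u t)\<^sup>2) \<le> integral {0..T} (\<lambda>t. (v t)\<^sup>2))"
proof -
  have adm: "(\<exists>p. admissible_pair q0 q1 T v p) \<longleftrightarrow> v \<in> L2_controls T \<and> steered_curve q0 v T = q1" for v
    unfolding admissible_pair_iff[OF assms]
    using trajectory_steered_curve[of v T q0] steered_curve_0[of q0 v] by blast
  have "(\<forall>v p. admissible_pair q0 q1 T v p \<longrightarrow> elastic_energy T u \<le> elastic_energy T v) \<longleftrightarrow>
    (\<forall>v. (\<exists>p. admissible_pair q0 q1 T v p) \<longrightarrow> elastic_energy T u \<le> elastic_energy T v)" by blast
  also have "\<dots> \<longleftrightarrow> (\<forall>v\<in>L2_controls T. steered_curve q0 v T = q1 \<longrightarrow> elastic_energy T u \<le> elastic_energy T v)"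
    unfolding adm by blast
  finally have min: "(\<forall>v p. admissible_pair q0 q1 T v p \<longrightarrow> elastic_energy T u \<le> elastic_energy T v) \<longleftrightarrow>
    (\<forall>v\<in>L2_controls T. steered_curve q0 v T = q1 \<longrightarrow> elastic_energy T u \<le> elastic_energy T v)" .
  show ?thesis
    unfolding optimal_pair_def min unfolding admissible_pair_iff[OF assms]
    by (auto simp: elastic_energy_eq_integral)
qed

text \<open>The energy controls the modulus of continuity of the heading but not that of the control, so
compactness is available for the headings of a minimising sequence (Arzela-Ascoli). Their uniform
limit suffices, because the position depends on the control only through the heading.\<close>

lemma exists_optimal_control:
  assumes T: "0 < T" and q1: "q1 \<in> attainable_set q0 T"
  shows "\<exists>u. optimal_control q0 q1 T u"
proof -
  define N :: "(real \<Rightarrow> real) \<Rightarrow> real" where "N = (\<lambda>v. integral {0..T} (\<lambda>t. (v t)\<^sup>2))"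
  define E where "E = {v \<in> L2_controls T. steered_curve q0 v T = q1}"
  have N0: "0 \<le> N v" if "v \<in> E" for v
    unfolding N_def using that
    by (intro Henstock_Kurzweil_Integration.integral_nonneg) (auto simp: L2_controls_iff E_def)
  have bdd: "bdd_below (N ` E)" by (rule bdd_belowI[of _ 0]) (auto intro: N0)
  have ne: "E \<noteq> {}"
  proof -
    obtain u q where "q1 = q T" "u \<in> L2_controls T" "trajectory T u q" "q 0 = q0"
      using q1 unfolding attainable_set_def by blast
    then have "u \<in> E" using trajectory_eq_steered_curve[of u T q T] T by (simp add: E_def)
    then show ?thesis by blast
  qed
  define I where "I = (INF v\<in>E. N v)"
  have I_le: "I \<le> N v" if "v \<in> E" for v unfolding I_def by (rule cINF_lower[OF bdd that])
  have "\<exists>v\<in>E. N v < I + inverse (Suc n)" for n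
    using cINF_less_iff[OF ne bdd, of "I + inverse (Suc n)"] unfolding I_def[symmetric] by simp
  then obtain u where u: "\<And>n. u n \<in> E" "\<And>n. N (u n) < I + inverse (real (Suc n))" by metis
  have uL: "u n \<in> L2_controls T" for n using u(1) by (simp add: E_def)
  define M where "M = I + 1"
  have M: "N (u n) \<le> M" for n
  proof -
    have "inverse (real (Suc n)) \<le> 1" by (simp add: inverse_le_1_iff)
    then show ?thesis using u(2)[of n] unfolding M_def by linarith
  qed
  have M0: "0 \<le> M" using M[of 0] N0[OF u(1)[of 0]] by linarith
  define P where "P = (\<lambda>n t. integral {0..t} (u n))"
  have holder: "\<bar>P n t - P n s\<bar> \<le> sqrt (M * \<bar>t - s\<bar>)" if "s \<in> {0..T}" "t \<in> {0..T}" for n s t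
  proof -
    have *: "\<bar>P n t - P n s\<bar> \<le> sqrt (M * \<bar>t - s\<bar>)" if "0 \<le> s" "s \<le> t" "t \<le> T" for s t
    proof -
      have "P n t - P n s = integral {s..t} (u n)"
        unfolding P_def by (rule integral_increment[OF L2_integrable[OF uL]]) (use that in auto)
      then have "(P n t - P n s)\<^sup>2 \<le> (t - s) * N (u n)"
        using L2_cauchy_schwarz[OF uL, of s t n] that by (simp add: N_def)
      also have "\<dots> \<le> (t - s) * M" using M[of n] that by (intro mult_left_mono) auto
      finally have "(P n t - P n s)\<^sup>2 \<le> M * \<bar>t - s\<bar>" using that by (simp add: mult.commute)
      then show ?thesis using real_le_rsqrt[of "\<bar>P n t - P n s\<bar>"] by simp
    qed
    show ?thesis
      using *[of s t] *[of t s] that by (cases "s \<le> t") (auto simp: abs_minus_commute)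
  qed
  obtain \<eta> k where \<eta>: "continuous_on {0..T} \<eta>" and k: "strict_mono (k :: nat \<Rightarrow> nat)"
    and conv: "\<And>e. 0 < e \<Longrightarrow> \<exists>N. \<forall>n x. n \<ge> N \<and> x \<in> {0..T} \<longrightarrow> norm (P (k n) x - \<eta> x) < e"
  proof (rule Arzela_Ascoli[of "{0..T}" P "sqrt (M * T)"])
    show "norm (P n x) \<le> sqrt (M * T)" if "x \<in> {0..T}" for n x
    proof -
      have "\<bar>P n x\<bar> \<le> sqrt (M * \<bar>x - 0\<bar>)"
        using holder[of 0 x n] that T by (simp add: P_def)
      also have "\<dots> \<le> sqrt (M * T)"
        using that M0 by (intro real_sqrt_le_mono mult_left_mono) auto
      finally show ?thesis by simp
    qed
    fix x e :: real assume x: "x \<in> {0..T}" and e: "0 < e"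
    let ?d = "e\<^sup>2 / (M + 1)"
    have "norm (P n x - P n y) < e" if "y \<in> {0..T}" "norm (x - y) < ?d" for n y
    proof -
      have "\<bar>x - y\<bar> * (M + 1) < e\<^sup>2" using that(2) M0 by (simp add: field_simps)
      then have "M * \<bar>x - y\<bar> < e\<^sup>2" using abs_ge_zero[of "x - y"] by (simp add: algebra_simps)
      then have "sqrt (M * \<bar>x - y\<bar>) < e" using e by (simp add: real_less_lsqrt)
      then show ?thesis using holder[OF that(1) x, of n] by simp
    qed
    moreover have "?d > 0" using e M0 by simp
    ultimately show "\<exists>d. 0 < d \<and> (\<forall>n y. y \<in> {0..T} \<and> norm (x - y) < d \<longrightarrow> norm (P n x - P n y) < e)"
      by blast
  qed ((rule compact_Icc)[1], (rule that; assumption)[1])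
  define w where "w = (\<lambda>n. u (k n))"
  have wL: "w n \<in> L2_controls T" for n unfolding w_def by (rule uL)
  have unif: "uniform_limit {0..T} (\<lambda>n t. integral {0..t} (w n)) \<eta> sequentially"
    unfolding uniform_limit_iff
  proof (intro allI impI)
    fix e :: real assume "0 < e"
    then obtain n0 where "\<forall>n x. n \<ge> n0 \<and> x \<in> {0..T} \<longrightarrow> norm (P (k n) x - \<eta> x) < e" using conv by blast
    then show "\<forall>\<^sub>F n in sequentially. \<forall>t\<in>{0..T}. dist (integral {0..t} (w n)) (\<eta> t) < e"
      unfolding eventually_sequentially P_def w_def dist_norm by blast
  qed
  have lim_b: "(\<lambda>n. I + inverse (real (Suc n))) \<longlonglongrightarrow> I"
    using tendsto_add[OF tendsto_const LIMSEQ_inverse_real_of_nat] by simp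
  have w_b: "integral {0..T} (\<lambda>t. (w n t)\<^sup>2) \<le> I + inverse (real (Suc n))" for n
  proof -
    have "inverse (real (Suc (k n))) \<le> inverse (real (Suc n))"
      using seq_suble[OF k, of n] by (simp add: le_imp_inverse_le)
    then show ?thesis using u(2)[of "k n"] unfolding w_def N_def by linarith
  qed
  obtain v where v: "v \<in> L2_controls T" "\<And>t. t \<in> {0..T} \<Longrightarrow> integral {0..t} v = \<eta> t"
    "integral {0..T} (\<lambda>t. (v t)\<^sup>2) \<le> I"
    by (rule L2_primitive_limit[OF wL unif lim_b w_b]) (rule that)
  have head: "(\<lambda>n. heading q0 (w n) t) \<longlonglongrightarrow> heading q0 v t" if "t \<in> {0..T}" for t
    unfolding heading_def v(2)[OF that]
    using tendsto_uniform_limitI[OF unif that] by (intro tendsto_intros)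
  have endpoint: "steered_curve q0 (w n) T = q1" for n using u(1) by (simp add: w_def E_def)
  have disp: "c + integral {0..T} (\<lambda>s. f (heading q0 v s)) = a"
    if f: "continuous_on UNIV f" "\<And>x. \<bar>f x\<bar> \<le> 1"
      and a: "\<And>n. c + integral {0..T} (\<lambda>s. f (heading q0 (w n) s)) = a" for f :: "real \<Rightarrow> real" and a c
  proof -
    have "(\<lambda>n. integral {0..T} (\<lambda>s. f (heading q0 (w n) s))) \<longlonglongrightarrow> integral {0..T} (\<lambda>s. f (heading q0 v s))"
    proof (rule dominated_convergence(2))
      show "(\<lambda>s. f (heading q0 (w n) s)) integrable_on {0..T}" for n
        using continuous_on_compose2[OF f(1) continuous_heading[OF wL]]
        by (intro integrable_continuous_real) auto
      show "(\<lambda>s. 1) integrable_on {0..T}" by (rule integrable_const_ivl)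
      show "(\<lambda>n. f (heading q0 (w n) x)) \<longlonglongrightarrow> f (heading q0 v x)" if "x \<in> {0..T}" for x
        by (rule isCont_tendsto_compose[OF _ head[OF that]])
          (use f(1) in \<open>simp add: continuous_on_eq_continuous_at\<close>)
    qed (use f in auto)
    then have "(\<lambda>n. c + integral {0..T} (\<lambda>s. f (heading q0 (w n) s))) \<longlonglongrightarrow> c + integral {0..T} (\<lambda>s. f (heading q0 v s))"
      by (intro tendsto_intros)
    then show ?thesis unfolding a by (simp add: LIMSEQ_const_iff)
  qed
  have c1: "fst q0 + integral {0..T} (\<lambda>s. cos (heading q0 v s)) = fst q1"
    by (rule disp[OF continuous_on_cos_real abs_cos_le_one])
      (use arg_cong[OF endpoint, of fst] in \<open>simp add: steered_curve_def\<close>)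
  have c2: "fst (snd q0) + integral {0..T} (\<lambda>s. sin (heading q0 v s)) = fst (snd q1)"
    by (rule disp[OF continuous_on_sin_real abs_sin_le_one])
      (use arg_cong[OF endpoint, of "\<lambda>q. fst (snd q)"] in \<open>simp add: steered_curve_def\<close>)
  have c3: "angle (heading q0 v T) = snd (snd q1)"
  proof -
    have "(\<lambda>n. angle (heading q0 (w n) T)) \<longlonglongrightarrow> angle (heading q0 v T)"
      proof (rule tendsto_dist_iff[THEN iffD2], rule Lim_null_comparison)
      show "\<forall>\<^sub>F n in sequentially. norm (dist (angle (heading q0 (w n) T)) (angle (heading q0 v T)))
          \<le> \<bar>heading q0 (w n) T - heading q0 v T\<bar>"
        using dist_angle_le by simp
      show "(\<lambda>n. \<bar>heading q0 (w n) T - heading q0 v T\<bar>) \<longlonglongrightarrow> 0"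
        using head[of T] T by (intro tendsto_rabs_zero LIM_zero) auto
    qed
    moreover have "angle (heading q0 (w n) T) = snd (snd q1)" for n
      using arg_cong[OF endpoint[of n], of "\<lambda>q. snd (snd q)"] by (simp add: steered_curve_def)
    ultimately show ?thesis by (simp add: LIMSEQ_const_iff)
  qed
  have "steered_curve q0 v T = q1"
    unfolding steered_curve_def c1 c2 c3 by simp
  moreover have "integral {0..T} (\<lambda>t. (v t)\<^sup>2) \<le> integral {0..T} (\<lambda>t. (p t)\<^sup>2)"
    if "p \<in> L2_controls T" "steered_curve q0 p T = q1" for p
    using order_trans[OF v(3) I_le[of p, unfolded N_def]] that by (simp add: E_def)
  ultimately have "optimal_pair q0 q1 T v (steered_curve q0 v)"
    using T v(1) trajectory_steered_curve[OF v(1), of q0] by (simp add: optimal_pair_iff)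
  then show ?thesis unfolding optimal_control_def by blast
qed

section \<open>First variation of energy and end point\<close>

lemma continuous_on_Icc_norm_bounded:
  fixes f :: "real \<Rightarrow> 'a::real_normed_vector"
  assumes "continuous_on {a..b} f"
  obtains B where "\<And>t. t \<in> {a..b} \<Longrightarrow> norm (f t) \<le> B"
proof -
  have "bounded (f ` {a..b})"
    by (intro compact_imp_bounded compact_continuous_image assms compact_Icc)
  then obtain B where "\<forall>x\<in>f ` {a..b}. norm x \<le> B" unfolding bounded_iff by blast
  then show thesis by (intro that[of B]) blast
qed

lemma integral_tail_has_derivative:
  fixes f :: "real \<Rightarrow> real"
  assumes f: "continuous_on {0..T} f" and t: "t \<in> {0..T}"
  shows "((\<lambda>s. integral {s..T} f) has_vector_derivative - f t) (at t within {0..T})"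
proof -
  have eq: "integral {s..T} f = integral {0..T} f - integral {0..s} f" if "s \<in> {0..T}" for s
    using integral_increment[OF integrable_continuous_real[OF f], of s T] that by auto
  show ?thesis
    using has_vector_derivative_diff[OF has_vector_derivative_const integral_has_vector_derivative[OF f t],
        of "integral {0..T} f"]
    by (intro has_vector_derivative_transform[OF t eq]) auto
qed

lemma continuous_on_integral_tail:
  fixes f :: "real \<Rightarrow> real"
  assumes f: "continuous_on {0..T} f"
  shows "continuous_on {0..T} (\<lambda>s. integral {s..T} f)"
  unfolding continuous_on_eq_continuous_within
  by (rule ballI, rule has_vector_derivative_continuous, erule integral_tail_has_derivative[OF f])

text \<open>As \<open>v\<close> is merely integrable, the product rule holds only almost everywhere; the function \<open>H\<close>,
the difference of the two sides taken up to time \<open>t\<close> less a boundary term that vanishes at both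
ends, is absolutely continuous with derivative zero almost everywhere.\<close>

lemma integral_by_parts_primitive:
  fixes f v :: "real \<Rightarrow> real"
  assumes T: "0 \<le> T" and f: "continuous_on {0..T} f" and v: "v absolutely_integrable_on {0..T}"
  shows "integral {0..T} (\<lambda>t. f t * integral {0..t} v) = integral {0..T} (\<lambda>s. integral {s..T} f * v s)"
proof -
  define V where "V = (\<lambda>t. integral {0..t} v)"
  define G where "G = (\<lambda>t. integral {t..T} f)"
  have fi: "f integrable_on {0..T}" by (rule integrable_continuous_real[OF f])
  have vi: "v integrable_on {0..T}" and va: "(\<lambda>t. \<bar>v t\<bar>) integrable_on {0..T}"
    using v unfolding absolutely_integrable_on_def by simp_all
  have G_eq: "G t = integral {0..T} f - integral {0..t} f" if "t \<in> {0..T}" for t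
    using integral_increment[OF fi, of t T] that unfolding G_def by auto
  have dG: "(G has_vector_derivative - f t) (at t within {0..T})" if t: "t \<in> {0..T}" for t
    unfolding G_def by (rule integral_tail_has_derivative[OF f t])
  have contG: "continuous_on {0..T} G"
    unfolding G_def by (rule continuous_on_integral_tail[OF f])
  have contV: "continuous_on {0..T} V" unfolding V_def by (rule indefinite_integral_continuous_1[OF vi])
  have contfV: "continuous_on {0..T} (\<lambda>t. f t * V t)" by (intro continuous_intros f contV)
  obtain cG where cG: "\<And>t. t \<in> {0..T} \<Longrightarrow> \<bar>G t\<bar> \<le> cG"
    by (rule continuous_on_Icc_norm_bounded[OF contG, unfolded real_norm_def]) (rule that)
  obtain cV where cV: "\<And>t. t \<in> {0..T} \<Longrightarrow> \<bar>V t\<bar> \<le> cV"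
    by (rule continuous_on_Icc_norm_bounded[OF contV, unfolded real_norm_def]) (rule that)
  obtain cf where cf: "\<And>t. t \<in> {0..T} \<Longrightarrow> \<bar>f t\<bar> \<le> cf"
    by (rule continuous_on_Icc_norm_bounded[OF f, unfolded real_norm_def]) (rule that)
  have c0: "0 \<le> cG" "0 \<le> cV" "0 \<le> cf" using cG[of 0] cV[of 0] cf[of 0] T by auto
  have Gv: "(\<lambda>s. G s * v s) absolutely_integrable_on {0..T}"
  proof (rule measurable_bounded_by_integrable_imp_absolutely_integrable)
    show "(\<lambda>s. G s * v s) \<in> borel_measurable (lebesgue_on {0..T})"
      using absolutely_integrable_imp_borel_measurable[OF v]
      by (intro borel_measurable_times continuous_imp_measurable_on_sets_lebesgue[OF contG]) auto
    show "(\<lambda>s. cG * \<bar>v s\<bar>) integrable_on {0..T}" by (intro integrable_on_mult_right va)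
    show "norm (G s * v s) \<le> cG * \<bar>v s\<bar>" if "s \<in> {0..T}" for s
      using cG[OF that] by (simp add: abs_mult mult_right_mono)
  qed simp
  have Gvi: "(\<lambda>s. G s * v s) integrable_on {0..T}"
    using Gv unfolding absolutely_integrable_on_def by simp
  define H where "H = (\<lambda>t. integral {0..t} (\<lambda>s. G s * v s) - integral {0..t} (\<lambda>s. f s * V s) - G t * V t)"
  obtain N1 where N1: "negligible N1" "\<And>t. t \<in> {0..T} - N1 \<Longrightarrow>
      ((\<lambda>t. integral {0..t} (\<lambda>s. G s * v s)) has_vector_derivative G t * v t) (at t within {0..T})"
    by (rule lebesgue_differentiation[OF Gvi]) (rule that)
  obtain N2 where N2: "negligible N2" "\<And>t. t \<in> {0..T} - N2 \<Longrightarrow>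
      ((\<lambda>t. integral {0..t} v) has_vector_derivative v t) (at t within {0..T})"
    by (rule lebesgue_differentiation[OF vi]) (rule that)
  have "H T = H 0"
  proof (rule abs_continuous_derivative_0_imp_eq_left[where f = H and a = 0 and b = T and t = T and N = "N1 \<union> N2"])
    show "abs_continuous_on {0..T} H"
    proof (rule abs_continuous_onI_integral_bound)
      show "(\<lambda>s. 2 * (cG * \<bar>v s\<bar>) + 2 * (cf * cV)) integrable_on {0..T}"
        by (intro integrable_add integrable_on_mult_right va) auto
      show "0 \<le> 2 * (cG * \<bar>v s\<bar>) + 2 * (cf * cV)" for s using c0 by simp
      fix s t assume st: "0 \<le> s" "s \<le> t" "t \<le> T"
      note sub = integrable_subinterval_real[of _ 0 T s t]
      have vs: "v integrable_on {s..t}" "(\<lambda>r. \<bar>v r\<bar>) integrable_on {s..t}"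
        using vi va st by (auto intro: sub)
      have dV: "\<bar>V t - V s\<bar> \<le> integral {s..t} (\<lambda>r. \<bar>v r\<bar>)"
        unfolding V_def integral_increment[OF vi st]
        using integral_norm_bound_integral[OF vs] by simp
      have dGi: "\<bar>G t - G s\<bar> \<le> cf * (t - s)"
      proof -
        have "G t - G s = - integral {s..t} f"
          using G_eq[of t] G_eq[of s] integral_increment[OF fi st] st by simp
        moreover have "\<bar>integral {s..t} f\<bar> \<le> integral {s..t} (\<lambda>r. cf)"
          using integral_norm_bound_integral[of f "{s..t}" "\<lambda>r. cf"] sub[OF fi] cf st by auto
        ultimately show ?thesis using st by (simp add: mult.commute)
      qed
      have i1: "\<bar>integral {0..t} (\<lambda>s. G s * v s) - integral {0..s} (\<lambda>s. G s * v s)\<bar>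
          \<le> cG * integral {s..t} (\<lambda>r. \<bar>v r\<bar>)"
      proof -
        have "norm (G r * v r) \<le> cG * \<bar>v r\<bar>" if "r \<in> {s..t}" for r
          using cG[of r] that st by (simp add: abs_mult mult_right_mono)
        then have "\<bar>integral {s..t} (\<lambda>s. G s * v s)\<bar> \<le> integral {s..t} (\<lambda>r. cG * \<bar>v r\<bar>)"
          using integral_norm_bound_integral[OF sub[OF Gvi] integrable_on_mult_right[OF vs(2)]] st by auto
        then show ?thesis unfolding integral_increment[OF Gvi st] by simp
      qed
      have i2: "\<bar>integral {0..t} (\<lambda>s. f s * V s) - integral {0..s} (\<lambda>s. f s * V s)\<bar> \<le> cf * cV * (t - s)"
      proof -
        note fV = integrable_continuous_real[OF contfV]
        have "norm (f r * V r) \<le> cf * cV" if "r \<in> {s..t}" for r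
          using cf[of r] cV[of r] that st c0 by (auto simp: abs_mult intro!: mult_mono)
        then have "\<bar>integral {s..t} (\<lambda>r. f r * V r)\<bar> \<le> integral {s..t} (\<lambda>r. cf * cV)"
          unfolding real_norm_def[symmetric]
          using st by (intro integral_norm_bound_integral[OF sub[OF fV] integrable_const_ivl]) auto
        then show ?thesis unfolding integral_increment[OF fV st] using st by (simp add: mult_ac)
      qed
      have i3: "\<bar>G t * V t - G s * V s\<bar> \<le> cG * integral {s..t} (\<lambda>r. \<bar>v r\<bar>) + cf * cV * (t - s)"
      proof -
        have "G t * V t - G s * V s = G t * (V t - V s) + (G t - G s) * V s" by (simp add: algebra_simps)
        also have "\<bar>\<dots>\<bar> \<le> \<bar>G t\<bar> * \<bar>V t - V s\<bar> + \<bar>G t - G s\<bar> * \<bar>V s\<bar>"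
          by (rule order_trans[OF abs_triangle_ineq]) (simp add: abs_mult)
        also have "\<dots> \<le> cG * integral {s..t} (\<lambda>r. \<bar>v r\<bar>) + (cf * (t - s)) * cV"
          using cG[of t] cV[of s] dV dGi st c0 by (intro add_mono mult_mono) auto
        finally show ?thesis by (simp add: mult_ac)
      qed
      have "integral {s..t} (\<lambda>s. 2 * (cG * \<bar>v s\<bar>) + 2 * (cf * cV)) =
          2 * (cG * integral {s..t} (\<lambda>r. \<bar>v r\<bar>)) + 2 * (cf * cV * (t - s))"
        using integral_unique[OF has_integral_add[OF
              has_integral_mult_right[OF has_integral_mult_right[OF integrable_integral[OF vs(2)]]]
              has_integral_const_real], of 2 cG "2 * (cf * cV)"] st by simp
      then show "dist (H s) (H t) \<le> integral {s..t} (\<lambda>s. 2 * (cG * \<bar>v s\<bar>) + 2 * (cf * cV))"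
        using i1 i2 i3 unfolding H_def dist_real_def by linarith
    qed
    show "(H has_vector_derivative 0) (at t within {0..T})" if t: "t \<in> {0..T} - (N1 \<union> N2)" for t
    proof -
      have "(H has_vector_derivative G t * v t - f t * V t - (G t * v t + (- f t) * V t)) (at t within {0..T})"
        unfolding H_def using t
        by (intro has_vector_derivative_diff has_vector_derivative_mult N1(2) N2(2)[folded V_def] dG
            integral_has_vector_derivative[OF contfV]) auto
      then show ?thesis by simp
    qed
  qed (use T N1 N2 in auto)
  then show ?thesis by (simp add: H_def V_def G_def)
qed

lemma has_derivative_quadratic_error:
  fixes F :: "'a::real_normed_vector \<Rightarrow> real"
  assumes L: "bounded_linear L" and err: "\<And>h. \<bar>F (a + h) - F a - L h\<bar> \<le> K * (norm h)\<^sup>2"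
  shows "(F has_derivative L) (at a)"
  unfolding has_derivative_at_alt
proof (intro conjI L allI impI)
  fix e :: real assume e: "0 < e"
  define d where "d = e / (\<bar>K\<bar> + 1)"
  have d: "d > 0" using e by (simp add: d_def add_nonneg_pos)
  have "norm (F y - F a - L (y - a)) \<le> e * norm (y - a)" if "norm (y - a) < d" for y
  proof -
    have "norm (F y - F a - L (y - a)) \<le> K * (norm (y - a))\<^sup>2" using err[of "y - a"] by simp
    also have "\<dots> \<le> (\<bar>K\<bar> + 1) * (norm (y - a))\<^sup>2" by (intro mult_right_mono) auto
    also have "\<dots> = ((\<bar>K\<bar> + 1) * norm (y - a)) * norm (y - a)" by (simp add: power2_eq_square)
    also have "\<dots> \<le> ((\<bar>K\<bar> + 1) * d) * norm (y - a)"
      using that by (intro mult_right_mono mult_left_mono) auto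
    also have "(\<bar>K\<bar> + 1) * d = e" by (simp add: d_def)
    finally show ?thesis .
  qed
  then show "\<exists>d>0. \<forall>y. norm (y - a) < d \<longrightarrow> norm (F y - F a - L (y - a)) \<le> e * norm (y - a)"
    using d by blast
qed

lemma cos_taylor_le: "\<bar>cos (x + k) - cos x + sin x * k\<bar> \<le> k\<^sup>2" for x k :: real
proof -
  let ?g = "\<lambda>z. cos (x + z) + sin x * z"
  have "norm (?g k - ?g 0) \<le> \<bar>k\<bar> * norm (k - 0)"
  proof (rule field_differentiable_bound[of "{- \<bar>k\<bar>..\<bar>k\<bar>}"])
    fix z assume z: "z \<in> {- \<bar>k\<bar>..\<bar>k\<bar>}"
    show "(?g has_field_derivative sin x - sin (x + z)) (at z within {- \<bar>k\<bar>..\<bar>k\<bar>})"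
      by (auto intro!: derivative_eq_intros)
    have "\<bar>sin x - sin (x + z)\<bar> \<le> \<bar>x - (x + z)\<bar>"
    proof -
      have "sin x - sin (x + z) = 2 * sin (- z / 2) * cos ((2 * x + z) / 2)"
        by (simp add: sin_diff_sin)
      also have "\<bar>\<dots>\<bar> \<le> 2 * \<bar>- z / 2\<bar> * 1"
        unfolding abs_mult by (intro mult_mono abs_sin_x_le_abs_x abs_cos_le_one) auto
      finally show ?thesis by simp
    qed
    then show "norm (sin x - sin (x + z)) \<le> \<bar>k\<bar>" using z by auto
  qed (auto simp: convex_real_interval)
  then show ?thesis by (simp add: power2_eq_square abs_mult_self_eq)
qed

text \<open>With \<open>\<theta> + p \<bullet> W\<close> as heading this is the first variation of the displacement along the \<open>x\<close>-axis when
the control varies in a finite-dimensional family.\<close>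

lemma has_derivative_integral_cos:
  fixes \<theta> :: "real \<Rightarrow> real" and W :: "real \<Rightarrow> 'a::euclidean_space"
  assumes \<theta>: "continuous_on {a..b} \<theta>" and W: "continuous_on {a..b} W"
  shows "((\<lambda>p. integral {a..b} (\<lambda>t. cos (\<theta> t + p \<bullet> W t))) has_derivative
    (\<lambda>h. integral {a..b} (\<lambda>t. - sin (\<theta> t + p \<bullet> W t) * (h \<bullet> W t)))) (at p)"
proof -
  obtain B where B: "\<And>t. t \<in> {a..b} \<Longrightarrow> norm (W t) \<le> B"
    by (rule continuous_on_Icc_norm_bounded[OF W]) (rule that)
  have i1: "(\<lambda>t. cos (\<theta> t + p \<bullet> W t)) integrable_on {a..b}" for p
    by (intro integrable_continuous_real continuous_intros \<theta> W)
  have i2: "(\<lambda>t. - sin (\<theta> t + p \<bullet> W t) * (h \<bullet> W t)) integrable_on {a..b}" for h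
    by (intro integrable_continuous_real continuous_intros \<theta> W)
  have i3: "(\<lambda>t. (h \<bullet> W t)\<^sup>2) integrable_on {a..b}" for h
    by (intro integrable_continuous_real continuous_intros \<theta> W)
  show ?thesis
  proof (rule has_derivative_quadratic_error)
    have "linear (\<lambda>h. integral {a..b} (\<lambda>t. - sin (\<theta> t + p \<bullet> W t) * (h \<bullet> W t)))"
    proof (rule linearI)
      fix h k
      show "integral {a..b} (\<lambda>t. - sin (\<theta> t + p \<bullet> W t) * ((h + k) \<bullet> W t)) =
          integral {a..b} (\<lambda>t. - sin (\<theta> t + p \<bullet> W t) * (h \<bullet> W t)) +
          integral {a..b} (\<lambda>t. - sin (\<theta> t + p \<bullet> W t) * (k \<bullet> W t))"
        unfolding inner_add_left distrib_left by (rule integral_add[OF i2 i2])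
      fix r :: real
      have "(\<lambda>t. - sin (\<theta> t + p \<bullet> W t) * ((r *\<^sub>R h) \<bullet> W t)) = (\<lambda>t. r * (- sin (\<theta> t + p \<bullet> W t) * (h \<bullet> W t)))"
        by (simp add: mult_ac)
      then show "integral {a..b} (\<lambda>t. - sin (\<theta> t + p \<bullet> W t) * ((r *\<^sub>R h) \<bullet> W t)) =
          r *\<^sub>R integral {a..b} (\<lambda>t. - sin (\<theta> t + p \<bullet> W t) * (h \<bullet> W t))"
        by (simp only: integral_mult_right real_scaleR_def)
    qed
    then show "bounded_linear (\<lambda>h. integral {a..b} (\<lambda>t. - sin (\<theta> t + p \<bullet> W t) * (h \<bullet> W t)))"
      by (simp add: linear_conv_bounded_linear)
    fix h
    have "integral {a..b} (\<lambda>t. cos (\<theta> t + (p + h) \<bullet> W t)) - integral {a..b} (\<lambda>t. cos (\<theta> t + p \<bullet> W t))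
        - integral {a..b} (\<lambda>t. - sin (\<theta> t + p \<bullet> W t) * (h \<bullet> W t)) =
      integral {a..b} (\<lambda>t. cos (\<theta> t + (p + h) \<bullet> W t) - cos (\<theta> t + p \<bullet> W t)
        - - sin (\<theta> t + p \<bullet> W t) * (h \<bullet> W t))" (is "?l = integral _ ?e")
      by (intro integral_unique[symmetric] has_integral_diff integrable_integral i1 i2)
    also have "\<bar>integral {a..b} ?e\<bar> \<le> integral {a..b} (\<lambda>t. B\<^sup>2 * (norm h)\<^sup>2)"
    proof (rule integral_norm_bound_integral[of ?e, unfolded real_norm_def])
      show "?e integrable_on {a..b}" by (intro integrable_diff i1 i2)
      fix t assume t: "t \<in> {a..b}"
      have "\<bar>?e t\<bar> \<le> (h \<bullet> W t)\<^sup>2"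
        using cos_taylor_le[of "\<theta> t + p \<bullet> W t" "h \<bullet> W t"] by (simp add: inner_add_left algebra_simps)
      also have "\<dots> \<le> (norm h * norm (W t))\<^sup>2"
        using Cauchy_Schwarz_ineq2[of h "W t"] by (intro abs_le_square_iff[THEN iffD1]) simp
      also have "\<dots> \<le> B\<^sup>2 * (norm h)\<^sup>2"
        unfolding power_mult_distrib mult.commute[of "(norm h)\<^sup>2"]
        using B[OF t] by (intro mult_right_mono power_mono) auto
      finally show "\<bar>?e t\<bar> \<le> B\<^sup>2 * (norm h)\<^sup>2" .
    qed (rule integrable_const_ivl)
    also have "\<dots> = (measure lborel {a..b} * B\<^sup>2) * (norm h)\<^sup>2"
      by (simp add: mult_ac)
    finally show "\<bar>?l\<bar> \<le> (measure lborel {a..b} * B\<^sup>2) * (norm h)\<^sup>2" .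
  qed
qed

lemma has_derivative_integral_sin:
  fixes \<theta> :: "real \<Rightarrow> real" and W :: "real \<Rightarrow> 'a::euclidean_space"
  assumes \<theta>: "continuous_on {a..b} \<theta>" and W: "continuous_on {a..b} W"
  shows "((\<lambda>p. integral {a..b} (\<lambda>t. sin (\<theta> t + p \<bullet> W t))) has_derivative
    (\<lambda>h. integral {a..b} (\<lambda>t. cos (\<theta> t + p \<bullet> W t) * (h \<bullet> W t)))) (at p)"
proof -
  have "continuous_on {a..b} (\<lambda>t. \<theta> t - pi / 2)" by (intro continuous_intros \<theta>)
  from has_derivative_integral_cos[OF this W, of p]
  moreover have "cos (x - pi / 2 + y) = sin (x + y)" "- sin (x - pi / 2 + y) = cos (x + y)" for x y :: real
    by (simp_all add: cos_add sin_add cos_diff sin_diff)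
  ultimately show ?thesis by simp
qed

lemma has_derivative_L2_energy:
  fixes w :: "real \<Rightarrow> 'a::euclidean_space"
  assumes w: "\<And>b. (\<lambda>t. b \<bullet> w t) \<in> L2_controls T"
  shows "((\<lambda>b. 1 / 2 * integral {0..T} (\<lambda>t. (b \<bullet> w t)\<^sup>2)) has_derivative
    (\<lambda>h. integral {0..T} (\<lambda>t. (b \<bullet> w t) * (h \<bullet> w t)))) (at b)"
proof (rule has_derivative_quadratic_error)
  note i = L2_mult_integrable[OF w w]
  have "linear (\<lambda>h. integral {0..T} (\<lambda>t. (b \<bullet> w t) * (h \<bullet> w t)))"
  proof (rule linearI)
    show "integral {0..T} (\<lambda>t. (b \<bullet> w t) * ((h + k) \<bullet> w t)) =
        integral {0..T} (\<lambda>t. (b \<bullet> w t) * (h \<bullet> w t)) + integral {0..T} (\<lambda>t. (b \<bullet> w t) * (k \<bullet> w t))" for h k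
      unfolding inner_add_left distrib_left by (rule integral_add[OF i i])
    fix r :: real and h
    have "(\<lambda>t. (b \<bullet> w t) * ((r *\<^sub>R h) \<bullet> w t)) = (\<lambda>t. r * ((b \<bullet> w t) * (h \<bullet> w t)))"
      by (simp add: mult_ac)
    then show "integral {0..T} (\<lambda>t. (b \<bullet> w t) * ((r *\<^sub>R h) \<bullet> w t)) =
        r *\<^sub>R integral {0..T} (\<lambda>t. (b \<bullet> w t) * (h \<bullet> w t))"
      by (simp only: integral_mult_right real_scaleR_def)
  qed
  then show "bounded_linear (\<lambda>h. integral {0..T} (\<lambda>t. (b \<bullet> w t) * (h \<bullet> w t)))"
    by (simp add: linear_conv_bounded_linear)
  fix h
  have sq: "((\<lambda>t. (x \<bullet> w t)\<^sup>2) has_integral integral {0..T} (\<lambda>t. (x \<bullet> w t)\<^sup>2)) {0..T}" for x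
    using i[of x x] by (simp add: power2_eq_square integrable_integral)
  have "(\<lambda>t. ((b + h) \<bullet> w t)\<^sup>2) = (\<lambda>t. (b \<bullet> w t)\<^sup>2 + 2 * ((b \<bullet> w t) * (h \<bullet> w t)) + (h \<bullet> w t)\<^sup>2)"
    by (auto simp: inner_add_left power2_eq_square algebra_simps)
  then have "integral {0..T} (\<lambda>t. ((b + h) \<bullet> w t)\<^sup>2) =
      integral {0..T} (\<lambda>t. (b \<bullet> w t)\<^sup>2) + 2 * integral {0..T} (\<lambda>t. (b \<bullet> w t) * (h \<bullet> w t))
      + integral {0..T} (\<lambda>t. (h \<bullet> w t)\<^sup>2)"
    by (simp only:) (intro integral_unique has_integral_add has_integral_mult_right sq integrable_integral i)
  then have eq: "1 / 2 * integral {0..T} (\<lambda>t. ((b + h) \<bullet> w t)\<^sup>2) - 1 / 2 * integral {0..T} (\<lambda>t. (b \<bullet> w t)\<^sup>2)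
      - integral {0..T} (\<lambda>t. (b \<bullet> w t) * (h \<bullet> w t)) = 1 / 2 * integral {0..T} (\<lambda>t. (h \<bullet> w t)\<^sup>2)"
    by (simp add: algebra_simps)
  have wint: "(\<lambda>t. (norm (w t))\<^sup>2) integrable_on {0..T}"
  proof -
    have "(\<lambda>t. (norm (w t))\<^sup>2) = (\<lambda>t. \<Sum>b\<in>Basis. (b \<bullet> w t) * (b \<bullet> w t))"
      by (simp add: power2_norm_eq_inner euclidean_inner[of "w _" "w _"] inner_commute)
    moreover have "\<dots> integrable_on {0..T}" by (intro integrable_sum i) auto
    ultimately show ?thesis by simp
  qed
  have "integral {0..T} (\<lambda>t. (h \<bullet> w t)\<^sup>2) \<le> integral {0..T} (\<lambda>t. (norm h)\<^sup>2 * (norm (w t))\<^sup>2)"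
  proof (rule integral_le)
    show "(h \<bullet> w t)\<^sup>2 \<le> (norm h)\<^sup>2 * (norm (w t))\<^sup>2" for t
      using Cauchy_Schwarz_ineq2[of h "w t"] unfolding power_mult_distrib[symmetric]
      by (intro abs_le_square_iff[THEN iffD1]) simp
  qed (use sq wint in \<open>auto intro: integrable_on_mult_right has_integral_integrable\<close>)
  also have "\<dots> = integral {0..T} (\<lambda>t. (norm (w t))\<^sup>2) * (norm h)\<^sup>2" by simp
  finally have "1 / 2 * integral {0..T} (\<lambda>t. (h \<bullet> w t)\<^sup>2)
      \<le> (1 / 2 * integral {0..T} (\<lambda>t. (norm (w t))\<^sup>2)) * (norm h)\<^sup>2" by simp
  moreover have "0 \<le> integral {0..T} (\<lambda>t. (h \<bullet> w t)\<^sup>2)"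
    by (rule has_integral_nonneg[OF sq]) simp
  ultimately show "\<bar>1 / 2 * integral {0..T} (\<lambda>t. ((b + h) \<bullet> w t)\<^sup>2) - 1 / 2 * integral {0..T} (\<lambda>t. (b \<bullet> w t)\<^sup>2)
      - integral {0..T} (\<lambda>t. (b \<bullet> w t) * (h \<bullet> w t))\<bar>
      \<le> (1 / 2 * integral {0..T} (\<lambda>t. (norm (w t))\<^sup>2)) * (norm h)\<^sup>2"
    unfolding eq by simp
qed

lemma L2_integral_square_eq_0:
  assumes v: "v \<in> L2_controls T" and 0: "integral {0..T} (\<lambda>t. (v t)\<^sup>2) = 0"
  obtains N where "negligible N" "\<And>t. t \<in> {0..T} - N \<Longrightarrow> v t = 0"
proof -
  have "integrable (lebesgue_on {0..T}) (\<lambda>t. (v t)\<^sup>2)" using v by (simp add: L2_controls_def)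
  moreover from this have "integral\<^sup>L (lebesgue_on {0..T}) (\<lambda>t. (v t)\<^sup>2) = 0"
    using 0 lebesgue_integral_eq_integral[of "{0..T}" "\<lambda>t. (v t)\<^sup>2"] by simp
  ultimately have "AE t in lebesgue_on {0..T}. (v t)\<^sup>2 = 0"
    by (subst (asm) integral_nonneg_eq_0_iff_AE) auto
  then have "AE t in lebesgue_on {0..T}. v t = 0" by simp
  then show thesis by (rule AE_lebesgue_on_intervalE) (rule that)
qed

text \<open>Let \<open>g1 t\<close> and \<open>g2 t\<close> be the integrals of \<open>- sin \<theta>\<close> and \<open>cos \<theta>\<close> from \<open>t\<close> to \<open>T\<close>. The function \<open>F\<close>
sends the coefficients \<open>b\<close> of a control \<open>b \<bullet> w\<close>, where \<open>w = (u, g1, g2, 1)\<close>, to its energy and end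
point. Integration by parts shows that the derivative of \<open>F\<close> at \<open>e\<close>, the coefficients of \<open>u\<close>
itself, is the Gram matrix of \<open>u, g1, g2, 1\<close>. If it were invertible, \<open>F\<close> would be open at \<open>e\<close> and the energy could be
lowered with the end point fixed. So it is singular, and a vector in its kernel is a linear
relation between the four functions.\<close>

lemma optimal_control_multipliers:
  assumes T: "0 < T" and opt: "optimal_pair q0 q1 T u q"
  obtains N and a0 a1 a2 a3 :: real where "negligible N" "(a0, a1, a2, a3) \<noteq> 0"
    "\<And>t. t \<in> {0..T} - N \<Longrightarrow> a0 * u t + a1 * integral {t..T} (\<lambda>s. - sin (heading q0 u s))
      + a2 * integral {t..T} (\<lambda>s. cos (heading q0 u s)) + a3 = 0"
proof -
  have u: "u \<in> L2_controls T" and end_u: "steered_curve q0 u T = q1"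
    and min: "\<And>v. v \<in> L2_controls T \<Longrightarrow> steered_curve q0 v T = q1 \<Longrightarrow>
      integral {0..T} (\<lambda>t. (u t)\<^sup>2) \<le> integral {0..T} (\<lambda>t. (v t)\<^sup>2)"
    using opt T by (auto simp: optimal_pair_iff)
  define \<theta> where "\<theta> = heading q0 u"
  have \<theta>: "continuous_on {0..T} \<theta>" unfolding \<theta>_def by (rule continuous_heading[OF u])
  define f1 f2 where "f1 = (\<lambda>s. - sin (\<theta> s))" and "f2 = (\<lambda>s. cos (\<theta> s))"
  have f: "continuous_on {0..T} f1" "continuous_on {0..T} f2"
    unfolding f1_def f2_def by (intro continuous_intros \<theta>)+
  define g1 g2 where "g1 = (\<lambda>t. integral {t..T} f1)" and "g2 = (\<lambda>t. integral {t..T} f2)"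
  have contg: "continuous_on {0..T} g1" "continuous_on {0..T} g2"
    unfolding g1_def g2_def by (intro continuous_on_integral_tail f)+
  have g: "g1 \<in> L2_controls T" "g2 \<in> L2_controls T" by (intro L2_continuous contg)+
  have one: "(\<lambda>t. 1) \<in> L2_controls T" by (rule L2_const)
  define w :: "real \<Rightarrow> real \<times> real \<times> real \<times> real" where "w = (\<lambda>t. (u t, g1 t, g2 t, 1))"
  define W where "W = (\<lambda>t. (integral {0..t} u, integral {0..t} g1, integral {0..t} g2, t))"
  have inner_w: "b \<bullet> w t = fst b * u t + (fst (snd b) * g1 t + (fst (snd (snd b)) * g2 t + snd (snd (snd b)) * 1))" for b t
    by (cases b) (simp add: w_def)
  have w: "(\<lambda>t. b \<bullet> w t) \<in> L2_controls T" for b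
    unfolding inner_w by (intro L2_add L2_scale u g one)
  have contW: "continuous_on {0..T} W"
    unfolding W_def
    by (intro continuous_intros indefinite_integral_continuous_1 L2_integrable u g)
  have inner_W: "integral {0..t} (\<lambda>s. b \<bullet> w s) = b \<bullet> W t" if t: "t \<in> {0..T}" for b t
  proof -
    have sub: "(v has_integral integral {0..t} v) {0..t}" if "v \<in> L2_controls T" for v
      using integrable_subinterval_real[OF L2_integrable[OF that], of 0 t] t by auto
    have one_t: "integral {0..t} (\<lambda>s. 1) = t" using t by simp
    have "integral {0..t} (\<lambda>s. b \<bullet> w s) = fst b * integral {0..t} u + (fst (snd b) * integral {0..t} g1 +
        (fst (snd (snd b)) * integral {0..t} g2 + snd (snd (snd b)) * integral {0..t} (\<lambda>s. 1)))"
      unfolding inner_w by (intro integral_unique has_integral_add has_integral_mult_right sub u g one)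
    then show ?thesis unfolding one_t by (cases b) (simp add: W_def)
  qed
  define c where "c = rep_angle (snd (snd q0))"
  have head: "heading q0 (\<lambda>t. b \<bullet> w t) t = c + b \<bullet> W t" if "t \<in> {0..T}" for b t
    using inner_W[OF that] by (simp add: heading_def c_def)
  define e :: "real \<times> real \<times> real \<times> real" where "e = (1, 0, 0, 0)"
  have e_w: "(\<lambda>t. e \<bullet> w t) = u" by (simp add: e_def w_def)
  have e_W: "\<theta> t = c + e \<bullet> W t" if "t \<in> {0..T}" for t
    using head[OF that, of e] unfolding e_w \<theta>_def .
  define F where "F = (\<lambda>b. (1 / 2 * integral {0..T} (\<lambda>t. (b \<bullet> w t)\<^sup>2),
      integral {0..T} (\<lambda>t. cos (c + b \<bullet> W t)), integral {0..T} (\<lambda>t. sin (c + b \<bullet> W t)), b \<bullet> W T))"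
  define F' where "F' = (\<lambda>b h. (integral {0..T} (\<lambda>t. (b \<bullet> w t) * (h \<bullet> w t)),
      integral {0..T} (\<lambda>t. - sin (c + b \<bullet> W t) * (h \<bullet> W t)),
      integral {0..T} (\<lambda>t. cos (c + b \<bullet> W t) * (h \<bullet> W t)), h \<bullet> W T))"
  have dF: "(F has_derivative F' b) (at b)" for b
    unfolding F_def F'_def
    by (intro has_derivative_Pair has_derivative_L2_energy[OF w] has_derivative_integral_cos[OF _ contW]
        has_derivative_integral_sin[OF _ contW] bounded_linear_imp_has_derivative[OF bounded_linear_inner_left]) auto
  have contF: "continuous_on UNIV F"
    using dF by (intro continuous_at_imp_continuous_on ballI) (blast intro: has_derivative_continuous)
  define P where "P = (\<lambda>g h. integral {0..T} (\<lambda>t. g t * (h \<bullet> w t)))"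
  \<comment> \<open>This identifies the derivative of \<open>F\<close> at \<open>e\<close> with the Gram matrix.\<close>
  have L: "F' e h = (P u h, P g1 h, P g2 h, P (\<lambda>t. 1) h)" for h
  proof -
    have parts: "integral {0..T} (\<lambda>t. f t * (h \<bullet> W t)) = P (\<lambda>s. integral {s..T} f) h"
      if "continuous_on {0..T} f" for f
    proof -
      have "integral {0..T} (\<lambda>t. f t * (h \<bullet> W t)) = integral {0..T} (\<lambda>t. f t * integral {0..t} (\<lambda>s. h \<bullet> w s))"
        by (rule Henstock_Kurzweil_Integration.integral_cong) (simp only: inner_W)
      also have "\<dots> = P (\<lambda>s. integral {s..T} f) h"
        unfolding P_def using T that L2_absolutely_integrable[OF w[of h]]
        by (intro integral_by_parts_primitive) auto
      finally show ?thesis .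
    qed
    have "integral {0..T} (\<lambda>t. - sin (c + e \<bullet> W t) * (h \<bullet> W t)) = integral {0..T} (\<lambda>t. f1 t * (h \<bullet> W t))"
      by (rule Henstock_Kurzweil_Integration.integral_cong) (simp only: f1_def e_W)
    moreover have "integral {0..T} (\<lambda>t. cos (c + e \<bullet> W t) * (h \<bullet> W t)) = integral {0..T} (\<lambda>t. f2 t * (h \<bullet> W t))"
      by (rule Henstock_Kurzweil_Integration.integral_cong) (simp only: f2_def e_W)
    moreover have "h \<bullet> W T = P (\<lambda>t. 1) h" using inner_W[of T h] T by (simp add: P_def)
    moreover have "integral {0..T} (\<lambda>t. (e \<bullet> w t) * (h \<bullet> w t)) = P u h"
      unfolding P_def using fun_cong[OF e_w] by simp
    ultimately show ?thesis
      unfolding F'_def using parts[OF f(1)] parts[OF f(2)] by (simp only: g1_def g2_def)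
  qed
  have quad: "h \<bullet> F' e h = integral {0..T} (\<lambda>t. (h \<bullet> w t)\<^sup>2)" for h
  proof -
    have Pi: "((\<lambda>t. g t * (h \<bullet> w t)) has_integral P g h) {0..T}" if "g \<in> L2_controls T" for g
      unfolding P_def by (rule integrable_integral[OF L2_mult_integrable[OF that w]])
    have sq: "(h \<bullet> w t)\<^sup>2 = fst h * (u t * (h \<bullet> w t)) + (fst (snd h) * (g1 t * (h \<bullet> w t)) +
       (fst (snd (snd h)) * (g2 t * (h \<bullet> w t)) + snd (snd (snd h)) * (1 * (h \<bullet> w t))))" for t
      unfolding power2_eq_square by (subst (1) inner_w) (simp add: algebra_simps)
    have "integral {0..T} (\<lambda>t. (h \<bullet> w t)\<^sup>2) = fst h * P u h + (fst (snd h) * P g1 h +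
       (fst (snd (snd h)) * P g2 h + snd (snd (snd h)) * P (\<lambda>t. 1) h))"
      unfolding sq by (intro integral_unique has_integral_add has_integral_mult_right Pi u g one)
    then show ?thesis unfolding L by (cases h) simp
  qed
  have lin: "linear (F' e)"
    using has_derivative_linear[OF dF] .
  have "\<not> inj (F' e)"
  proof
    assume "inj (F' e)"
    then obtain f' where f': "linear f'" "\<And>x. F' e (f' x) = x"
      using linear_injective_isomorphism[OF lin] by blast
    \<comment> \<open>Surjectivity of the derivative at the single point \<open>e\<close> suffices, by a Brouwer argument.\<close>
    have "F e \<in> interior (F ` UNIV)"
      by (rule sussmann_open_mapping[OF open_UNIV contF UNIV_I dF, of f'])
        (use f' in \<open>auto simp: linear_conv_bounded_linear\<close>)
    then obtain d where d: "d > 0" "ball (F e) d \<subseteq> range F" unfolding mem_interior by blast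
    have "F e - (d / 2, 0, 0, 0) \<in> ball (F e) d"
      using d(1) by (simp add: dist_norm norm_Pair)
    then obtain b where b: "F b = F e - (d / 2, 0, 0, 0)" using d(2) by (metis (no_types, lifting) rangeE subsetD)
    define v where "v = (\<lambda>t. b \<bullet> w t)"
    have v: "v \<in> L2_controls T" unfolding v_def by (rule w)
    have Fv: "F b = (1 / 2 * integral {0..T} (\<lambda>t. (v t)\<^sup>2), integral {0..T} (\<lambda>t. cos (heading q0 v t)),
        integral {0..T} (\<lambda>t. sin (heading q0 v t)), heading q0 v T - c)"
      unfolding F_def v_def using T
      by (auto simp: head intro!: Henstock_Kurzweil_Integration.integral_cong)
    have Fu: "F e = (1 / 2 * integral {0..T} (\<lambda>t. (u t)\<^sup>2), integral {0..T} (\<lambda>t. cos (\<theta> t)),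
        integral {0..T} (\<lambda>t. sin (\<theta> t)), \<theta> T - c)"
      unfolding F_def using T fun_cong[OF e_w]
      by (auto simp: e_W intro!: Henstock_Kurzweil_Integration.integral_cong)
    have "steered_curve q0 v T = steered_curve q0 u T"
      using b unfolding Fv Fu steered_curve_def \<theta>_def[symmetric] by simp
    then have "integral {0..T} (\<lambda>t. (u t)\<^sup>2) \<le> integral {0..T} (\<lambda>t. (v t)\<^sup>2)"
      using min[OF v] end_u by simp
    then show False using b d(1) unfolding Fv Fu by simp
  qed
  then obtain h where h: "h \<noteq> 0" "F' e h = 0"
    using linear_injective_0[OF lin] by blast
  have "integral {0..T} (\<lambda>t. (h \<bullet> w t)\<^sup>2) = 0" using quad[of h] h by simp
  then obtain N where N: "negligible N" "\<And>t. t \<in> {0..T} - N \<Longrightarrow> h \<bullet> w t = 0"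
    by (rule L2_integral_square_eq_0[OF w]) (rule that)
  show thesis
  proof (rule that[OF N(1), of "fst h" "fst (snd h)" "fst (snd (snd h))" "snd (snd (snd h))"])
    show "(fst h, fst (snd h), fst (snd (snd h)), snd (snd (snd h))) \<noteq> 0" using h by simp
    show "fst h * u t + fst (snd h) * integral {t..T} (\<lambda>s. - sin (heading q0 u s))
      + fst (snd (snd h)) * integral {t..T} (\<lambda>s. cos (heading q0 u s)) + snd (snd (snd h)) = 0"
      if "t \<in> {0..T} - N" for t
      using N(2)[OF that] unfolding inner_w g1_def g2_def f1_def f2_def \<theta>_def by simp
  qed
qed

section \<open>The maximum principle and regularity\<close>

lemma pmp_hamiltonian_eq:
  "pmp_hamiltonian \<nu> u (q, p) = p \<bullet> elastic_rhs q u + \<nu> / 2 * u\<^sup>2"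
  by (cases q; cases p) (simp add: pmp_hamiltonian_def linear_hamiltonian_def X2_def)

text \<open>The Hamiltonian is affine in \<open>p\<close>, and only the angle enters it as a base coordinate, so both sums
over the basis expand a fixed vector in coordinates.\<close>

lemma hamiltonian_vector_field_pmp:
  "hamiltonian_vector_field (pmp_hamiltonian \<nu> u) ((x, y, \<theta>), (p1, p2, p3)) =
    (elastic_rhs (x, y, \<theta>) u, (0, 0, p1 * sin_circle \<theta> - p2 * cos_circle \<theta>))"
proof -
  let ?q = "(x, y, \<theta>)" and ?p = "(p1, p2, p3) :: covector"
  let ?z = "(0, 0, p2 * cos_circle \<theta> - p1 * sin_circle \<theta>) :: tangent"
  have dp: "deriv (\<lambda>s::real. pmp_hamiltonian \<nu> u (?q, ?p + s *\<^sub>R b)) 0 = elastic_rhs ?q u \<bullet> b" for b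
  proof (rule DERIV_imp_deriv)
    show "((\<lambda>s. pmp_hamiltonian \<nu> u (?q, ?p + s *\<^sub>R b)) has_field_derivative elastic_rhs ?q u \<bullet> b) (at 0)"
      unfolding pmp_hamiltonian_eq inner_add_left inner_scaleR_left
      by (rule derivative_eq_intros refl)+ (simp add: inner_commute)
  qed
  have dq: "deriv (\<lambda>s::real. pmp_hamiltonian \<nu> u (?q + covering (s *\<^sub>R b), ?p)) 0 = ?z \<bullet> b" for b
  proof (rule DERIV_imp_deriv)
    obtain b1 b2 b3 where b: "b = (b1, b2, b3)" by (cases b)
    define a where "a = rep_angle \<theta>"
    have \<theta>: "\<theta> = angle a" by (simp add: a_def)
    have "pmp_hamiltonian \<nu> u (?q + covering (s *\<^sub>R b), ?p) =
        p1 * cos (a + s * b3) + p2 * sin (a + s * b3) + p3 * u + \<nu> / 2 * u\<^sup>2" for s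
      unfolding pmp_hamiltonian_eq b \<theta>
      by (simp add: covering_def plus_circle.abs_eq)
    moreover have "((\<lambda>s. p1 * cos (a + s * b3) + p2 * sin (a + s * b3) + p3 * u + \<nu> / 2 * u\<^sup>2)
        has_field_derivative ?z \<bullet> b) (at 0)"
      unfolding b \<theta> by (auto intro!: derivative_eq_intros simp: algebra_simps)
    ultimately show "((\<lambda>s. pmp_hamiltonian \<nu> u (?q + covering (s *\<^sub>R b), ?p)) has_field_derivative ?z \<bullet> b) (at 0)"
      by simp
  qed
  have "- ?z = (0, 0, p1 * sin_circle \<theta> - p2 * cos_circle \<theta>)" by simp
  then show ?thesis
    unfolding hamiltonian_vector_field_def prod.case dp dq euclidean_representation by simp
qed

text \<open>The Hamiltonian is a concave quadratic polynomial in the control, hence maximal where its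
derivative vanishes; for \<open>\<nu> = 0\<close> stationarity makes it independent of the control.\<close>

lemma pmp_maximum_if_stationary:
  assumes \<nu>: "\<nu> \<le> 0" and stat: "\<nu> * u + snd (snd p) = 0"
  shows "pmp_hamiltonian \<nu> v (q, p) \<le> pmp_hamiltonian \<nu> u (q, p)"
proof -
  obtain x y \<theta> p1 p2 p3 where eq: "q = (x, y, \<theta>)" "p = (p1, p2, p3)" by (cases q; cases p)
  have p3: "p3 = - \<nu> * u" using stat by (simp add: eq)
  have "pmp_hamiltonian \<nu> u (q, p) - pmp_hamiltonian \<nu> v (q, p) = - \<nu> / 2 * (u - v)\<^sup>2"
    unfolding pmp_hamiltonian_eq eq p3 by (simp add: power2_eq_square field_simps)
  moreover have "0 \<le> - \<nu> / 2 * (u - v)\<^sup>2" using \<nu> by (simp add: mult_nonpos_nonneg)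
  ultimately show ?thesis by linarith
qed

text \<open>The third component of the solution of the adjoint equation with value \<open>(a1, a2, a3)\<close> at time
\<open>T\<close>; the first two components are constant.\<close>

definition switching_function :: "manifold \<Rightarrow> (real \<Rightarrow> real) \<Rightarrow> real \<Rightarrow> real \<Rightarrow> real \<Rightarrow> real \<Rightarrow> real \<Rightarrow> real" where
  "switching_function q u T a1 a2 a3 t = a1 * integral {t..T} (\<lambda>s. - sin (heading q u s))
     + a2 * integral {t..T} (\<lambda>s. cos (heading q u s)) + a3"

lemma switching_function_has_derivative:
  assumes u: "u \<in> L2_controls T" and t: "t \<in> {0..T}"
  shows "(switching_function q u T a1 a2 a3 has_vector_derivative
    a1 * sin (heading q u t) - a2 * cos (heading q u t)) (at t within {0..T})"
proof -
  note h = continuous_heading[OF u, of q]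
  have c: "continuous_on {0..T} (\<lambda>s. - sin (heading q u s))" "continuous_on {0..T} (\<lambda>s. cos (heading q u s))"
    by (intro continuous_intros h)+
  note scaled = bounded_linear.has_vector_derivative[OF bounded_linear_scaleR_right integral_tail_has_derivative[OF _ t]]
  from has_vector_derivative_add[OF has_vector_derivative_add[OF scaled[OF c(1), of a1] scaled[OF c(2), of a2]]
      has_vector_derivative_const[of a3]]
  show ?thesis unfolding switching_function_def by simp
qed

lemma pmp_lift_if_multipliers:
  assumes u: "u \<in> L2_controls T" and q: "trajectory T u q" and \<nu>: "\<nu> \<le> 0"
    and nz: "(\<nu>, a1, a2, a3) \<noteq> 0" and N: "negligible N"
    and stat: "\<And>t. t \<in> {0..T} - N \<Longrightarrow> \<nu> * u t + switching_function (q 0) u T a1 a2 a3 t = 0"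
  shows "pmp_lift T u q \<nu> (\<lambda>t. (q t, (a1, a2, switching_function (q 0) u T a1 a2 a3 t)))"
proof -
  define p3 where "p3 = switching_function (q 0) u T a1 a2 a3"
  let ?\<xi> = "\<lambda>t. (q t, (a1, a2, p3 t))"
  note dp3 = switching_function_has_derivative[OF u, of _ "q 0" a1 a2 a3, folded p3_def]
  have lip: "\<bar>p3 s - p3 t\<bar> \<le> (\<bar>a1\<bar> + \<bar>a2\<bar>) * \<bar>s - t\<bar>" if "s \<in> {0..T}" "t \<in> {0..T}" for s t
  proof (rule field_differentiable_bound[of "{0..T}", unfolded real_norm_def])
    show "(p3 has_field_derivative a1 * sin (heading (q 0) u r) - a2 * cos (heading (q 0) u r)) (at r within {0..T})"
      if "r \<in> {0..T}" for r
      using dp3[OF that] by (simp add: has_real_derivative_iff_has_vector_derivative)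
    show "\<bar>a1 * sin (heading (q 0) u r) - a2 * cos (heading (q 0) u r)\<bar> \<le> \<bar>a1\<bar> + \<bar>a2\<bar>" for r
    proof (rule order_trans[OF abs_triangle_ineq4 add_mono])
      show "\<bar>a1 * sin (heading (q 0) u r)\<bar> \<le> \<bar>a1\<bar>" "\<bar>a2 * cos (heading (q 0) u r)\<bar> \<le> \<bar>a2\<bar>"
        unfolding abs_mult by (intro mult_left_le abs_sin_le_one abs_cos_le_one abs_ge_zero)+
    qed
  qed (use that in auto)
  have acp: "abs_continuous_on {0..T} p3"
  proof (rule abs_continuous_onI_integral_bound[where g = "\<lambda>_. \<bar>a1\<bar> + \<bar>a2\<bar>"])
    show "dist (p3 s) (p3 t) \<le> integral {s..t} (\<lambda>_. \<bar>a1\<bar> + \<bar>a2\<bar>)" if "0 \<le> s" "s \<le> t" "t \<le> T" for s t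
      using lip[of s t] that by (simp add: dist_real_def mult.commute)
  qed auto
  have acq: "abs_continuous_on {0..T} q" using q by (simp add: trajectory_def)
  have ac: "abs_continuous_on {0..T} ?\<xi>"
  proof (rule abs_continuous_on_dominated[OF acq acp])
    show "dist (?\<xi> s) (?\<xi> t) \<le> dist (q s) (q t) + dist (p3 s) (p3 t)" for s t
      using dist_prod_le_add[of "q s" "(a1, a2, p3 s)" "q t" "(a1, a2, p3 t)"] by (simp add: dist_Pair_Pair)
  qed
  obtain N' where N': "negligible N'"
    "\<And>t. t \<in> {0..T} - N' \<Longrightarrow> has_velocity q (elastic_rhs (q t) (u t)) t {0..T}"
    by (rule AE_lebesgue_on_intervalE[OF conjunct2[OF q[unfolded trajectory_def]]]) (rule that)
  have "has_cotangent_velocity ?\<xi> (hamiltonian_vector_field (pmp_hamiltonian \<nu> (u t)) (?\<xi> t)) t {0..T} \<and>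
        (\<forall>v. pmp_hamiltonian \<nu> v (?\<xi> t) \<le> pmp_hamiltonian \<nu> (u t) (?\<xi> t)) \<and> (\<nu>, snd (?\<xi> t)) \<noteq> 0"
    if t: "t \<in> {0..T} - (N \<union> N')" for t
  proof (intro conjI allI)
    have qt: "q t = (fst (q t), fst (snd (q t)), angle (heading (q 0) u t))"
      using trajectory_eq_steered_curve[OF u q, of t] t by (simp add: steered_curve_def)
    have field: "hamiltonian_vector_field (pmp_hamiltonian \<nu> (u t)) (?\<xi> t) = (elastic_rhs (q t) (u t),
        (0, 0, a1 * sin (heading (q 0) u t) - a2 * cos (heading (q 0) u t)))"
    proof -
      obtain x y where xy: "q t = (x, y, angle (heading (q 0) u t))" using qt by blast
      show ?thesis unfolding xy hamiltonian_vector_field_pmp by simp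
    qed
    show "has_cotangent_velocity ?\<xi> (hamiltonian_vector_field (pmp_hamiltonian \<nu> (u t)) (?\<xi> t)) t {0..T}"
      unfolding has_cotangent_velocity_def field fst_conv snd_conv
      using t by (intro conjI N'(2) has_vector_derivative_Pair has_vector_derivative_const dp3) auto
    show "pmp_hamiltonian \<nu> v (?\<xi> t) \<le> pmp_hamiltonian \<nu> (u t) (?\<xi> t)" for v
      using stat[of t] t by (intro pmp_maximum_if_stationary[OF \<nu>]) (simp add: p3_def)
    show "(\<nu>, snd (?\<xi> t)) \<noteq> 0"
      using nz by (auto simp: p3_def switching_function_def zero_prod_def)
  qed
  moreover have "negligible (N \<union> N')" using N N' by (intro negligible_Un)
  ultimately have ae: "AE t in lebesgue_on {0..T}.
      has_cotangent_velocity ?\<xi> (hamiltonian_vector_field (pmp_hamiltonian \<nu> (u t)) (?\<xi> t)) t {0..T} \<and>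
      (\<forall>v. pmp_hamiltonian \<nu> v (?\<xi> t) \<le> pmp_hamiltonian \<nu> (u t) (?\<xi> t)) \<and> (\<nu>, snd (?\<xi> t)) \<noteq> 0"
    by (intro AE_lebesgue_on_intervalI[where N = "N \<union> N'"])
  show ?thesis
    unfolding pmp_lift_def p3_def[symmetric]
    by (intro conjI ac ae \<nu>) (simp add: bundle_proj_def)
qed

text \<open>The maximum principle fixes the sign of the coefficient of the control, which is achieved by
negating the relation if necessary.\<close>

lemma optimal_control_stationary:
  assumes T: "0 < T" and opt: "optimal_pair q0 q1 T u q"
  obtains N \<nu> a1 a2 a3 where "negligible N" "\<nu> \<le> 0" "(\<nu>, a1, a2, a3) \<noteq> 0"
    "\<And>t. t \<in> {0..T} - N \<Longrightarrow> \<nu> * u t + switching_function q0 u T a1 a2 a3 t = 0"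
proof -
  obtain N and b0 b1 b2 b3 :: real where N: "negligible N" and nz: "(b0, b1, b2, b3) \<noteq> 0"
    and stat: "\<And>t. t \<in> {0..T} - N \<Longrightarrow> b0 * u t + b1 * integral {t..T} (\<lambda>s. - sin (heading q0 u s))
      + b2 * integral {t..T} (\<lambda>s. cos (heading q0 u s)) + b3 = 0"
    by (rule optimal_control_multipliers[OF T opt]) (rule that)
  show thesis
  proof (cases "b0 \<le> 0")
    case True
    moreover have "b0 * u t + switching_function q0 u T b1 b2 b3 t = 0" if "t \<in> {0..T} - N" for t
      using stat[OF that] unfolding switching_function_def by linarith
    ultimately show thesis by (intro that[OF N _ nz])
  next
    case False
    have "- b0 * u t + switching_function q0 u T (- b1) (- b2) (- b3) t = 0" if "t \<in> {0..T} - N" for t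
      using stat[OF that] unfolding switching_function_def by linarith
    moreover have "(- b0, - b1, - b2, - b3) \<noteq> 0" using nz by (auto simp: zero_prod_def)
    ultimately show thesis using False by (intro that[OF N]) auto
  qed
qed

text \<open>A nonzero coefficient \<open>\<nu>\<close> expresses the control almost everywhere through the switching function, which is
continuous and hence bounded.\<close>

lemma normal_optimal_control_regularity:
  assumes u: "u \<in> L2_controls T" and q: "trajectory T u q" and N: "negligible N" and \<nu>: "\<nu> \<noteq> 0"
    and stat: "\<And>t. t \<in> {0..T} - N \<Longrightarrow> \<nu> * u t + switching_function (q 0) u T a1 a2 a3 t = 0"
  shows "u \<in> Linf_controls T \<and> (\<exists>L. L-lipschitz_on {0..T} q)"
proof -
  define p3 where "p3 = switching_function (q 0) u T a1 a2 a3"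
  have contp: "continuous_on {0..T} p3"
    unfolding p3_def continuous_on_eq_continuous_within
    by (rule ballI, rule has_vector_derivative_continuous, erule switching_function_has_derivative[OF u])
  obtain B where B: "\<And>t. t \<in> {0..T} \<Longrightarrow> \<bar>p3 t\<bar> \<le> B"
    by (rule continuous_on_Icc_norm_bounded[OF contp, unfolded real_norm_def]) (rule that)
  define C where "C = \<bar>B\<bar> / \<bar>\<nu>\<bar>"
  have bound: "\<bar>u t\<bar> \<le> C" if t: "t \<in> {0..T} - N" for t
  proof -
    have "u t = - p3 t / \<nu>" using stat[OF t] \<nu> by (simp add: p3_def field_simps)
    then have "\<bar>u t\<bar> = \<bar>p3 t\<bar> / \<bar>\<nu>\<bar>" by simp
    also have "\<dots> \<le> C" unfolding C_def using B[of t] t \<nu> by (intro divide_right_mono) auto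
    finally show ?thesis .
  qed
  have C0: "0 \<le> C" by (simp add: C_def)
  have ae: "AE t in lebesgue_on {0..T}. \<bar>u t\<bar> \<le> C"
    by (rule AE_lebesgue_on_intervalI[OF N]) (rule bound)
  have "u \<in> Linf_controls T"
    using u ae unfolding Linf_controls_def L2_controls_def by blast
  moreover have dist_le: "dist (q s) (q t) \<le> (2 + C) * (t - s)" if st: "0 \<le> s" "s \<le> t" "t \<le> T" for s t
  proof -
    have "dist (q s) (q t) \<le> integral {s..t} (\<lambda>r. 2 + \<bar>u r\<bar>)"
      using dist_steered_curve_le[OF u st, of "q 0"]
        trajectory_eq_steered_curve[OF u q, of s] trajectory_eq_steered_curve[OF u q, of t] st by simp
    also have "\<dots> = integral {s..t} (\<lambda>r. if r \<in> N then 0 else 2 + \<bar>u r\<bar>)"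
      by (rule integral_spike[OF N]) simp
    also have "\<dots> \<le> integral {s..t} (\<lambda>r. 2 + C)"
    proof (rule integral_le)
      have "(\<lambda>r. 2 + \<bar>u r\<bar>) integrable_on {s..t}"
        using integrable_subinterval_real[OF L2_abs_integrable[OF u], of s t] st
        by (intro integrable_add) auto
      then show "(\<lambda>r. if r \<in> N then 0 else 2 + \<bar>u r\<bar>) integrable_on {s..t}"
        by (rule integrable_spike[OF _ N]) simp
    qed (use bound C0 st in auto)
    also have "\<dots> = (2 + C) * (t - s)" using st by simp
    finally show ?thesis .
  qed
  have "(2 + C)-lipschitz_on {0..T} q"
  proof (rule lipschitz_onI)
    fix s t assume "s \<in> {0..T}" "t \<in> {0..T}"
    then show "dist (q s) (q t) \<le> (2 + C) * dist s t"
      using dist_le[of s t] dist_le[of t s]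
      by (cases "s \<le> t") (auto simp: dist_real_def dist_commute)
  qed (use C0 in simp)
  ultimately show ?thesis by blast
qed

theorem theorem5p3:
  fixes q0 q1 :: manifold and t1 :: real
  assumes "0 < t1" and "q1 \<in> attainable_set q0 t1"
  shows "(\<exists>u. optimal_control q0 q1 t1 u) \<and>
    (\<forall>u q. optimal_pair q0 q1 t1 u q \<and> \<not> abnormal_extremal_control q0 t1 u \<longrightarrow>
       u \<in> Linf_controls t1 \<and> (\<exists>L. L-lipschitz_on {0..t1} q)) \<and>
    (\<forall>u q. optimal_pair q0 q1 t1 u q \<longrightarrow> satisfies_pmp t1 u q)"
proof -
  have main: "satisfies_pmp t1 u q \<and> (\<not> abnormal_extremal_control q0 t1 u \<longrightarrow>
      u \<in> Linf_controls t1 \<and> (\<exists>L. L-lipschitz_on {0..t1} q))"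
    if opt: "optimal_pair q0 q1 t1 u q" for u q
  proof -
    have u: "u \<in> L2_controls t1" and q: "trajectory t1 u q" "q 0 = q0"
      using opt assms(1) by (auto simp: optimal_pair_iff)
    obtain N \<nu> a1 a2 a3 where m: "negligible N" "\<nu> \<le> 0" "(\<nu>, a1, a2, a3) \<noteq> 0"
      "\<And>t. t \<in> {0..t1} - N \<Longrightarrow> \<nu> * u t + switching_function q0 u t1 a1 a2 a3 t = 0"
      by (rule optimal_control_stationary[OF assms(1) opt]) (rule that)
    note stat = m(4)[folded q(2)]
    have lift: "pmp_lift t1 u q \<nu> (\<lambda>t. (q t, (a1, a2, switching_function (q 0) u t1 a1 a2 a3 t)))"
      by (rule pmp_lift_if_multipliers[OF u q(1) m(2,3,1) stat])
    have "u \<in> Linf_controls t1 \<and> (\<exists>L. L-lipschitz_on {0..t1} q)"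
      if "\<not> abnormal_extremal_control q0 t1 u"
    proof -
      have "\<nu> \<noteq> 0" using lift that q unfolding abnormal_extremal_control_def by blast
      then show ?thesis by (rule normal_optimal_control_regularity[OF u q(1) m(1) _ stat])
    qed
    then show ?thesis using lift unfolding satisfies_pmp_def by blast
  qed
  then show ?thesis using exists_optimal_control[OF assms] by blast
qed

end
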